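(* Let $\rho$ be a state on $\mathbb{C}^3\otimes\mathbb{C}^3$ with spectral decomposition $$\rho=p|u_1\rangle\langle u_1|+(1-p)|u_2\rangle\langle u_2|\qquad(0<p<1),$$ where $$|u_1\rangle=\frac{1}{\sqrt2}(|01\rangle-|10\rangle),\qquad |u_2\rangle=\frac1{\sqrt2}(|ab\rangle-|ba\rangle)$$ for some vectors $|a\rangle,|b\rangle\in\mathbb{C}^3$, with $|u_2\rangle$ a unit vector and $\langle u_1|u_2\rangle=0$. Then $$E_D(\rho)<1=E_C(\rho),$$ where $E_D$ and $E_C$ are the distillable entanglement and the entanglement cost under PPT operations.
   Context: $\{|0\rangle,|1\rangle,|2\rangle\}$ is the standard orthonormal basis of $\mathbb{C}^3$ and $|ab\rangle=|a\rangle\otimes|b\rangle$. All Hilbert spaces are finite-dimensional. A state is a positive semidefinite operator of trace one. $T_B$ denotes partial transpose on the second (Bob's) system: $(|i_Aj_B\rangle\langle k_Al_B|)^{T_B}=|i_Al_B\rangle\langle k_Aj_B|$. For tensor powers, the bipartition is all of Alice's systems versus all of Bob's systems. $\|\cdot\|_1$ is the trace norm. PPT operations: a CPTP map $\Lambda:\mathcal{L}(A\otimes B)\to\mathcal{L}(A'\otimes B')$ is a PPT operation if $T_{B'}\circ\Lambda\circ T_B$ is completely positive. Let $\Phi=|\phi\rangle\langle\phi|$, $|\phi\rangle=\frac1{\sqrt2}(|00\rangle+|11\rangle)$. Then $$E_D(\rho)=\sup\Big\{r\ge0:\lim_{n\to\infty}\inf_{\Lambda\text{ PPT operation}}\|\Lambda(\rho^{\otimes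 n})-\Phi^{\otimes\lfloor rn\rfloor}\|_1=0\Big\},$$ $$E_C(\rho)=\inf\Big\{r\ge0:\lim_{n\to\infty}\inf_{\Lambda\text{ PPT operation}}\|\rho^{\otimes n}-\Lambda(\Phi^{\otimes\lfloor rn\rfloor})\|_1=0\Big\}.$$ *)

theory Defs
  imports "Jordan_Normal_Form.Schur_Decomposition" "HOL-Library.Extended_Real"
begin

section \<open>Vectors, operators, states\<close>

text \<open>
  The tensor product of spaces of dimension \<open>a\<close> and \<open>b\<close> consists of the vectors of dimension
  \<open>a * b\<close>. The product basis vector \<open>|i j\<rangle>\<close> has index \<open>i * b + j\<close>, so an index \<open>r\<close> stands for
  Alice's index \<open>r div b\<close> and Bob's index \<open>r mod b\<close>.
\<close>

definition tensor_vec :: "complex vec \<Rightarrow> complex vec \<Rightarrow> complex vec" where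
  "tensor_vec v w =
     vec (dim_vec v * dim_vec w) (\<lambda>r. vec_index v (r div dim_vec w) * vec_index w (r mod dim_vec w))"

definition ketbra :: "complex vec \<Rightarrow> complex mat" where
  "ketbra v = mat (dim_vec v) (dim_vec v) (\<lambda>(r, c). vec_index v r * cnj (vec_index v c))"

definition mat_trace :: "complex mat \<Rightarrow> complex" where
  "mat_trace X = (\<Sum>i<dim_row X. X $$ (i, i))"

text \<open>
  The order on \<open>complex\<close> is the one of \<open>HOL-Library.Complex_Order\<close>: \<open>0 \<le> z\<close> says that \<open>z\<close> is
  real and nonnegative. Over the complex numbers this forces the operator to be Hermitian.
\<close>

definition psd :: "nat \<Rightarrow> complex mat \<Rightarrow> bool" where
  "psd d X \<longleftrightarrow> X \<in> carrier_mat d d \<and> (\<forall>v \<in> carrier_vec d. 0 \<le> (X *\<^sub>v v) \<bullet>c v)"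

definition is_state :: "nat \<Rightarrow> complex mat \<Rightarrow> bool" where
  "is_state d X \<longleftrightarrow> psd d X \<and> mat_trace X = 1"

text \<open>
  The trace norm \<open>Tr \<surd>(X\<^sup>* X)\<close>, i.e. the sum of the singular values with multiplicity: the
  roots of the characteristic polynomial of \<open>X\<^sup>* X\<close> are real and nonnegative, and the
  singular values are their square roots.
\<close>

definition trace_norm :: "complex mat \<Rightarrow> real" where
  "trace_norm X = (\<Sum>z \<in># proots (char_poly (mat_adjoint X * X)). sqrt (Re z))"


section \<open>Bipartite structure\<close>

definition partial_transpose :: "nat \<Rightarrow> nat \<Rightarrow> complex mat \<Rightarrow> complex mat" where
  "partial_transpose a b X = mat (a * b) (a * b)
     (\<lambda>(r, c). X $$ ((r div b) * b + c mod b, (c div b) * b + r mod b))"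

text \<open>
  Tensor product of an operator on \<open>A\<^sub>1 B\<^sub>1\<close> and an operator on \<open>A\<^sub>2 B\<^sub>2\<close> as an operator on
  \<open>(A\<^sub>1 A\<^sub>2) (B\<^sub>1 B\<^sub>2)\<close>, the dimensions being \<open>a1, b1, a2, b2\<close>. This differs from the Kronecker
  product by the reordering of the factors from \<open>A\<^sub>1 B\<^sub>1 A\<^sub>2 B\<^sub>2\<close> to \<open>A\<^sub>1 A\<^sub>2 B\<^sub>1 B\<^sub>2\<close>. The two index
  functions extract from a joint index the index in each of the two pairs.
\<close>

definition left_index :: "nat \<Rightarrow> nat \<Rightarrow> nat \<Rightarrow> nat \<Rightarrow> nat" where
  "left_index b1 a2 b2 r = ((r div (b1 * b2)) div a2) * b1 + (r mod (b1 * b2)) div b2"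

definition right_index :: "nat \<Rightarrow> nat \<Rightarrow> nat \<Rightarrow> nat \<Rightarrow> nat" where
  "right_index b1 a2 b2 r = ((r div (b1 * b2)) mod a2) * b2 + (r mod (b1 * b2)) mod b2"

definition bipartite_tensor ::
    "nat \<Rightarrow> nat \<Rightarrow> nat \<Rightarrow> nat \<Rightarrow> complex mat \<Rightarrow> complex mat \<Rightarrow> complex mat" where
  "bipartite_tensor a1 b1 a2 b2 X Y = mat ((a1 * a2) * (b1 * b2)) ((a1 * a2) * (b1 * b2))
     (\<lambda>(r, c). X $$ (left_index b1 a2 b2 r, left_index b1 a2 b2 c)
             * Y $$ (right_index b1 a2 b2 r, right_index b1 a2 b2 c))"

text \<open>The \<open>n\<close>-th tensor power of an operator with local dimensions \<open>a, b\<close> has local dimensions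
  \<open>a ^ n, b ^ n\<close>.\<close>

primrec tensor_power :: "nat \<Rightarrow> nat \<Rightarrow> complex mat \<Rightarrow> nat \<Rightarrow> complex mat" where
  "tensor_power a b X 0 = 1\<^sub>m 1"
| "tensor_power a b X (Suc n) = bipartite_tensor a b (a ^ n) (b ^ n) X (tensor_power a b X n)"


section \<open>PPT operations\<close>

text \<open>Maps between operator spaces are HOL functions on matrices of which only the values on
  \<open>carrier_mat d d\<close> matter.\<close>

definition linear_op_map :: "nat \<Rightarrow> nat \<Rightarrow> (complex mat \<Rightarrow> complex mat) \<Rightarrow> bool" where
  "linear_op_map d d' L \<longleftrightarrow>
     (\<forall>X \<in> carrier_mat d d. L X \<in> carrier_mat d' d') \<and>
     (\<forall>X \<in> carrier_mat d d. \<forall>Y \<in> carrier_mat d d. L (X + Y) = L X + L Y) \<and>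
     (\<forall>X \<in> carrier_mat d d. \<forall>z. L (z \<cdot>\<^sub>m X) = z \<cdot>\<^sub>m L X)"

text \<open>The map \<open>id\<^sub>k \<otimes> L\<close>: \<open>L\<close> is applied to each of the \<open>k * k\<close> blocks of size \<open>d\<close> of the argument.\<close>

definition ampliation ::
    "nat \<Rightarrow> nat \<Rightarrow> nat \<Rightarrow> (complex mat \<Rightarrow> complex mat) \<Rightarrow> complex mat \<Rightarrow> complex mat" where
  "ampliation k d d' L X = mat (k * d') (k * d')
     (\<lambda>(r, c). L (mat d d (\<lambda>(s, t). X $$ ((r div d') * d + s, (c div d') * d + t)))
                 $$ (r mod d', c mod d'))"

definition completely_positive :: "nat \<Rightarrow> nat \<Rightarrow> (complex mat \<Rightarrow> complex mat) \<Rightarrow> bool" where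
  "completely_positive d d' L \<longleftrightarrow> linear_op_map d d' L \<and>
     (\<forall>k X. psd (k * d) X \<longrightarrow> psd (k * d') (ampliation k d d' L X))"

definition cptp :: "nat \<Rightarrow> nat \<Rightarrow> (complex mat \<Rightarrow> complex mat) \<Rightarrow> bool" where
  "cptp d d' L \<longleftrightarrow> completely_positive d d' L \<and>
     (\<forall>X \<in> carrier_mat d d. mat_trace (L X) = mat_trace X)"

definition ppt_operation ::
    "nat \<Rightarrow> nat \<Rightarrow> nat \<Rightarrow> nat \<Rightarrow> (complex mat \<Rightarrow> complex mat) \<Rightarrow> bool" where
  "ppt_operation a b a' b' L \<longleftrightarrow> cptp (a * b) (a' * b') L \<and>
     completely_positive (a * b) (a' * b') (partial_transpose a' b' \<circ> L \<circ> partial_transpose a b)"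


section \<open>Distillable entanglement and entanglement cost\<close>

definition phi_plus :: "complex vec" where
  "phi_plus = complex_of_real (1 / sqrt 2) \<cdot>\<^sub>v
     (tensor_vec (unit_vec 2 0) (unit_vec 2 0) + tensor_vec (unit_vec 2 1) (unit_vec 2 1))"

definition Phi :: "complex mat" where
  "Phi = ketbra phi_plus"

definition distill_error :: "nat \<Rightarrow> nat \<Rightarrow> complex mat \<Rightarrow> nat \<Rightarrow> nat \<Rightarrow> real" where
  "distill_error a b \<rho> n m =
     (INF L \<in> {L. ppt_operation (a ^ n) (b ^ n) (2 ^ m) (2 ^ m) L}.
        trace_norm (L (tensor_power a b \<rho> n) - tensor_power 2 2 Phi m))"

definition dilute_error :: "nat \<Rightarrow> nat \<Rightarrow> complex mat \<Rightarrow> nat \<Rightarrow> nat \<Rightarrow> real" where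
  "dilute_error a b \<rho> n m =
     (INF L \<in> {L. ppt_operation (2 ^ m) (2 ^ m) (a ^ n) (b ^ n) L}.
        trace_norm (tensor_power a b \<rho> n - L (tensor_power 2 2 Phi m)))"

text \<open>Supremum and infimum are taken in the extended reals, so that they have their usual meaning
  (possibly \<open>\<infinity>\<close>) without boundedness or nonemptiness of the sets of achievable rates.\<close>

definition E_D :: "nat \<Rightarrow> nat \<Rightarrow> complex mat \<Rightarrow> ereal" where
  "E_D a b \<rho> = Sup (ereal `
     {r. 0 \<le> r \<and> (\<lambda>n. distill_error a b \<rho> n (nat \<lfloor>r * real n\<rfloor>)) \<longlonglongrightarrow> 0})"

definition E_C :: "nat \<Rightarrow> nat \<Rightarrow> complex mat \<Rightarrow> ereal" where
  "E_C a b \<rho> = Inf (ereal `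
     {r. 0 \<le> r \<and> (\<lambda>n. dilute_error a b \<rho> n (nat \<lfloor>r * real n\<rfloor>)) \<longlonglongrightarrow> 0})"

end

theory Submission
  imports Defs
begin

text \<open>
  For a PPT operation \<open>\<Lambda>\<close> the map \<open>T \<circ> \<Lambda> \<circ> T\<close> is completely positive and trace preserving, so both
  bounds reduce to operator inequalities \<open>-Y \<le> X \<le> Y\<close>, which are multiplicative under tensor powers.
  Choosing local bases appropriately, \<open>u1 = f \<and> g\<close> and \<open>u2 = f \<and> e\<close> with \<open>f, g, e\<close> orthonormal.

  Distillation: \<open>\<rho>\<^sup>T\<close> is dominated by an operator of trace \<open>N = 1 + \<surd>(p\<^sup>2 + (1 - p)\<^sup>2) < 2\<close>
  (the negativity) and \<open>\<Phi>\<^sup>T\<close> by \<open>1/2\<close>, so the fidelity of \<open>\<Lambda>(\<rho>\<^sup>n)\<close> with \<open>\<Phi>\<^sup>m\<close> is at most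
  \<open>N\<^sup>n / 2\<^sup>m\<close> and the rate is at most \<open>log 2 N < 1\<close>.

  Cost, lower bound: \<open>\<Phi> \<le> D\<close> for the PPT operator \<open>D = |00\<rangle>\<langle>00| + |11\<rangle>\<langle>11|\<close> of trace \<open>2\<close>, so
  \<open>\<Lambda>(\<Phi>\<^sup>m)\<close> lies below a PPT operator of trace \<open>2\<^sup>m\<close>. The projection \<open>P\<close> onto the support of \<open>\<rho>\<close>
  satisfies \<open>-Y \<le> P\<^sup>T \<le> Y\<close> and \<open>-1/2 \<le> Y\<^sup>T \<le> 1/2\<close> for \<open>Y = (1/2 - |g \<and> e\<rangle>\<langle>g \<and> e|)\<^sup>T\<close>, so the
  weight of \<open>\<Lambda>(\<Phi>\<^sup>m)\<close> on the support of \<open>\<rho>\<^sup>n\<close> is at most \<open>2\<^sup>m / 2\<^sup>n\<close>.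

  Cost, upper bound: \<open>u1\<close> and \<open>u2\<close> are images of \<open>\<phi>\<close> under local isometries, so a random choice of
  these isometries turns \<open>\<Phi>\<^sup>n\<close> exactly into \<open>\<rho>\<^sup>n\<close>.
\<close>


section \<open>Adjoints and positive semidefinite matrices\<close>

text \<open>The two bounds need different invariants. The negativity N limits distillation, but log
  2 N < 1 can never show that the cost reaches 1; the cost bound therefore looks only at the support
  of \<rho> and does not depend on p. Its core is that no PPT state \<sigma> has weight above 1/2 on
  that support: Tr(P \<sigma>) = Tr(P^T \<sigma>^T) <= Tr(Y \<sigma>^T) = Tr(Y^T \<sigma>) <= 1/2.
  For n copies this chain needs tensor powers of inequalities. A bare A <= B does not survive them
  (-2 <= 1 but 4 > 1), whereas -B <= A <= B does; hence both conditions on Y are two-sided. The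
  common factor f comes from dimension 3: an antisymmetric vector of C^3 \<otimes> C^3 is a single
  wedge, that is a plane in C^3, and two distinct planes meet in a line, spanned by f. Sharing f is
  also what makes N < 2: the off-diagonal parts of both transposed states start from the same vector
  |ff>, so the weights p and 1 - p combine in the Euclidean norm and not in the sum norm; a single
  pure u would give exactly 2.\<close>

lemma mat_adjoint_carrier [simp]:
  "A \<in> carrier_mat m n \<Longrightarrow> mat_adjoint A \<in> carrier_mat n m"
  by (auto simp: mat_adjoint_def)

lemma dim_mat_adjoint [simp]:
  "dim_row (mat_adjoint A) = dim_col A" "dim_col (mat_adjoint A) = dim_row A"
  by (auto simp: mat_adjoint_def)

lemma mat_adjoint_index [simp]:
  fixes A :: "complex mat"
  assumes "i < dim_col A" "j < dim_row A"
  shows "mat_adjoint A $$ (i, j) = cnj (A $$ (j, i))"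
  using assms by (simp add: mat_adjoint_def mat_of_rows_index)

lemma mat_adjoint_adjoint [simp]:
  fixes A :: "complex mat"
  shows "mat_adjoint (mat_adjoint A) = A"
  by (rule eq_matI) auto

lemma mat_adjoint_mult:
  fixes A B :: "complex mat"
  assumes "A \<in> carrier_mat m n" "B \<in> carrier_mat n k"
  shows "mat_adjoint (A * B) = mat_adjoint B * mat_adjoint A"
  using assms by (intro eq_matI) (auto simp: scalar_prod_def intro!: sum.cong)

lemma mat_adjoint_minus:
  fixes A B :: "complex mat"
  assumes "A \<in> carrier_mat m n" "B \<in> carrier_mat m n"
  shows "mat_adjoint (A - B) = mat_adjoint A - mat_adjoint B"
  using assms by (intro eq_matI) auto

lemma mat_adjoint_one [simp]: "mat_adjoint (1\<^sub>m n :: complex mat) = 1\<^sub>m n"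
  by (intro eq_matI) auto

lemma inner_mult_adjoint:
  fixes A :: "complex mat"
  assumes A: "A \<in> carrier_mat m n" and v: "v \<in> carrier_vec n" and w: "w \<in> carrier_vec m"
  shows "(A *\<^sub>v v) \<bullet>c w = v \<bullet>c (mat_adjoint A *\<^sub>v w)"
proof -
  have "(A *\<^sub>v v) \<bullet>c w = (\<Sum>i<m. \<Sum>j<n. A $$ (i, j) * v $ j * cnj (w $ i))"
    using assms by (auto simp: scalar_prod_def sum_distrib_right atLeast0LessThan intro!: sum.cong)
  also have "\<dots> = (\<Sum>j<n. \<Sum>i<m. A $$ (i, j) * v $ j * cnj (w $ i))"
    by (rule sum.swap)
  also have "\<dots> = v \<bullet>c (mat_adjoint A *\<^sub>v w)"
    using assms by (auto simp: scalar_prod_def sum_distrib_left atLeast0LessThan intro!: sum.cong)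
  finally show ?thesis .
qed

lemma inner_self_nonneg: "0 \<le> (v :: complex vec) \<bullet>c v"
  by (rule conjugate_square_ge_0_vec)

lemma psd_carrier: "psd d X \<Longrightarrow> X \<in> carrier_mat d d"
  by (simp add: psd_def)

lemma psd_quadratic: "psd d X \<Longrightarrow> v \<in> carrier_vec d \<Longrightarrow> 0 \<le> (X *\<^sub>v v) \<bullet>c v"
  by (simp add: psd_def)

lemma psd_congruence:
  assumes X: "psd n X" and K: "K \<in> carrier_mat m n"
  shows "psd m (K * X * mat_adjoint K)"
  unfolding psd_def
proof safe
  note X' = psd_carrier[OF X]
  show "K * X * mat_adjoint K \<in> carrier_mat m m" using X' K by auto
  fix v :: "complex vec" assume v: "v \<in> carrier_vec m"
  let ?w = "mat_adjoint K *\<^sub>v v"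
  have w: "?w \<in> carrier_vec n" using K v by (intro mult_mat_vec_carrier[of _ _ m]) auto
  have "(K * X * mat_adjoint K) *\<^sub>v v = K *\<^sub>v (X *\<^sub>v ?w)"
    using K X' v w mat_adjoint_carrier[OF K] mult_carrier_mat[OF K X']
    by (metis assoc_mult_mat_vec)
  then have "((K * X * mat_adjoint K) *\<^sub>v v) \<bullet>c v = (X *\<^sub>v ?w) \<bullet>c ?w"
    using inner_mult_adjoint[OF K, of "X *\<^sub>v ?w" v] X' w v by (metis mult_mat_vec_carrier)
  then show "0 \<le> ((K * X * mat_adjoint K) *\<^sub>v v) \<bullet>c v"
    using psd_quadratic[OF X w] by simp
qed

lemma psd_one: "psd d (1\<^sub>m d)"
  by (simp add: psd_def inner_self_nonneg)

lemma psd_gram: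
  assumes "K \<in> carrier_mat m n"
  shows "psd m (K * mat_adjoint K)"
  using psd_congruence[OF psd_one assms] assms by simp

lemma psd_add:
  assumes "psd d X" "psd d Y"
  shows "psd d (X + Y)"
  using assms unfolding psd_def
  by (auto simp: add_mult_distrib_mat_vec[of _ d d] add_scalar_prod_distrib[of _ d])

lemma psd_smult:
  assumes "psd d X" "0 \<le> c"
  shows "psd d (complex_of_real c \<cdot>\<^sub>m X)"
  unfolding psd_def
proof safe
  note X = psd_carrier[OF assms(1)]
  show "complex_of_real c \<cdot>\<^sub>m X \<in> carrier_mat d d" using X by simp
  fix v :: "complex vec" assume v: "v \<in> carrier_vec d"
  have "(complex_of_real c \<cdot>\<^sub>m X) *\<^sub>v v = complex_of_real c \<cdot>\<^sub>v (X *\<^sub>v v)"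
    using X v by (intro eq_vecI) auto
  then have "((complex_of_real c \<cdot>\<^sub>m X) *\<^sub>v v) \<bullet>c v = complex_of_real c * ((X *\<^sub>v v) \<bullet>c v)"
    using X v by (simp add: smult_scalar_prod_distrib[of _ d])
  then show "0 \<le> ((complex_of_real c \<cdot>\<^sub>m X) *\<^sub>v v) \<bullet>c v"
    using psd_quadratic[OF assms(1) v] assms(2) by (simp add: less_eq_complex_def)
qed

lemma psd_zero: "psd d (0\<^sub>m d d)"
proof -
  have "0\<^sub>m d d = complex_of_real 0 \<cdot>\<^sub>m 1\<^sub>m d" by (intro eq_matI) auto
  then show ?thesis using psd_smult[OF psd_one, of 0 d] by simp
qed

lemma quadratic_two_point:
  fixes X :: "complex mat"
  assumes X: "X \<in> carrier_mat d d" and ij: "i < d" "j < d"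
  shows "(X *\<^sub>v (unit_vec d i + z \<cdot>\<^sub>v unit_vec d j)) \<bullet>c (unit_vec d i + z \<cdot>\<^sub>v unit_vec d j)
       = X $$ (i, i) + z * X $$ (i, j) + cnj z * X $$ (j, i) + z * cnj z * X $$ (j, j)"
proof -
  let ?v = "unit_vec d i + z \<cdot>\<^sub>v unit_vec d j"
  have Xv: "(X *\<^sub>v ?v) $ r = X $$ (r, i) + z * X $$ (r, j)" if "r < d" for r
    using X ij that by (simp add: scalar_prod_add_distrib[of _ d])
  have "conjugate ?v = unit_vec d i + cnj z \<cdot>\<^sub>v unit_vec d j"
    using ij by (intro eq_vecI) (auto simp: unit_vec_def)
  then have "(X *\<^sub>v ?v) \<bullet>c ?v = (X *\<^sub>v ?v) $ i + cnj z * (X *\<^sub>v ?v) $ j"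
    using X ij by (simp add: scalar_prod_add_distrib[of _ d])
  then show ?thesis using ij by (simp add: Xv algebra_simps)
qed

text \<open>Only the reality of the quadratic form enters: its values at e_i + z e_j for z = 0, 1,
  -1 and the imaginary unit determine the imaginary part of X_ij + X_ji and the real part of X_ij -
  X_ji.\<close>

lemma psd_hermitian:
  assumes "psd d X"
  shows "mat_adjoint X = X"
proof (rule eq_matI)
  note X = psd_carrier[OF assms]
  show "dim_row (mat_adjoint X) = dim_row X" "dim_col (mat_adjoint X) = dim_col X" using X by auto
  fix i j assume "i < dim_row X" "j < dim_col X"
  then have ij: "i < d" "j < d" using X by auto
  have im: "Im (X $$ (i, i) + z * X $$ (i, j) + cnj z * X $$ (j, i) + z * cnj z * X $$ (j, j)) = 0" for z
    using psd_quadratic[OF assms, of "unit_vec d i + z \<cdot>\<^sub>v unit_vec d j"] ij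
    unfolding quadratic_two_point[OF X ij] by (simp add: less_eq_complex_def)
  have "Im (X $$ (i, i)) = 0" using im[of 0] by simp
  moreover have "Im (X $$ (i, j)) + Im (X $$ (j, i)) + Im (X $$ (j, j)) = 0"
    using im[of 1] calculation by simp
  moreover have "- Im (X $$ (i, j)) - Im (X $$ (j, i)) + Im (X $$ (j, j)) = 0"
    using im[of "-1"] calculation by simp
  moreover have "Re (X $$ (i, j)) - Re (X $$ (j, i)) + Im (X $$ (j, j)) = 0"
    using im[of "\<i>"] calculation by simp
  ultimately show "mat_adjoint X $$ (i, j) = X $$ (i, j)"
    using X ij by (simp add: complex_eq_iff)
qed

lemma psd_diag_nonneg:
  assumes "psd d X" "i < d"
  shows "0 \<le> X $$ (i, i)"
  using psd_quadratic[OF assms(1), of "unit_vec d i + 0 \<cdot>\<^sub>v unit_vec d i"] assms(2)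
  unfolding quadratic_two_point[OF psd_carrier[OF assms(1)] assms(2) assms(2)] by simp

definition real_diag :: "nat \<Rightarrow> (nat \<Rightarrow> real) \<Rightarrow> complex mat" where
  "real_diag n d = mat n n (\<lambda>(i, j). if i = j then complex_of_real (d i) else 0)"

lemma real_diag_carrier [simp]: "real_diag n d \<in> carrier_mat n n"
  by (simp add: real_diag_def)

lemma real_diag_mult: "real_diag n d * real_diag n e = real_diag n (\<lambda>i. d i * e i)"
proof (rule eq_matI)
  fix i j assume "i < dim_row (real_diag n (\<lambda>i. d i * e i))" "j < dim_col (real_diag n (\<lambda>i. d i * e i))"
  then have ij: "i < n" "j < n" by (auto simp: real_diag_def)
  have "(\<Sum>k = 0..<n. real_diag n d $$ (i, k) * real_diag n e $$ (k, j))
      = (\<Sum>k = 0..<n. if k = i then (if i = j then complex_of_real (d i * e i) else 0) else 0)"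
    using ij by (intro sum.cong) (auto simp: real_diag_def)
  then show "(real_diag n d * real_diag n e) $$ (i, j) = real_diag n (\<lambda>i. d i * e i) $$ (i, j)"
    using ij by (auto simp: real_diag_def scalar_prod_def)
qed (auto simp: real_diag_def)

lemma mat_adjoint_real_diag [simp]: "mat_adjoint (real_diag n d) = real_diag n d"
  by (intro eq_matI) (auto simp: real_diag_def)

lemma psd_real_diag:
  assumes "\<And>i. i < n \<Longrightarrow> 0 \<le> d i"
  shows "psd n (real_diag n d)"
proof -
  have "real_diag n d = real_diag n (\<lambda>i. sqrt (d i)) * mat_adjoint (real_diag n (\<lambda>i. sqrt (d i)))"
    using assms by (simp add: real_diag_mult) (auto simp: real_diag_def intro!: eq_matI)
  then show ?thesis by (metis psd_gram real_diag_carrier)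
qed


section \<open>Diagonalization of Hermitian matrices\<close>

text \<open>The direct sum of the 1 x 1 block \<open>c\<close> and \<open>P\<close>, the shape
  reached by splitting off one eigenvector.\<close>

definition corner_ext :: "complex \<Rightarrow> complex mat \<Rightarrow> complex mat" where
  "corner_ext c P = mat (Suc (dim_row P)) (Suc (dim_col P))
     (\<lambda>(i, j). case i of 0 \<Rightarrow> (case j of 0 \<Rightarrow> c | Suc _ \<Rightarrow> 0)
       | Suc i' \<Rightarrow> (case j of 0 \<Rightarrow> 0 | Suc j' \<Rightarrow> P $$ (i', j')))"

lemma dim_corner_ext [simp]:
  "dim_row (corner_ext c P) = Suc (dim_row P)" "dim_col (corner_ext c P) = Suc (dim_col P)"
  by (auto simp: corner_ext_def)

lemma corner_ext_mult:
  assumes "dim_col P = dim_row Q"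
  shows "corner_ext c P * corner_ext c' Q = corner_ext (c * c') (P * Q)"
  using assms
  by (intro eq_matI)
    (auto simp: corner_ext_def scalar_prod_def sum.atLeast0_lessThan_Suc_shift
          simp del: sum.op_ivl_Suc split: nat.splits intro!: sum.cong)

lemma corner_ext_adjoint: "mat_adjoint (corner_ext c P) = corner_ext (cnj c) (mat_adjoint P)"
  by (intro eq_matI) (auto simp: corner_ext_def split: nat.splits)

lemma corner_ext_one: "corner_ext 1 (1\<^sub>m n) = 1\<^sub>m (Suc n)"
  by (intro eq_matI) (auto simp: corner_ext_def split: nat.splits)

lemma corner_ext_real_diag:
  "corner_ext (complex_of_real c) (real_diag n d) = real_diag (Suc n) (case_nat c d)"
  by (intro eq_matI) (auto simp: corner_ext_def real_diag_def split: nat.splits)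

text \<open>Gram-Schmidt on a basis completed from \<open>v\<close> keeps \<open>v\<close> as its
  first vector, up to the normalization \<open>c\<close>. This is how an eigenvector becomes the
  first column of a unitary.\<close>

lemma orthonormal_basis_exists:
  fixes v :: "complex vec"
  assumes v: "v \<in> carrier_vec n" and v0: "v \<noteq> 0\<^sub>v n"
  shows "\<exists>W c. W \<in> carrier_mat n n \<and> mat_adjoint W * W = 1\<^sub>m n \<and> W * mat_adjoint W = 1\<^sub>m n
           \<and> col W 0 = c \<cdot>\<^sub>v v"
proof -
  interpret cof_vec_space n "TYPE(complex)" .
  define b where "b = basis_completion v"
  define ws where "ws = gram_schmidt n b"
  have n: "n \<noteq> 0" using v v0 by auto
  from basis_completion[OF v v0, folded b_def]
  have dist_b: "distinct b" and indep: "\<not> lin_dep (set b)" and b: "set b \<subseteq> carrier_vec n"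
    and hdb: "hd b = v" and len_b: "length b = n" by auto
  from hdb len_b n obtain vs where bv: "b = v # vs" by (cases b, auto)
  from gram_schmidt_result[OF b dist_b indep refl, folded ws_def]
  have ws: "set ws \<subseteq> carrier_vec n" "corthogonal ws" "length ws = n"
    by (auto simp: len_b)
  from gram_schmidt_hd[OF v, of vs, folded bv] have hdws: "hd ws = v" unfolding ws_def .
  \<comment> \<open>The family \<open>ws\<close> is orthogonal but not normalized.\<close>
  define nrm where "nrm w = complex_of_real (1 / sqrt (Re (w \<bullet>c w)))" for w :: "complex vec"
  define W where "W = mat_of_cols n (map (\<lambda>w. nrm w \<cdot>\<^sub>v w) ws)"
  have wsc: "ws ! i \<in> carrier_vec n" if "i < n" for i using ws that by auto
  have W: "W \<in> carrier_mat n n" unfolding W_def using ws by (metis length_map mat_of_cols_carrier(1))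
  have Wcol: "col W i = nrm (ws ! i) \<cdot>\<^sub>v ws ! i" if "i < n" for i
    unfolding W_def using that ws wsc[OF that] by (subst col_mat_of_cols) auto
  have WW: "mat_adjoint W * W = 1\<^sub>m n"
  proof (rule eq_matI)
    fix i j assume "i < dim_row (1\<^sub>m n :: complex mat)" "j < dim_col (1\<^sub>m n :: complex mat)"
    then have ij: "i < n" "j < n" by auto
    have "(mat_adjoint W * W) $$ (i, j) = conjugate (col W i) \<bullet> col W j"
      using W ij by (auto simp: scalar_prod_def intro!: sum.cong)
    also have "\<dots> = nrm (ws ! i) * nrm (ws ! j) * (ws ! j \<bullet>c ws ! i)"
      using ij wsc[OF ij(1)] wsc[OF ij(2)]
      by (simp add: Wcol conjugate_smult_vec smult_scalar_prod_distrib[of _ n]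
          scalar_prod_smult_distrib[of _ n] comm_scalar_prod[of _ n "ws ! j"] nrm_def)
    also have "\<dots> = 1\<^sub>m n $$ (i, j)"
    proof (cases "i = j")
      case True
      have "ws ! i \<bullet>c ws ! i \<noteq> 0" using corthogonalD[OF ws(2), of i i] ij ws(3) by auto
      moreover have "0 \<le> ws ! i \<bullet>c ws ! i" by (rule inner_self_nonneg)
      ultimately obtain x where x: "ws ! i \<bullet>c ws ! i = complex_of_real x" "0 < x"
        by (metis Reals_cases complex_is_Real_iff less_eq_complex_def Re_complex_of_real
            zero_complex.sel order_le_less of_real_0)
      have "nrm (ws ! i) * nrm (ws ! i) = complex_of_real (1 / x)"
        using x(2) unfolding nrm_def x(1) of_real_mult[symmetric] by (simp add: real_sqrt_mult_self)
      also have "\<dots> * (ws ! i \<bullet>c ws ! i) = 1" using x by (simp flip: of_real_mult)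
      finally show ?thesis using True ij by simp
    next
      case False
      then show ?thesis using corthogonalD[OF ws(2), of j i] ij ws(3) by auto
    qed
    finally show "(mat_adjoint W * W) $$ (i, j) = 1\<^sub>m n $$ (i, j)" .
  qed (use W in auto)
  moreover have "W * mat_adjoint W = 1\<^sub>m n"
    using mat_mult_left_right_inverse[OF mat_adjoint_carrier[OF W] W WW] .
  moreover have "col W 0 = nrm v \<cdot>\<^sub>v v"
    using Wcol[of 0] n hdws ws(3) by (cases ws) auto
  ultimately show ?thesis using W by blast
qed

lemma complex_eigenvector_exists:
  fixes A :: "complex mat"
  assumes A: "A \<in> carrier_mat n n" and n: "0 < n"
  obtains v e where "v \<in> carrier_vec n" "v \<noteq> 0\<^sub>v n" "A *\<^sub>v v = e \<cdot>\<^sub>v v"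
proof -
  obtain as where as: "char_poly A = (\<Prod>a\<leftarrow>as. [:- a, 1:])" "length as = n"
    using char_poly_factorized[OF A] by auto
  then obtain e bs where "as = e # bs" using n by (cases as) auto
  then have "eigenvalue A e" unfolding eigenvalue_root_char_poly[OF A] as(1) by simp
  then show ?thesis using that A unfolding eigenvalue_def eigenvector_def by auto
qed

text \<open>Deflation: in a basis that starts with a unit eigenvector the first column of the matrix
  is a multiple of the first unit vector, by Hermiticity so is the first row, and the remaining
  block is again Hermitian.\<close>

lemma hermitian_diagonalization:
  assumes "A \<in> carrier_mat n n" "mat_adjoint A = A"
  shows "\<exists>U d. U \<in> carrier_mat n n \<and> mat_adjoint U * U = 1\<^sub>m n \<and> U * mat_adjoint U = 1\<^sub>m n
           \<and> A = U * real_diag n d * mat_adjoint U"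
  using assms
proof (induction n arbitrary: A)
  case 0
  then have "A = 1\<^sub>m 0 * real_diag 0 d * mat_adjoint (1\<^sub>m 0)" for d by (intro eq_matI) auto
  then show ?case by (intro exI[of _ "1\<^sub>m 0"]) auto
next
  case (Suc m)
  let ?n = "Suc m"
  note A = Suc.prems(1)
  obtain v e where v: "v \<in> carrier_vec ?n" "v \<noteq> 0\<^sub>v ?n" and ev: "A *\<^sub>v v = e \<cdot>\<^sub>v v"
    using complex_eigenvector_exists[OF A] by auto
  obtain W c where W: "W \<in> carrier_mat ?n ?n" and W1: "mat_adjoint W * W = 1\<^sub>m ?n"
    and W2: "W * mat_adjoint W = 1\<^sub>m ?n" and Wc: "col W 0 = c \<cdot>\<^sub>v v"
    using orthonormal_basis_exists[OF v] by blast
  note Wa = mat_adjoint_carrier[OF W]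
  define A' where "A' = mat_adjoint W * (A * W)"
  have A': "A' \<in> carrier_mat ?n ?n" using A W unfolding A'_def by auto
  have hA': "mat_adjoint A' = A'"
    unfolding A'_def
    using mat_adjoint_mult[OF Wa, of "A * W" ?n] mat_adjoint_mult[OF A W] Suc.prems(2) A W Wa
      assoc_mult_mat[OF Wa A W] by auto
  have AWc: "col (A * W) 0 = e \<cdot>\<^sub>v col W 0"
  proof -
    have "col (A * W) 0 = A *\<^sub>v col W 0" using A W by (intro col_mult2) auto
    also have "\<dots> = e \<cdot>\<^sub>v col W 0"
      unfolding Wc using ev v(1) A by (simp add: mult_mat_vec[of _ ?n ?n] smult_smult_assoc mult.commute)
    finally show ?thesis .
  qed
  have col0: "A' $$ (i, 0) = (if i = 0 then e else 0)" if i: "i < ?n" for i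
  proof -
    have "A' $$ (i, 0) = row (mat_adjoint W) i \<bullet> col (A * W) 0" unfolding A'_def using i A W by auto
    also have "\<dots> = e * (mat_adjoint W * W) $$ (i, 0)"
      unfolding AWc using i W by (simp add: scalar_prod_smult_distrib[of _ ?n])
    finally show ?thesis using i unfolding W1 by auto
  qed
  have entry_sym: "A' $$ (i, j) = cnj (A' $$ (j, i))" if "i < ?n" "j < ?n" for i j
  proof -
    have "mat_adjoint A' $$ (i, j) = cnj (A' $$ (j, i))" using that A' by simp
    then show ?thesis unfolding hA' .
  qed
  have e_real: "e = complex_of_real (Re e)"
    using entry_sym[of 0 0] col0[of 0] by (simp add: complex_eq_iff)
  define B where "B = mat m m (\<lambda>(i, j). A' $$ (Suc i, Suc j))"
  have B: "B \<in> carrier_mat m m" by (simp add: B_def)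
  have hB: "mat_adjoint B = B"
    by (rule eq_matI) (auto simp: B_def entry_sym[symmetric])
  have A'_ext: "A' = corner_ext (complex_of_real (Re e)) B"
  proof (rule eq_matI)
    fix i j assume "i < dim_row (corner_ext (complex_of_real (Re e)) B)"
      "j < dim_col (corner_ext (complex_of_real (Re e)) B)"
    then have ij: "i < ?n" "j < ?n" using B by auto
    then show "A' $$ (i, j) = corner_ext (complex_of_real (Re e)) B $$ (i, j)"
      using col0[of i] col0[of j] entry_sym[of i j] e_real
      by (auto simp: corner_ext_def B_def split: nat.splits)
  qed (use A' B in auto)
  obtain P d where P: "P \<in> carrier_mat m m" and P1: "mat_adjoint P * P = 1\<^sub>m m"
    and P2: "P * mat_adjoint P = 1\<^sub>m m" and BP: "B = P * real_diag m d * mat_adjoint P"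
    using Suc.IH[OF B hB] by blast
  define Q where "Q = corner_ext 1 P"
  have Q: "Q \<in> carrier_mat ?n ?n" using P unfolding Q_def by auto
  note Qa = mat_adjoint_carrier[OF Q]
  have Q1: "mat_adjoint Q * Q = 1\<^sub>m ?n" "Q * mat_adjoint Q = 1\<^sub>m ?n"
    unfolding Q_def corner_ext_adjoint using P P1 P2 by (simp_all add: corner_ext_mult corner_ext_one)
  let ?D = "real_diag ?n (case_nat (Re e) d)"
  have A'Q: "A' = Q * ?D * mat_adjoint Q"
    unfolding A'_ext BP Q_def corner_ext_adjoint corner_ext_real_diag[symmetric]
    using P carrier_matD[OF real_diag_carrier[of m d]] by (simp add: corner_ext_mult)
  let ?U = "W * Q"
  have U: "?U \<in> carrier_mat ?n ?n" using W Q by auto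
  have Ua: "mat_adjoint ?U = mat_adjoint Q * mat_adjoint W" by (rule mat_adjoint_mult[OF W Q])
  have D: "?D \<in> carrier_mat ?n ?n" by simp
  have "mat_adjoint ?U * ?U = mat_adjoint Q * (mat_adjoint W * (W * Q))"
    unfolding Ua by (rule assoc_mult_mat[OF Qa Wa U])
  also have "mat_adjoint W * (W * Q) = Q"
    using assoc_mult_mat[OF Wa W Q] W1 Q by simp
  finally have U1: "mat_adjoint ?U * ?U = 1\<^sub>m ?n" using Q1 by simp
  have U2: "?U * mat_adjoint ?U = 1\<^sub>m ?n"
    using mat_mult_left_right_inverse[OF mat_adjoint_carrier[OF U] U U1] .
  have QD: "Q * ?D \<in> carrier_mat ?n ?n" and UD: "?U * ?D \<in> carrier_mat ?n ?n"
    using mult_carrier_mat[OF Q D] mult_carrier_mat[OF U D] .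
  have "?U * ?D * mat_adjoint ?U = ?U * ?D * mat_adjoint Q * mat_adjoint W"
    unfolding Ua by (rule assoc_mult_mat[OF UD Qa Wa, symmetric])
  also have "?U * ?D * mat_adjoint Q = W * A'"
    unfolding A'Q using assoc_mult_mat[OF W Q D] assoc_mult_mat[OF W QD Qa] by simp
  also have "W * A' = W * mat_adjoint W * (A * W)"
    unfolding A'_def using assoc_mult_mat[OF W Wa mult_carrier_mat[OF A W]] by simp
  also have "\<dots> * mat_adjoint W = A * (W * mat_adjoint W)"
    using left_mult_one_mat[OF mult_carrier_mat[OF A W]] assoc_mult_mat[OF A W Wa] by (simp add: W2)
  also have "\<dots> = A" using A unfolding W2 by simp
  finally show ?case using U U1 U2 by metis
qed


section \<open>Traces, domination and the trace norm\<close>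

lemma mat_trace_add:
  "A \<in> carrier_mat n n \<Longrightarrow> B \<in> carrier_mat n n \<Longrightarrow> mat_trace (A + B) = mat_trace A + mat_trace B"
  by (auto simp: mat_trace_def sum.distrib)

lemma mat_trace_minus:
  "A \<in> carrier_mat n n \<Longrightarrow> B \<in> carrier_mat n n \<Longrightarrow> mat_trace (A - B) = mat_trace A - mat_trace B"
  by (auto simp: mat_trace_def sum_subtractf)

lemma mat_trace_smult:
  "A \<in> carrier_mat n n \<Longrightarrow> mat_trace (c \<cdot>\<^sub>m A) = c * mat_trace A"
  by (auto simp: mat_trace_def sum_distrib_left)

lemma mat_trace_mult:
  assumes "A \<in> carrier_mat m n" "B \<in> carrier_mat n m"
  shows "mat_trace (A * B) = (\<Sum>i<m. \<Sum>j<n. A $$ (i, j) * B $$ (j, i))"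
  using assms by (auto simp: mat_trace_def scalar_prod_def atLeast0LessThan intro!: sum.cong)

lemma mat_trace_comm:
  assumes "A \<in> carrier_mat m n" "B \<in> carrier_mat n m"
  shows "mat_trace (A * B) = mat_trace (B * A)"
  unfolding mat_trace_mult[OF assms] mat_trace_mult[OF assms(2,1)]
  by (subst sum.swap) (simp add: mult.commute)

lemma psd_trace_nonneg: "psd d X \<Longrightarrow> 0 \<le> mat_trace X"
  using psd_carrier[of d X] by (auto simp: mat_trace_def intro!: sum_nonneg psd_diag_nonneg)

text \<open>The root is taken on the eigenvalues: \<open>K\<close> is the diagonalizing unitary
  times the diagonal matrix of square roots.\<close>

lemma psd_factorization:
  assumes X: "psd d X"
  shows "\<exists>K \<in> carrier_mat d d. X = K * mat_adjoint K"
proof -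
  obtain U e where U: "U \<in> carrier_mat d d" and U1: "mat_adjoint U * U = 1\<^sub>m d"
    and XU: "X = U * real_diag d e * mat_adjoint U"
    using hermitian_diagonalization[OF psd_carrier[OF X] psd_hermitian[OF X]] by blast
  note Ua = mat_adjoint_carrier[OF U]
  have D: "real_diag d f \<in> carrier_mat d d" for f by simp
  have UD: "U * real_diag d f \<in> carrier_mat d d" for f using U by simp
  \<comment> \<open>Undoing the conjugation exhibits the diagonal matrix as a congruence of
    \<open>X\<close>, so the eigenvalues are nonnegative.\<close>
  have "mat_adjoint U * X * U = mat_adjoint U * (X * U)"
    using assoc_mult_mat[OF Ua psd_carrier[OF X] U] .
  also have "X * U = U * real_diag d e"
    unfolding XU using assoc_mult_mat[OF UD Ua U] U1 right_mult_one_mat[OF UD] by simp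
  also have "mat_adjoint U * (U * real_diag d e) = real_diag d e"
    using assoc_mult_mat[OF Ua U D, symmetric] U1 left_mult_one_mat[OF D] by simp
  finally have "psd d (real_diag d e)"
    using psd_congruence[OF X Ua] by simp
  then have e: "0 \<le> e i" if "i < d" for i
    using psd_diag_nonneg[of d "real_diag d e" i] that by (simp add: real_diag_def less_eq_complex_def)
  let ?S = "real_diag d (\<lambda>i. sqrt (e i))"
  have "real_diag d e = ?S * ?S"
    unfolding real_diag_mult using e by (auto simp: real_diag_def intro!: eq_matI)
  then have "X = U * ?S * ?S * mat_adjoint U"
    unfolding XU using assoc_mult_mat[OF U D D] by simp
  also have "\<dots> = (U * ?S) * mat_adjoint (U * ?S)"
    using mat_adjoint_mult[OF U D] assoc_mult_mat[OF UD D Ua] by simp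
  finally show ?thesis using UD by blast
qed

text \<open>After factoring A, cyclicity of the trace turns A B into a congruence of B.\<close>

lemma trace_mult_psd_nonneg:
  assumes A: "psd d A" and B: "psd d B"
  shows "0 \<le> mat_trace (A * B)"
proof -
  obtain K where K: "K \<in> carrier_mat d d" "A = K * mat_adjoint K"
    using psd_factorization[OF A] by blast
  note Ka = mat_adjoint_carrier[OF K(1)] and Bc = psd_carrier[OF B]
  have "mat_trace (A * B) = mat_trace (K * (mat_adjoint K * B))"
    unfolding K(2) using assoc_mult_mat[OF K(1) Ka Bc] by simp
  also have "\<dots> = mat_trace (mat_adjoint K * B * mat_adjoint (mat_adjoint K))"
    using mat_trace_comm[OF K(1) mult_carrier_mat[OF Ka Bc]] by simp
  finally show ?thesis using psd_trace_nonneg[OF psd_congruence[OF B Ka]] by simp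
qed

text \<open>The interval -B <= A <= B of the Loewner order, which takes the place of norm bounds:
  for B the identity it says that the Hermitian operator A has operator norm at most 1, and the
  least possible trace of B is the trace norm of A.\<close>

definition dominated :: "nat \<Rightarrow> complex mat \<Rightarrow> complex mat \<Rightarrow> bool" where
  "dominated d A B \<longleftrightarrow> A \<in> carrier_mat d d \<and> B \<in> carrier_mat d d \<and> psd d (B - A) \<and> psd d (B + A)"

lemma dominatedD:
  assumes "dominated d A B"
  shows "A \<in> carrier_mat d d" "B \<in> carrier_mat d d" "psd d (B - A)" "psd d (B + A)"
  using assms by (auto simp: dominated_def)

lemma trace_mult_minus_left:
  assumes "A \<in> carrier_mat d d" "B \<in> carrier_mat d d" "C \<in> carrier_mat d d"
  shows "mat_trace ((A - B) * C) = mat_trace (A * C) - mat_trace (B * C)"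
  using assms minus_mult_distrib_mat[OF assms] mat_trace_minus[of "A * C" d "B * C"] by simp

lemma trace_mult_minus_right:
  assumes "A \<in> carrier_mat d d" "B \<in> carrier_mat d d" "C \<in> carrier_mat d d"
  shows "mat_trace (A * (B - C)) = mat_trace (A * B) - mat_trace (A * C)"
  using assms mult_minus_distrib_mat[OF assms] mat_trace_minus[of "A * B" d "A * C"] by simp

lemma trace_mult_add_left:
  assumes "A \<in> carrier_mat d d" "B \<in> carrier_mat d d" "C \<in> carrier_mat d d"
  shows "mat_trace ((A + B) * C) = mat_trace (A * C) + mat_trace (B * C)"
  using assms add_mult_distrib_mat[OF assms] mat_trace_add[of "A * C" d "B * C"] by simp

lemma trace_mult_add_right:
  assumes "A \<in> carrier_mat d d" "B \<in> carrier_mat d d" "C \<in> carrier_mat d d"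
  shows "mat_trace (A * (B + C)) = mat_trace (A * B) + mat_trace (A * C)"
  using assms mult_add_distrib_mat[OF assms] mat_trace_add[of "A * B" d "A * C"] by simp

lemma trace_mult_mono:
  assumes "psd d (B - A)" "psd d C" "A \<in> carrier_mat d d" "B \<in> carrier_mat d d"
  shows "mat_trace (A * C) \<le> mat_trace (B * C)"
  using trace_mult_psd_nonneg[OF assms(1,2)] trace_mult_minus_left[OF assms(4,3) psd_carrier[OF assms(2)]]
  by simp

text \<open>Under the trace, \<open>2 (B D - A C) = (B - A) (D + C) + (B + A) (D - C)\<close>.\<close>

lemma dominated_trace_mult:
  assumes AB: "dominated d A B" and CD: "dominated d C D"
  shows "mat_trace (A * C) \<le> mat_trace (B * D)"
proof -
  note [simp] = dominatedD(1,2)[OF AB] dominatedD(1,2)[OF CD]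
  have "0 \<le> mat_trace ((B - A) * (D + C)) + mat_trace ((B + A) * (D - C))"
    using trace_mult_psd_nonneg[OF dominatedD(3)[OF AB] dominatedD(4)[OF CD]]
      trace_mult_psd_nonneg[OF dominatedD(4)[OF AB] dominatedD(3)[OF CD]] by (rule add_nonneg_nonneg)
  also have "\<dots> = 2 * (mat_trace (B * D) - mat_trace (A * C))"
    by (simp add: trace_mult_minus_left[of _ d] trace_mult_add_left[of _ d]
        trace_mult_minus_right[of _ d] trace_mult_add_right[of _ d])
  finally show ?thesis by (simp add: less_eq_complex_def)
qed

section \<open>The trace norm and its dual pairing\<close>

lemma proots_linear_factors: "proots (\<Prod>a\<leftarrow>as. [:- a, 1:]) = mset as"
  for as :: "complex list"
proof (induction as)
  case (Cons a as)
  have "(\<Prod>a\<leftarrow>as. [:- a, 1:]) \<noteq> 0" by (auto simp: prod_list_zero_iff)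
  then show ?case using Cons by (simp add: proots_mult del: mult_pCons_left)
qed simp

text \<open>The witness is Y = |X|. The product of X with its adjoint has the squared eigenvalues of
  X as its spectrum, so the trace norm is the sum of their absolute values.\<close>

lemma trace_norm_hermitian:
  assumes X: "X \<in> carrier_mat n n" "mat_adjoint X = X"
  shows "\<exists>Y. dominated n X Y \<and> mat_trace Y = complex_of_real (trace_norm X)"
proof -
  obtain U d where U: "U \<in> carrier_mat n n" and U1: "mat_adjoint U * U = 1\<^sub>m n"
    and U2: "U * mat_adjoint U = 1\<^sub>m n" and XU: "X = U * real_diag n d * mat_adjoint U"
    using hermitian_diagonalization[OF X] by blast
  note Ua = mat_adjoint_carrier[OF U]
  have D: "real_diag n f \<in> carrier_mat n n" for f by simp
  have UD: "U * real_diag n f \<in> carrier_mat n n" for f using U by simp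
  let ?D2 = "real_diag n (\<lambda>i. d i * d i)"
  have "X * X = U * real_diag n d * (mat_adjoint U * (U * real_diag n d * mat_adjoint U))"
    unfolding XU by (rule assoc_mult_mat[OF UD Ua]) (use U in auto)
  also have "mat_adjoint U * (U * real_diag n d * mat_adjoint U) = real_diag n d * mat_adjoint U"
  proof -
    have "U * real_diag n d * mat_adjoint U = U * (real_diag n d * mat_adjoint U)"
      by (rule assoc_mult_mat[OF U D Ua])
    then show ?thesis
      using assoc_mult_mat[OF Ua U mult_carrier_mat[OF D Ua], of d]
        left_mult_one_mat[OF mult_carrier_mat[OF D Ua]] U1 by simp
  qed
  also have "U * real_diag n d * (real_diag n d * mat_adjoint U) = U * ?D2 * mat_adjoint U"
    using assoc_mult_mat[OF UD D Ua] assoc_mult_mat[OF U D D] real_diag_mult by metis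
  finally have XX: "mat_adjoint X * X = U * ?D2 * mat_adjoint U" using X(2) by simp
  have "similar_mat (mat_adjoint X * X) ?D2"
    using U Ua U1 U2 X XX by (intro similar_matI[of _ _ U "mat_adjoint U" n]) auto
  then have "char_poly (mat_adjoint X * X) = char_poly ?D2" by (rule char_poly_similar)
  also have "\<dots> = (\<Prod>a\<leftarrow>diag_mat ?D2. [:- a, 1:])"
    by (rule char_poly_upper_triangular[of _ n]) (auto simp: real_diag_def)
  also have "diag_mat ?D2 = map (\<lambda>i. complex_of_real (d i * d i)) [0..<n]"
    by (auto simp: diag_mat_def real_diag_def)
  finally have "proots (char_poly (mat_adjoint X * X))
      = mset (map (\<lambda>i. complex_of_real (d i * d i)) [0..<n])"
    by (simp only: proots_linear_factors)
  then have "trace_norm X = sum_mset (mset (map (\<lambda>i. \<bar>d i\<bar>) [0..<n]))"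
    unfolding trace_norm_def by (simp add: image_mset.compositionality comp_def)
  then have tn: "trace_norm X = (\<Sum>i<n. \<bar>d i\<bar>)"
    unfolding sum_mset_sum_list by (simp add: interv_sum_list_conv_sum_set_nat atLeast0LessThan)
  let ?A = "real_diag n (\<lambda>i. \<bar>d i\<bar>)"
  let ?Y = "U * ?A * mat_adjoint U"
  have Y: "?Y \<in> carrier_mat n n" using mult_carrier_mat[OF UD Ua] .
  have "mat_trace ?Y = mat_trace (mat_adjoint U * (U * ?A))"
    using mat_trace_comm[OF UD Ua] .
  also have "mat_adjoint U * (U * ?A) = ?A"
    using assoc_mult_mat[OF Ua U D, symmetric] U1 left_mult_one_mat[OF D] by simp
  also have "mat_trace ?A = complex_of_real (trace_norm X)"
    unfolding tn by (simp add: mat_trace_def real_diag_def)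
  finally have tr: "mat_trace ?Y = complex_of_real (trace_norm X)" .
  have "?Y - X = U * real_diag n (\<lambda>i. \<bar>d i\<bar> - d i) * mat_adjoint U"
  proof -
    have "real_diag n (\<lambda>i. \<bar>d i\<bar> - d i) = ?A - real_diag n d"
      by (intro eq_matI) (auto simp: real_diag_def)
    then show ?thesis
      unfolding XU using minus_mult_distrib_mat[OF UD UD Ua] mult_minus_distrib_mat[OF U D D] by simp
  qed
  then have p1: "psd n (?Y - X)"
    using psd_congruence[OF psd_real_diag U, of "\<lambda>i. \<bar>d i\<bar> - d i"] by simp
  have "?Y + X = U * real_diag n (\<lambda>i. \<bar>d i\<bar> + d i) * mat_adjoint U"
  proof -
    have "real_diag n (\<lambda>i. \<bar>d i\<bar> + d i) = ?A + real_diag n d"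
      by (intro eq_matI) (auto simp: real_diag_def)
    then show ?thesis
      unfolding XU using add_mult_distrib_mat[OF UD UD Ua] mult_add_distrib_mat[OF U D D] by simp
  qed
  then have p2: "psd n (?Y + X)"
    using psd_congruence[OF psd_real_diag U, of "\<lambda>i. \<bar>d i\<bar> + d i"] by simp
  from tr p1 p2 X Y show ?thesis unfolding dominated_def by blast
qed

lemma sum_mset_image_nonneg:
  fixes f :: "'a \<Rightarrow> real"
  assumes "\<And>x. x \<in># M \<Longrightarrow> 0 \<le> f x"
  shows "0 \<le> (\<Sum>x\<in>#M. f x)"
  using assms by (induction M) auto

text \<open>Real \<open>sqrt\<close> is odd, hence negative on negative arguments, so the roots of
  the characteristic polynomial must be shown to be nonnegative: they are eigenvalues of a Gram
  matrix.\<close>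

lemma trace_norm_nonneg:
  assumes X: "X \<in> carrier_mat m n"
  shows "0 \<le> trace_norm X"
proof -
  let ?A = "mat_adjoint X * X"
  have A: "?A \<in> carrier_mat n n" using X by auto
  have "0 \<le> sqrt (Re z)" if "z \<in># proots (char_poly ?A)" for z
  proof -
    have "char_poly ?A \<noteq> 0" using degree_monic_char_poly[OF A] by auto
    then have "poly (char_poly ?A) z = 0" using that by simp
    then have "eigenvalue ?A z" unfolding eigenvalue_root_char_poly[OF A] .
    then obtain v where v: "v \<in> carrier_vec n" "v \<noteq> 0\<^sub>v n" "?A *\<^sub>v v = z \<cdot>\<^sub>v v"
      using A unfolding eigenvalue_def eigenvector_def by auto
    have "psd n (mat_adjoint X * mat_adjoint (mat_adjoint X))"
      by (rule psd_gram) (use X in auto)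
    then have "0 \<le> z * (v \<bullet>c v)"
      using psd_quadratic[of n ?A v] v by simp
    moreover have "0 < v \<bullet>c v" using v by simp
    ultimately have "0 \<le> Re z"
      by (auto simp: less_eq_complex_def less_complex_def zero_le_mult_iff)
    then show ?thesis by simp
  qed
  then show ?thesis unfolding trace_norm_def by (rule sum_mset_image_nonneg)
qed

lemma trace_norm_zero: "trace_norm (0\<^sub>m n n) = 0"
proof -
  have "char_poly (0\<^sub>m n n :: complex mat) = (\<Prod>a\<leftarrow>diag_mat (0\<^sub>m n n). [:- a, 1:])"
    by (rule char_poly_upper_triangular[of _ n]) auto
  also have "diag_mat (0\<^sub>m n n :: complex mat) = replicate n 0"
    by (intro nth_equalityI) (auto simp: diag_mat_def)
  finally have "proots (char_poly (0\<^sub>m n n :: complex mat)) = mset (replicate n 0)"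
    by (simp only: proots_linear_factors)
  moreover have "mat_adjoint (0\<^sub>m n n) * 0\<^sub>m n n = (0\<^sub>m n n :: complex mat)"
    by (rule right_mult_zero_mat) auto
  ultimately show ?thesis unfolding trace_norm_def by auto
qed

text \<open>Hoelder's inequality for the operator norm and the trace norm, obtained by pairing the
  domination of W by the identity with that of X by |X|.\<close>

lemma trace_norm_ge:
  assumes W: "dominated n W (1\<^sub>m n)" and X: "X \<in> carrier_mat n n" "mat_adjoint X = X"
  shows "Re (mat_trace (W * X)) \<le> trace_norm X"
proof -
  obtain Y where Y: "dominated n X Y" "mat_trace Y = complex_of_real (trace_norm X)"
    using trace_norm_hermitian[OF X] by blast
  have "mat_trace (W * X) \<le> mat_trace (1\<^sub>m n * Y)" by (rule dominated_trace_mult[OF W Y(1)])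
  then show ?thesis using Y dominatedD(2)[OF Y(1)] by (simp add: less_eq_complex_def)
qed


section \<open>Bipartite tensor products and partial transposition\<close>

lemma mult_add_less:
  fixes i j a b :: nat
  assumes "i < a" "j < b"
  shows "i * b + j < a * b"
proof -
  have "i * b + j < i * b + b" using assms by simp
  also have "\<dots> = Suc i * b" by simp
  also have "\<dots> \<le> a * b" using assms by (intro mult_le_mono1) simp
  finally show ?thesis .
qed

lemma div_less_of_less_mult: "(r::nat) < a * b \<Longrightarrow> r div b < a"
  by (simp add: less_mult_imp_div_less)

lemma mod_less_of_less_mult: "(r::nat) < a * b \<Longrightarrow> r mod b < b"
  by (cases b) auto

context
  fixes a1 b1 a2 b2 r :: nat
  assumes r: "r < (a1 * a2) * (b1 * b2)"
begin

lemma split_index_bounds: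
  "r div (b1 * b2) div a2 < a1" "r div (b1 * b2) mod a2 < a2"
  "r mod (b1 * b2) div b2 < b1" "r mod (b1 * b2) mod b2 < b2"
proof -
  have "r div (b1 * b2) < a1 * a2" using div_less_of_less_mult[OF r] .
  then show "r div (b1 * b2) div a2 < a1" "r div (b1 * b2) mod a2 < a2"
    using div_less_of_less_mult mod_less_of_less_mult by blast+
  have "r mod (b1 * b2) < b1 * b2" using mod_less_of_less_mult[OF r] .
  then show "r mod (b1 * b2) div b2 < b1" "r mod (b1 * b2) mod b2 < b2"
    using div_less_of_less_mult mod_less_of_less_mult by blast+
qed

lemma left_index_less: "left_index b1 a2 b2 r < a1 * b1"
  and right_index_less: "right_index b1 a2 b2 r < a2 * b2"
  unfolding left_index_def right_index_def using split_index_bounds by (auto intro: mult_add_less)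

lemma left_index_div: "left_index b1 a2 b2 r div b1 = r div (b1 * b2) div a2"
  and left_index_mod: "left_index b1 a2 b2 r mod b1 = r mod (b1 * b2) div b2"
  and right_index_div: "right_index b1 a2 b2 r div b2 = r div (b1 * b2) mod a2"
  and right_index_mod: "right_index b1 a2 b2 r mod b2 = r mod (b1 * b2) mod b2"
  unfolding left_index_def right_index_def using split_index_bounds by auto

end

lemma left_right_index_inj:
  assumes r: "r < (a1 * a2) * (b1 * b2)" and s: "s < (a1 * a2) * (b1 * b2)"
    and eq: "left_index b1 a2 b2 r = left_index b1 a2 b2 s"
      "right_index b1 a2 b2 r = right_index b1 a2 b2 s"
  shows "r = s"
proof -
  have "r div (b1 * b2) = s div (b1 * b2)"
    using left_index_div[OF r] left_index_div[OF s] right_index_div[OF r] right_index_div[OF s] eq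
    by (metis div_mult_mod_eq)
  moreover have "r mod (b1 * b2) = s mod (b1 * b2)"
    using left_index_mod[OF r] left_index_mod[OF s] right_index_mod[OF r] right_index_mod[OF s] eq
    by (metis div_mult_mod_eq)
  ultimately show ?thesis by (metis div_mult_mod_eq)
qed

text \<open>Injectivity and equal cardinalities give surjectivity. Reindexing along this bijection
  makes sums over a joint index factor, which is behind the product and trace rules for tensor
  products.\<close>

lemma left_right_index_bij:
  "bij_betw (\<lambda>r. (left_index b1 a2 b2 r, right_index b1 a2 b2 r))
     {..<(a1 * a2) * (b1 * b2)} ({..<a1 * b1} \<times> {..<a2 * b2})" (is "bij_betw ?f ?A ?B")
proof -
  have inj: "inj_on ?f ?A" by (auto simp: inj_on_def intro: left_right_index_inj)
  have "?f ` ?A \<subseteq> ?B" using left_index_less right_index_less by blast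
  moreover have "card (?f ` ?A) = card ?B" unfolding card_image[OF inj] by simp
  ultimately have "?f ` ?A = ?B" by (intro card_subset_eq) auto
  with inj show ?thesis by (simp add: bij_betw_def)
qed

lemma sum_left_right_index:
  "(\<Sum>r<(a1 * a2) * (b1 * b2). f (left_index b1 a2 b2 r) (right_index b1 a2 b2 r))
     = (\<Sum>l<a1 * b1. \<Sum>m<a2 * b2. f l m)"
  using sum.reindex_bij_betw[OF left_right_index_bij, of "\<lambda>(l, m). f l m" b1 a2 b2 a1]
  by (simp add: sum.cartesian_product)

section \<open>Products, traces, positivity and order of tensor products\<close>

text \<open>The rectangular version of \<^const>\<open>bipartite_tensor\<close>: the dimensions
  \<open>a1, b1, a2, b2\<close> are those of the rows and \<open>c1, d1, c2, d2\<close> those of the columns.\<close>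

definition rect_tensor ::
    "nat \<Rightarrow> nat \<Rightarrow> nat \<Rightarrow> nat \<Rightarrow> nat \<Rightarrow> nat \<Rightarrow> nat \<Rightarrow> nat \<Rightarrow> complex mat \<Rightarrow> complex mat \<Rightarrow> complex mat" where
  "rect_tensor a1 b1 a2 b2 c1 d1 c2 d2 X Y =
     mat ((a1 * a2) * (b1 * b2)) ((c1 * c2) * (d1 * d2))
     (\<lambda>(r, c). X $$ (left_index b1 a2 b2 r, left_index d1 c2 d2 c)
             * Y $$ (right_index b1 a2 b2 r, right_index d1 c2 d2 c))"

lemma bipartite_tensor_rect: "bipartite_tensor a b a' b' = rect_tensor a b a' b' a b a' b'"
  by (simp add: fun_eq_iff bipartite_tensor_def rect_tensor_def)

lemma rect_tensor_carrier:
  "rect_tensor a1 b1 a2 b2 c1 d1 c2 d2 X Y \<in> carrier_mat ((a1 * a2) * (b1 * b2)) ((c1 * c2) * (d1 * d2))"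
  by (simp add: rect_tensor_def)

lemma dim_rect_tensor [simp]:
  "dim_row (rect_tensor a1 b1 a2 b2 c1 d1 c2 d2 X Y) = (a1 * a2) * (b1 * b2)"
  "dim_col (rect_tensor a1 b1 a2 b2 c1 d1 c2 d2 X Y) = (c1 * c2) * (d1 * d2)"
  by (simp_all add: rect_tensor_def)

lemma rect_tensor_index:
  assumes "r < (a1 * a2) * (b1 * b2)" "c < (c1 * c2) * (d1 * d2)"
  shows "rect_tensor a1 b1 a2 b2 c1 d1 c2 d2 X Y $$ (r, c)
       = X $$ (left_index b1 a2 b2 r, left_index d1 c2 d2 c)
       * Y $$ (right_index b1 a2 b2 r, right_index d1 c2 d2 c)"
  using assms by (simp add: rect_tensor_def)

lemma mat_mult_index:
  assumes "A \<in> carrier_mat m n" "B \<in> carrier_mat n k" "i < m" "j < k"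
  shows "(A * B) $$ (i, j) = (\<Sum>l<n. A $$ (i, l) * B $$ (l, j))"
  using assms by (auto simp: scalar_prod_def atLeast0LessThan intro!: sum.cong)

lemma rect_tensor_mult:
  assumes X: "X \<in> carrier_mat (a1 * b1) (c1 * d1)" and Y: "Y \<in> carrier_mat (a2 * b2) (c2 * d2)"
    and X': "X' \<in> carrier_mat (c1 * d1) (e1 * f1)" and Y': "Y' \<in> carrier_mat (c2 * d2) (e2 * f2)"
  shows "rect_tensor a1 b1 a2 b2 c1 d1 c2 d2 X Y * rect_tensor c1 d1 c2 d2 e1 f1 e2 f2 X' Y'
       = rect_tensor a1 b1 a2 b2 e1 f1 e2 f2 (X * X') (Y * Y')" (is "?T * ?T' = ?R")
proof (rule eq_matI)
  fix r c assume "r < dim_row ?R" "c < dim_col ?R"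
  then have rc: "r < (a1 * a2) * (b1 * b2)" "c < (e1 * e2) * (f1 * f2)" by auto
  let ?l = "left_index b1 a2 b2 r" and ?m = "right_index b1 a2 b2 r"
  let ?l' = "left_index f1 e2 f2 c" and ?m' = "right_index f1 e2 f2 c"
  note bounds = left_index_less[OF rc(1)] right_index_less[OF rc(1)]
    left_index_less[OF rc(2)] right_index_less[OF rc(2)]
  have "(?T * ?T') $$ (r, c) = (\<Sum>k<(c1 * c2) * (d1 * d2). ?T $$ (r, k) * ?T' $$ (k, c))"
    by (rule mat_mult_index[OF rect_tensor_carrier rect_tensor_carrier rc])
  also have "\<dots> = (\<Sum>k<(c1 * c2) * (d1 * d2).
      (X $$ (?l, left_index d1 c2 d2 k) * X' $$ (left_index d1 c2 d2 k, ?l'))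
    * (Y $$ (?m, right_index d1 c2 d2 k) * Y' $$ (right_index d1 c2 d2 k, ?m')))"
    using rc by (intro sum.cong) (auto simp: rect_tensor_index)
  also have "\<dots> = (\<Sum>l<c1 * d1. \<Sum>m<c2 * d2. (X $$ (?l, l) * X' $$ (l, ?l')) * (Y $$ (?m, m) * Y' $$ (m, ?m')))"
    by (rule sum_left_right_index)
  also have "\<dots> = (\<Sum>l<c1 * d1. X $$ (?l, l) * X' $$ (l, ?l')) * (\<Sum>m<c2 * d2. Y $$ (?m, m) * Y' $$ (m, ?m'))"
    by (rule sum_product[symmetric])
  also have "\<dots> = (X * X') $$ (?l, ?l') * (Y * Y') $$ (?m, ?m')"
    by (simp only: mat_mult_index[OF X X' bounds(1,3)] mat_mult_index[OF Y Y' bounds(2,4)])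
  also have "\<dots> = ?R $$ (r, c)" using rc by (simp add: rect_tensor_index)
  finally show "(?T * ?T') $$ (r, c) = ?R $$ (r, c)" .
qed auto

lemma rect_tensor_adjoint:
  assumes X: "X \<in> carrier_mat (a1 * b1) (c1 * d1)" and Y: "Y \<in> carrier_mat (a2 * b2) (c2 * d2)"
  shows "mat_adjoint (rect_tensor a1 b1 a2 b2 c1 d1 c2 d2 X Y)
       = rect_tensor c1 d1 c2 d2 a1 b1 a2 b2 (mat_adjoint X) (mat_adjoint Y)" (is "?L = ?R")
proof (rule eq_matI)
  fix r c assume "r < dim_row ?R" "c < dim_col ?R"
  then have rc: "r < (c1 * c2) * (d1 * d2)" "c < (a1 * a2) * (b1 * b2)" by auto
  then show "?L $$ (r, c) = ?R $$ (r, c)"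
    using X Y left_index_less[OF rc(1)] right_index_less[OF rc(1)]
      left_index_less[OF rc(2)] right_index_less[OF rc(2)]
    by (simp add: rect_tensor_index)
qed auto

lemma bipartite_tensor_carrier:
  "bipartite_tensor a1 b1 a2 b2 X Y \<in> carrier_mat ((a1 * a2) * (b1 * b2)) ((a1 * a2) * (b1 * b2))"
  by (simp add: bipartite_tensor_def)

lemma bipartite_tensor_index:
  assumes "r < (a1 * a2) * (b1 * b2)" "c < (a1 * a2) * (b1 * b2)"
  shows "bipartite_tensor a1 b1 a2 b2 X Y $$ (r, c)
       = X $$ (left_index b1 a2 b2 r, left_index b1 a2 b2 c)
       * Y $$ (right_index b1 a2 b2 r, right_index b1 a2 b2 c)"
  using assms by (simp add: bipartite_tensor_def)

lemma bipartite_tensor_mult: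
  assumes "X \<in> carrier_mat (a1 * b1) (a1 * b1)" "Y \<in> carrier_mat (a2 * b2) (a2 * b2)"
    "X' \<in> carrier_mat (a1 * b1) (a1 * b1)" "Y' \<in> carrier_mat (a2 * b2) (a2 * b2)"
  shows "bipartite_tensor a1 b1 a2 b2 X Y * bipartite_tensor a1 b1 a2 b2 X' Y'
       = bipartite_tensor a1 b1 a2 b2 (X * X') (Y * Y')"
  unfolding bipartite_tensor_rect by (rule rect_tensor_mult[OF assms])

lemma bipartite_tensor_trace:
  assumes X: "X \<in> carrier_mat (a1 * b1) (a1 * b1)" and Y: "Y \<in> carrier_mat (a2 * b2) (a2 * b2)"
  shows "mat_trace (bipartite_tensor a1 b1 a2 b2 X Y) = mat_trace X * mat_trace Y"
proof -
  have "mat_trace (bipartite_tensor a1 b1 a2 b2 X Y)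
      = (\<Sum>r<(a1 * a2) * (b1 * b2). X $$ (left_index b1 a2 b2 r, left_index b1 a2 b2 r)
          * Y $$ (right_index b1 a2 b2 r, right_index b1 a2 b2 r))"
    by (simp add: mat_trace_def bipartite_tensor_def)
  also have "\<dots> = (\<Sum>l<a1 * b1. \<Sum>m<a2 * b2. X $$ (l, l) * Y $$ (m, m))"
    by (rule sum_left_right_index)
  also have "\<dots> = mat_trace X * mat_trace Y"
    using X Y by (simp add: mat_trace_def sum_product)
  finally show ?thesis .
qed

text \<open>Factorizations of the two operators tensor to a factorization of their tensor
  product.\<close>

lemma psd_bipartite_tensor:
  assumes X: "psd (a1 * b1) X" and Y: "psd (a2 * b2) Y"
  shows "psd ((a1 * a2) * (b1 * b2)) (bipartite_tensor a1 b1 a2 b2 X Y)"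
proof -
  obtain K where K: "K \<in> carrier_mat (a1 * b1) (a1 * b1)" "X = K * mat_adjoint K"
    using psd_factorization[OF X] by blast
  obtain L where L: "L \<in> carrier_mat (a2 * b2) (a2 * b2)" "Y = L * mat_adjoint L"
    using psd_factorization[OF Y] by blast
  have "bipartite_tensor a1 b1 a2 b2 X Y
      = bipartite_tensor a1 b1 a2 b2 K L * mat_adjoint (bipartite_tensor a1 b1 a2 b2 K L)"
    unfolding K(2) L(2) bipartite_tensor_rect rect_tensor_adjoint[OF K(1) L(1)]
    using rect_tensor_mult[OF K(1) L(1) mat_adjoint_carrier[OF K(1)] mat_adjoint_carrier[OF L(1)]] by simp
  then show ?thesis using psd_gram[OF bipartite_tensor_carrier] by simp
qed

text \<open>Follows from \<open>2 (B \<otimes> D \<minusplus> A \<otimes> C) = (B - A) \<otimes> (D \<plusminus> C) + (B + A) \<otimes> (D \<minusplus> C)\<close>.\<close>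

lemma dominated_bipartite_tensor:
  assumes AB: "dominated (a1 * b1) A B" and CD: "dominated (a2 * b2) C D"
  shows "dominated ((a1 * a2) * (b1 * b2)) (bipartite_tensor a1 b1 a2 b2 A C)
           (bipartite_tensor a1 b1 a2 b2 B D)"
proof -
  let ?T = "bipartite_tensor a1 b1 a2 b2" and ?d = "(a1 * a2) * (b1 * b2)"
  let ?l = "left_index b1 a2 b2" and ?r = "right_index b1 a2 b2"
  note A = dominatedD[OF AB] and C = dominatedD[OF CD]
  have half: "psd ?d X" if "psd ?d Y" "X = complex_of_real (1/2) \<cdot>\<^sub>m Y" for X Y
    using psd_smult[OF that(1), of "1/2"] that(2) by simp
  have entry: "?T (B + A) (D + C) $$ (i, j) = (B $$ (?l i, ?l j) + A $$ (?l i, ?l j)) * (D $$ (?r i, ?r j) + C $$ (?r i, ?r j))"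
      "?T (B + A) (D - C) $$ (i, j) = (B $$ (?l i, ?l j) + A $$ (?l i, ?l j)) * (D $$ (?r i, ?r j) - C $$ (?r i, ?r j))"
      "?T (B - A) (D + C) $$ (i, j) = (B $$ (?l i, ?l j) - A $$ (?l i, ?l j)) * (D $$ (?r i, ?r j) + C $$ (?r i, ?r j))"
      "?T (B - A) (D - C) $$ (i, j) = (B $$ (?l i, ?l j) - A $$ (?l i, ?l j)) * (D $$ (?r i, ?r j) - C $$ (?r i, ?r j))"
      "?T B D $$ (i, j) = B $$ (?l i, ?l j) * D $$ (?r i, ?r j)"
      "?T A C $$ (i, j) = A $$ (?l i, ?l j) * C $$ (?r i, ?r j)"
    if "i < ?d" "j < ?d" for i j
    using A(1,2) C(1,2) that
    by (simp_all add: bipartite_tensor_index left_index_less right_index_less)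
  have "psd ?d (?T B D - ?T A C)"
  proof (rule half)
    show "psd ?d (?T (B - A) (D + C) + ?T (B + A) (D - C))"
      by (intro psd_add psd_bipartite_tensor A C)
    show "?T B D - ?T A C = complex_of_real (1/2) \<cdot>\<^sub>m (?T (B - A) (D + C) + ?T (B + A) (D - C))"
      by (rule eq_matI)
        (simp_all add: entry carrier_matD[OF bipartite_tensor_carrier] distrib_left distrib_right
          left_diff_distrib right_diff_distrib)
  qed
  moreover have "psd ?d (?T B D + ?T A C)"
  proof (rule half)
    show "psd ?d (?T (B - A) (D - C) + ?T (B + A) (D + C))"
      by (intro psd_add psd_bipartite_tensor A C)
    show "?T B D + ?T A C = complex_of_real (1/2) \<cdot>\<^sub>m (?T (B - A) (D - C) + ?T (B + A) (D + C))"
      by (rule eq_matI)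
        (simp_all add: entry carrier_matD[OF bipartite_tensor_carrier] distrib_left distrib_right
          left_diff_distrib right_diff_distrib)
  qed
  ultimately show ?thesis unfolding dominated_def using bipartite_tensor_carrier by blast
qed

lemma bipartite_tensor_one:
  "bipartite_tensor a1 b1 a2 b2 (1\<^sub>m (a1 * b1)) (1\<^sub>m (a2 * b2)) = 1\<^sub>m ((a1 * a2) * (b1 * b2))"
proof (rule eq_matI)
  fix r c assume "r < dim_row (1\<^sub>m ((a1 * a2) * (b1 * b2)))" "c < dim_col (1\<^sub>m ((a1 * a2) * (b1 * b2)))"
  then have "r < (a1 * a2) * (b1 * b2)" "c < (a1 * a2) * (b1 * b2)" by auto
  then show "bipartite_tensor a1 b1 a2 b2 (1\<^sub>m (a1 * b1)) (1\<^sub>m (a2 * b2)) $$ (r, c)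
      = 1\<^sub>m ((a1 * a2) * (b1 * b2)) $$ (r, c)"
    using left_right_index_inj[of r a1 a2 b1 b2 c]
    by (auto simp: bipartite_tensor_index left_index_less right_index_less)
qed (auto simp: bipartite_tensor_def)

section \<open>Tensor powers\<close>

lemma tensor_power_carrier:
  "tensor_power a b X n \<in> carrier_mat (a ^ n * b ^ n) (a ^ n * b ^ n)"
  using bipartite_tensor_carrier by (cases n) auto

lemma tensor_power_mult:
  assumes "X \<in> carrier_mat (a * b) (a * b)" "Y \<in> carrier_mat (a * b) (a * b)"
  shows "tensor_power a b X n * tensor_power a b Y n = tensor_power a b (X * Y) n"
  by (induction n) (simp_all add: bipartite_tensor_mult assms tensor_power_carrier)

lemma tensor_power_trace:
  assumes "X \<in> carrier_mat (a * b) (a * b)"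
  shows "mat_trace (tensor_power a b X n) = mat_trace X ^ n"
proof (induction n)
  case 0
  show ?case by (simp add: mat_trace_def)
next
  case (Suc n)
  then show ?case by (simp add: bipartite_tensor_trace assms tensor_power_carrier)
qed

lemma tensor_power_psd:
  assumes "psd (a * b) X"
  shows "psd (a ^ n * b ^ n) (tensor_power a b X n)"
  by (induction n) (use psd_one[of 1] psd_bipartite_tensor[OF assms] in auto)

lemma dominated_one: "dominated d (1\<^sub>m d) (1\<^sub>m d)"
proof -
  have "1\<^sub>m d - 1\<^sub>m d = (0\<^sub>m d d :: complex mat)" by auto
  with psd_zero[of d] have "psd d (1\<^sub>m d - 1\<^sub>m d)" by metis
  then show ?thesis unfolding dominated_def by (intro conjI one_carrier_mat psd_add psd_one)
qed

lemma tensor_power_dominated: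
  assumes "dominated (a * b) X Y"
  shows "dominated (a ^ n * b ^ n) (tensor_power a b X n) (tensor_power a b Y n)"
  by (induction n) (use dominated_one[of 1] dominated_bipartite_tensor[OF assms] in auto)

lemma tensor_power_scaled_one:
  "tensor_power a b (c \<cdot>\<^sub>m 1\<^sub>m (a * b)) n = c ^ n \<cdot>\<^sub>m 1\<^sub>m (a ^ n * b ^ n)"
proof (induction n)
  case (Suc n)
  have "bipartite_tensor a b (a ^ n) (b ^ n) (c \<cdot>\<^sub>m 1\<^sub>m (a * b)) (c ^ n \<cdot>\<^sub>m 1\<^sub>m (a ^ n * b ^ n))
      = (c * c ^ n) \<cdot>\<^sub>m bipartite_tensor a b (a ^ n) (b ^ n) (1\<^sub>m (a * b)) (1\<^sub>m (a ^ n * b ^ n))"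
    by (intro eq_matI) (auto simp: bipartite_tensor_def left_index_less right_index_less)
  then show ?case using Suc by (simp add: bipartite_tensor_one)
qed (auto intro: eq_matI)

section \<open>Partial transposition\<close>

definition cross_index :: "nat \<Rightarrow> nat \<Rightarrow> nat \<Rightarrow> nat" where
  "cross_index b r c = (r div b) * b + c mod b"

lemma cross_index_less:
  assumes "r < a * b" "c < a' * b"
  shows "cross_index b r c < a * b"
  unfolding cross_index_def using assms
  by (intro mult_add_less) (auto intro: div_less_of_less_mult mod_less_of_less_mult)

lemma cross_index_div_mod:
  assumes "c < a * b"
  shows "cross_index b r c div b = r div b" "cross_index b r c mod b = c mod b"
  using mod_less_of_less_mult[OF assms] by (auto simp: cross_index_def)

text \<open>Crossing in both orders exchanges Bob's digits of row and column, and a second exchange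
  restores them; hence partial transposition is an involution.\<close>

lemma cross_index_cross:
  assumes "r < a * b" "c < a * b"
  shows "cross_index b (cross_index b r c) (cross_index b c r) = r"
  using cross_index_div_mod[OF assms(1)] cross_index_div_mod[OF assms(2)]
  by (simp add: cross_index_def)

text \<open>Bob's joint digit is exchanged as a whole, which exchanges its two components
  separately. Hence partial transposition commutes with tensor products.\<close>

lemma cross_index_left_right:
  assumes r: "r < (a1 * a2) * (b1 * b2)" and c: "c < (a1 * a2) * (b1 * b2)"
  shows "left_index b1 a2 b2 (cross_index (b1 * b2) r c)
           = cross_index b1 (left_index b1 a2 b2 r) (left_index b1 a2 b2 c)"
    and "right_index b1 a2 b2 (cross_index (b1 * b2) r c)
           = cross_index b2 (right_index b1 a2 b2 r) (right_index b1 a2 b2 c)"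
  unfolding cross_index_def[of b1] cross_index_def[of b2]
    left_index_div[OF r] left_index_mod[OF c] right_index_div[OF r] right_index_mod[OF c]
  by (simp_all add: left_index_def right_index_def cross_index_div_mod[OF c])

lemma partial_transpose_carrier [simp]: "partial_transpose a b X \<in> carrier_mat (a * b) (a * b)"
  by (simp add: partial_transpose_def)

lemma partial_transpose_index:
  assumes "r < a * b" "c < a * b"
  shows "partial_transpose a b X $$ (r, c) = X $$ (cross_index b r c, cross_index b c r)"
  using assms by (simp add: partial_transpose_def cross_index_def)

lemma partial_transpose_involution:
  assumes "X \<in> carrier_mat (a * b) (a * b)"
  shows "partial_transpose a b (partial_transpose a b X) = X"
  using assms
  by (intro eq_matI)
    (auto simp: partial_transpose_index cross_index_less cross_index_cross carrier_matD[OF partial_transpose_carrier])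

lemma partial_transpose_bipartite_tensor:
  assumes "X \<in> carrier_mat (a1 * b1) (a1 * b1)" "Y \<in> carrier_mat (a2 * b2) (a2 * b2)"
  shows "partial_transpose (a1 * a2) (b1 * b2) (bipartite_tensor a1 b1 a2 b2 X Y)
       = bipartite_tensor a1 b1 a2 b2 (partial_transpose a1 b1 X) (partial_transpose a2 b2 Y)"
    (is "?L = ?R")
proof (rule eq_matI)
  fix r c assume "r < dim_row ?R" "c < dim_col ?R"
  then have rc: "r < (a1 * a2) * (b1 * b2)" "c < (a1 * a2) * (b1 * b2)"
    by (auto simp: bipartite_tensor_def)
  note less = cross_index_less[OF rc] cross_index_less[OF rc(2,1)]
  show "?L $$ (r, c) = ?R $$ (r, c)"
    unfolding partial_transpose_index[OF rc] bipartite_tensor_index[OF less] bipartite_tensor_index[OF rc]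
      cross_index_left_right[OF rc] cross_index_left_right[OF rc(2,1)]
      partial_transpose_index[OF left_index_less[OF rc(1)] left_index_less[OF rc(2)]]
      partial_transpose_index[OF right_index_less[OF rc(1)] right_index_less[OF rc(2)]] ..
qed (auto simp: bipartite_tensor_def partial_transpose_def)

lemma partial_transpose_tensor_power:
  assumes "X \<in> carrier_mat (a * b) (a * b)"
  shows "partial_transpose (a ^ n) (b ^ n) (tensor_power a b X n)
       = tensor_power a b (partial_transpose a b X) n"
proof (induction n)
  case 0
  show ?case by (intro eq_matI) (auto simp: partial_transpose_def)
next
  case (Suc n)
  then show ?case by (simp add: partial_transpose_bipartite_tensor assms tensor_power_carrier)
qed

lemma sum_div_mod:
  "(\<Sum>r<a * b. f (r div b) (r mod b)) = (\<Sum>i<a. \<Sum>j<(b::nat). f i j)"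
proof -
  have "bij_betw (\<lambda>r. (r div b, r mod b)) {..<a * b} ({..<a} \<times> {..<b})"
    by (rule bij_betw_byWitness[where f' = "\<lambda>(i, j). i * b + j"])
      (auto intro: div_less_of_less_mult mod_less_of_less_mult mult_add_less)
  from sum.reindex_bij_betw[OF this, of "\<lambda>(i, j). f i j"] show ?thesis
    by (simp add: sum.cartesian_product)
qed

text \<open>Written over digit pairs, transposing both factors only exchanges the names of Bob's two
  summation indices; the chain below unfolds indices into digits, reorders the four sums and folds
  back.\<close>

lemma partial_transpose_trace_mult:
  assumes "X \<in> carrier_mat (a * b) (a * b)" "Y \<in> carrier_mat (a * b) (a * b)"
  shows "mat_trace (partial_transpose a b X * partial_transpose a b Y) = mat_trace (X * Y)"
proof -
  have "mat_trace (partial_transpose a b X * partial_transpose a b Y)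
      = (\<Sum>r<a * b. \<Sum>c<a * b. X $$ ((r div b) * b + c mod b, (c div b) * b + r mod b)
            * Y $$ ((c div b) * b + r mod b, (r div b) * b + c mod b))"
    by (simp add: mat_trace_mult[of _ "a * b" "a * b"] partial_transpose_def)
  also have "\<dots> = (\<Sum>r<a * b. \<Sum>k<a. \<Sum>l<b. X $$ ((r div b) * b + l, k * b + r mod b) * Y $$ (k * b + r mod b, (r div b) * b + l))"
    by (rule sum.cong[OF refl], rule sum_div_mod[where f = "\<lambda>k l. X $$ ((r div b) * b + l, k * b + r mod b) * Y $$ (k * b + r mod b, (r div b) * b + l)" for r])
  also have "\<dots> = (\<Sum>i<a. \<Sum>j<b. \<Sum>k<a. \<Sum>l<b. X $$ (i * b + l, k * b + j) * Y $$ (k * b + j, i * b + l))"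
    by (rule sum_div_mod)
  also have "\<dots> = (\<Sum>i<a. \<Sum>k<a. \<Sum>l<b. \<Sum>j<b. X $$ (i * b + l, k * b + j) * Y $$ (k * b + j, i * b + l))"
    by (rule sum.cong[OF refl], subst sum.swap, rule sum.cong[OF refl], rule sum.swap)
  also have "\<dots> = (\<Sum>i<a. \<Sum>l<b. \<Sum>k<a. \<Sum>j<b. X $$ (i * b + l, k * b + j) * Y $$ (k * b + j, i * b + l))"
    by (rule sum.cong[OF refl], rule sum.swap)
  also have "\<dots> = (\<Sum>r<a * b. \<Sum>k<a. \<Sum>j<b. X $$ ((r div b) * b + r mod b, k * b + j) * Y $$ (k * b + j, (r div b) * b + r mod b))"
    by (rule sum_div_mod[symmetric])
  also have "\<dots> = (\<Sum>r<a * b. \<Sum>c<a * b. X $$ ((r div b) * b + r mod b, (c div b) * b + c mod b) * Y $$ ((c div b) * b + c mod b, (r div b) * b + r mod b))"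
    by (rule sum.cong[OF refl], rule sum_div_mod[where f = "\<lambda>k j. X $$ ((r div b) * b + r mod b, k * b + j) * Y $$ (k * b + j, (r div b) * b + r mod b)" for r, symmetric])
  also have "\<dots> = mat_trace (X * Y)"
    by (simp add: mat_trace_mult[OF assms])
  finally show ?thesis .
qed

lemma partial_transpose_trace:
  assumes "X \<in> carrier_mat (a * b) (a * b)"
  shows "mat_trace (partial_transpose a b X) = mat_trace X"
  using assms by (simp add: mat_trace_def partial_transpose_def)

lemma partial_transpose_minus:
  assumes "X \<in> carrier_mat (a * b) (a * b)" "Y \<in> carrier_mat (a * b) (a * b)"
  shows "partial_transpose a b (X - Y) = partial_transpose a b X - partial_transpose a b Y"
  using assms by (intro eq_matI)
    (auto simp: partial_transpose_index cross_index_less carrier_matD[OF partial_transpose_carrier])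

lemma partial_transpose_smult:
  assumes "X \<in> carrier_mat (a * b) (a * b)"
  shows "partial_transpose a b (c \<cdot>\<^sub>m X) = c \<cdot>\<^sub>m partial_transpose a b X"
  using assms by (intro eq_matI)
    (auto simp: partial_transpose_index cross_index_less carrier_matD[OF partial_transpose_carrier])


section \<open>Kraus maps\<close>

definition kraus_map ::
    "nat \<Rightarrow> (nat \<Rightarrow> complex mat) \<Rightarrow> nat \<Rightarrow> complex mat \<Rightarrow> complex mat" where
  "kraus_map N K d' X = mat d' d' (\<lambda>(r, c). \<Sum>i<N. (K i * X * mat_adjoint (K i)) $$ (r, c))"

lemma kraus_map_carrier [simp]: "kraus_map N K d' X \<in> carrier_mat d' d'"
  by (simp add: kraus_map_def)

lemma kraus_map_cong:
  assumes "\<And>i. i < N \<Longrightarrow> K i = K' i"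
  shows "kraus_map N K d' X = kraus_map N K' d' X"
  using assms by (simp add: kraus_map_def cong: sum.cong_simp)

lemma congruence_index:
  assumes K: "K \<in> carrier_mat m n" and X: "X \<in> carrier_mat n n" and "r < m" "c < m"
  shows "(K * X * mat_adjoint K) $$ (r, c) = (\<Sum>s<n. \<Sum>t<n. K $$ (r, s) * X $$ (s, t) * cnj (K $$ (c, t)))"
proof -
  have "(K * X * mat_adjoint K) $$ (r, c) = (\<Sum>t<n. (K * X) $$ (r, t) * mat_adjoint K $$ (t, c))"
    using assms by (intro mat_mult_index) auto
  also have "\<dots> = (\<Sum>t<n. \<Sum>s<n. K $$ (r, s) * X $$ (s, t) * cnj (K $$ (c, t)))"
    using assms by (simp add: mat_mult_index[OF K X] sum_distrib_right del: index_mult_mat)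
  finally show ?thesis by (subst sum.swap)
qed

lemma kraus_map_index:
  assumes "\<And>i. i < N \<Longrightarrow> K i \<in> carrier_mat d' d" "X \<in> carrier_mat d d" "r < d'" "c < d'"
  shows "kraus_map N K d' X $$ (r, c)
       = (\<Sum>i<N. \<Sum>s<d. \<Sum>t<d. K i $$ (r, s) * X $$ (s, t) * cnj (K i $$ (c, t)))"
  using assms(3,4) by (simp add: kraus_map_def congruence_index[OF assms(1,2)] del: index_mult_mat)

lemma psd_sum:
  assumes "\<And>i. i < N \<Longrightarrow> psd d (F i)"
  shows "psd d (mat d d (\<lambda>(r, c). \<Sum>i<(N::nat). F i $$ (r, c)))"
  using assms
proof (induction N)
  case 0
  have "mat d d (\<lambda>(r, c). \<Sum>i<(0::nat). F i $$ (r, c)) = 0\<^sub>m d d" by (intro eq_matI) auto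
  then show ?case by (simp only: psd_zero)
next
  case (Suc N)
  have eq: "mat d d (\<lambda>(r, c). \<Sum>i<Suc N. F i $$ (r, c)) = mat d d (\<lambda>(r, c). \<Sum>i<N. F i $$ (r, c)) + F N"
    using psd_carrier[OF Suc.prems, of N] by (intro eq_matI) auto
  show ?case unfolding eq by (intro psd_add Suc) auto
qed

lemma sum_block:
  fixes f :: "nat \<Rightarrow> complex"
  assumes "i < k"
  shows "(\<Sum>u<k * d. if i = u div d then f u else 0) = (\<Sum>s<d. f (i * d + s))"
proof -
  have "(\<Sum>u<k * d. if i = u div d then f u else 0)
      = (\<Sum>u<k * d. (\<lambda>x s. if i = x then f (x * d + s) else 0) (u div d) (u mod d))"
    by (intro sum.cong) auto
  also have "\<dots> = (\<Sum>x<k. \<Sum>s<d. if i = x then f (x * d + s) else 0)"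
    by (rule sum_div_mod)
  also have "\<dots> = (\<Sum>x<k. if i = x then \<Sum>s<d. f (x * d + s) else 0)"
    by (intro sum.cong) auto
  finally show ?thesis using assms by simp
qed

text \<open>The ampliation is again in operator-sum form: \<open>E i\<close> is the identity of size
  \<open>k\<close> tensored with \<open>K i\<close>, so the image is a sum of congruences of
  \<open>X\<close>.\<close>

lemma completely_positive_kraus_map:
  assumes K: "\<And>i. i < N \<Longrightarrow> K i \<in> carrier_mat d' d"
  shows "completely_positive d d' (kraus_map N K d')"
  unfolding completely_positive_def
proof (intro conjI allI impI)
  show "linear_op_map d d' (kraus_map N K d')"
    unfolding linear_op_map_def
  proof (intro conjI ballI allI)
    fix X Y :: "complex mat" and z :: complex
    assume X: "X \<in> carrier_mat d d"
    show "kraus_map N K d' X \<in> carrier_mat d' d'" by simp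
    show "kraus_map N K d' (z \<cdot>\<^sub>m X) = z \<cdot>\<^sub>m kraus_map N K d' X"
      using X by (intro eq_matI)
        (auto simp: kraus_map_index[OF K] carrier_matD[OF kraus_map_carrier] sum_distrib_left ac_simps)
    assume Y: "Y \<in> carrier_mat d d"
    show "kraus_map N K d' (X + Y) = kraus_map N K d' X + kraus_map N K d' Y"
      using X Y by (intro eq_matI)
        (auto simp: kraus_map_index[OF K] carrier_matD[OF kraus_map_carrier] distrib_left distrib_right sum.distrib)
  qed
next
  fix k X assume X: "psd (k * d) X"
  note Xc = psd_carrier[OF X]
  define E where "E i = mat (k * d') (k * d)
    (\<lambda>(r, c). if r div d' = c div d then K i $$ (r mod d', c mod d) else 0)" for i
  have E: "E i \<in> carrier_mat (k * d') (k * d)" for i by (simp add: E_def)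
  have "ampliation k d d' (kraus_map N K d') X
      = mat (k * d') (k * d') (\<lambda>(r, c). \<Sum>i<N. (E i * X * mat_adjoint (E i)) $$ (r, c))"
  proof (rule eq_matI)
    fix r c assume "r < dim_row (mat (k * d') (k * d') (\<lambda>(r, c). \<Sum>i<N. (E i * X * mat_adjoint (E i)) $$ (r, c)))"
      "c < dim_col (mat (k * d') (k * d') (\<lambda>(r, c). \<Sum>i<N. (E i * X * mat_adjoint (E i)) $$ (r, c)))"
    then have rc: "r < k * d'" "c < k * d'" by auto
    note dm = div_less_of_less_mult[OF rc(1)] div_less_of_less_mult[OF rc(2)]
      mod_less_of_less_mult[OF rc(1)] mod_less_of_less_mult[OF rc(2)]
    have "(E i * X * mat_adjoint (E i)) $$ (r, c) = (\<Sum>s<d. \<Sum>t<d. K i $$ (r mod d', s)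
        * X $$ ((r div d') * d + s, (c div d') * d + t) * cnj (K i $$ (c mod d', t)))" if "i < N" for i
    proof -
      have "(E i * X * mat_adjoint (E i)) $$ (r, c)
          = (\<Sum>u<k * d. \<Sum>w<k * d. E i $$ (r, u) * X $$ (u, w) * cnj (E i $$ (c, w)))"
        by (rule congruence_index[OF E Xc rc])
      also have "\<dots> = (\<Sum>u<k * d. if r div d' = u div d then
          \<Sum>w<k * d. if c div d' = w div d then
            K i $$ (r mod d', u mod d) * X $$ (u, w) * cnj (K i $$ (c mod d', w mod d)) else 0 else 0)"
        using rc by (intro sum.cong) (auto simp: E_def intro!: sum.cong)
      also have "\<dots> = (\<Sum>s<d. \<Sum>t<d. K i $$ (r mod d', s)
          * X $$ ((r div d') * d + s, (c div d') * d + t) * cnj (K i $$ (c mod d', t)))"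
        by (simp add: sum_block[OF dm(1)] sum_block[OF dm(2)])
      finally show ?thesis .
    qed
    then show "ampliation k d d' (kraus_map N K d') X $$ (r, c)
        = mat (k * d') (k * d') (\<lambda>(r, c). \<Sum>i<N. (E i * X * mat_adjoint (E i)) $$ (r, c)) $$ (r, c)"
      using rc dm by (simp add: ampliation_def kraus_map_index[OF K] del: index_mult_mat)
  qed (auto simp: ampliation_def)
  then show "psd (k * d') (ampliation k d d' (kraus_map N K d') X)"
    using psd_sum[of N, OF psd_congruence[OF X E]] by simp
qed

text \<open>The normalization (adjoints times Kraus operators sum to the identity) is phrased as
  unitality of the adjoint family. In this form the tensor rule for Kraus maps also delivers it for
  tensor powers.\<close>

lemma kraus_map_trace:
  assumes K: "\<And>i. i < N \<Longrightarrow> K i \<in> carrier_mat d' d" and X: "X \<in> carrier_mat d d"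
    and one: "kraus_map N (\<lambda>i. mat_adjoint (K i)) d (1\<^sub>m d') = 1\<^sub>m d"
  shows "mat_trace (kraus_map N K d' X) = mat_trace X"
proof -
  have K1: "mat_adjoint (K i) * 1\<^sub>m d' = mat_adjoint (K i)"
    if "i < N" for i using K[OF that] by simp
  have "mat_trace (kraus_map N K d' X) = (\<Sum>i<N. mat_trace (K i * X * mat_adjoint (K i)))"
  proof -
    have "mat_trace (kraus_map N K d' X) = (\<Sum>r<d'. \<Sum>i<N. (K i * X * mat_adjoint (K i)) $$ (r, r))"
      by (simp add: mat_trace_def kraus_map_def del: index_mult_mat)
    also have "\<dots> = (\<Sum>i<N. \<Sum>r<d'. (K i * X * mat_adjoint (K i)) $$ (r, r))" by (rule sum.swap)
    also have "\<dots> = (\<Sum>i<N. mat_trace (K i * X * mat_adjoint (K i)))"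
      unfolding mat_trace_def using K by (intro sum.cong) (auto simp del: index_mult_mat(1))
    finally show ?thesis .
  qed
  also have "\<dots> = (\<Sum>i<N. mat_trace (X * (mat_adjoint (K i) * K i)))"
  proof (rule sum.cong[OF refl])
    fix i assume "i \<in> {..<N}"
    then have Ki: "K i \<in> carrier_mat d' d" using K by simp
    note Ka = mat_adjoint_carrier[OF Ki]
    show "mat_trace (K i * X * mat_adjoint (K i)) = mat_trace (X * (mat_adjoint (K i) * K i))"
      using assoc_mult_mat[OF Ki X Ka] mat_trace_comm[OF Ki mult_carrier_mat[OF X Ka]]
        assoc_mult_mat[OF X Ka Ki] by simp
  qed
  also have "\<dots> = (\<Sum>i<N. \<Sum>s<d. \<Sum>t<d. X $$ (s, t) * (mat_adjoint (K i) * K i) $$ (t, s))"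
  proof (rule sum.cong[OF refl])
    fix i assume "i \<in> {..<N}"
    then have "K i \<in> carrier_mat d' d" using K by simp
    then show "mat_trace (X * (mat_adjoint (K i) * K i))
        = (\<Sum>s<d. \<Sum>t<d. X $$ (s, t) * (mat_adjoint (K i) * K i) $$ (t, s))"
      by (intro mat_trace_mult[OF X]) auto
  qed
  also have "\<dots> = (\<Sum>s<d. \<Sum>t<d. \<Sum>i<N. X $$ (s, t) * (mat_adjoint (K i) * K i) $$ (t, s))"
    by (subst sum.swap, rule sum.cong[OF refl], rule sum.swap)
  also have "\<dots> = (\<Sum>s<d. \<Sum>t<d. X $$ (s, t) * kraus_map N (\<lambda>i. mat_adjoint (K i)) d (1\<^sub>m d') $$ (t, s))"
    by (intro sum.cong refl) (simp add: kraus_map_def K1 sum_distrib_left del: index_mult_mat cong: sum.cong_simp)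
  also have "\<dots> = (\<Sum>s<d. \<Sum>t<d. if t = s then X $$ (s, t) else 0)"
    unfolding one by (intro sum.cong) auto
  also have "\<dots> = mat_trace X" using X by (simp add: mat_trace_def)
  finally show ?thesis .
qed

section \<open>Kraus operators under partial transposition\<close>

text \<open>If \<open>K = A \<otimes> B\<close> then \<open>K' = A \<otimes> cnj B\<close> is such a partner; the relation says that
  conjugation by \<open>K\<close>, transposed on both sides, is conjugation by \<open>K'\<close>.\<close>

definition transpose_partner ::
    "nat \<Rightarrow> nat \<Rightarrow> nat \<Rightarrow> nat \<Rightarrow> complex mat \<Rightarrow> complex mat \<Rightarrow> bool" where
  "transpose_partner a b a' b' K K' \<longleftrightarrow>
     K \<in> carrier_mat (a' * b') (a * b) \<and> K' \<in> carrier_mat (a' * b') (a * b) \<and>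
     (\<forall>r < a' * b'. \<forall>r' < a' * b'. \<forall>s < a * b. \<forall>s' < a * b.
        K $$ (cross_index b' r r', cross_index b s s') * cnj (K $$ (cross_index b' r' r, cross_index b s' s))
        = K' $$ (r, s) * cnj (K' $$ (r', s')))"

lemma sum_cross_index:
  "(\<Sum>s<a * b. \<Sum>t<a * b. f (cross_index b s t) (cross_index b t s)) = (\<Sum>s<a * b. \<Sum>t<(a * b::nat). f s t)"
proof -
  let ?D = "{..<a * b} \<times> {..<a * b}"
  have "bij_betw (\<lambda>(s, t). (cross_index b s t, cross_index b t s)) ?D ?D"
    by (rule bij_betw_byWitness[where f' = "\<lambda>(s, t). (cross_index b s t, cross_index b t s)"])
      (auto simp: cross_index_cross intro: cross_index_less)
  from sum.reindex_bij_betw[OF this, of "\<lambda>(s, t). f s t"] show ?thesis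
    by (simp add: sum.cartesian_product split_def)
qed

lemma partial_transpose_kraus_map:
  assumes K: "\<And>i. i < N \<Longrightarrow> transpose_partner a b a' b' (K i) (K' i)" and X: "X \<in> carrier_mat (a * b) (a * b)"
  shows "partial_transpose a' b' (kraus_map N K (a' * b') (partial_transpose a b X)) = kraus_map N K' (a' * b') X"
proof (rule eq_matI)
  have Kc: "K i \<in> carrier_mat (a' * b') (a * b)" "K' i \<in> carrier_mat (a' * b') (a * b)" if "i < N" for i
    using K[OF that] by (auto simp: transpose_partner_def)
  fix r r' assume "r < dim_row (kraus_map N K' (a' * b') X)" "r' < dim_col (kraus_map N K' (a' * b') X)"
  then have rr: "r < a' * b'" "r' < a' * b'" by (auto simp: kraus_map_def)
  let ?x = "cross_index b' r r'" and ?y = "cross_index b' r' r"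
  have "partial_transpose a' b' (kraus_map N K (a' * b') (partial_transpose a b X)) $$ (r, r')
      = kraus_map N K (a' * b') (partial_transpose a b X) $$ (?x, ?y)"
    by (rule partial_transpose_index[OF rr])
  also have "\<dots> = (\<Sum>i<N. \<Sum>s<a * b. \<Sum>t<a * b. K i $$ (?x, s)
      * X $$ (cross_index b s t, cross_index b t s) * cnj (K i $$ (?y, t)))"
    using rr by (simp add: kraus_map_index[OF Kc(1)] cross_index_less partial_transpose_index)
  \<comment> \<open>Summing over crossed index pairs moves the transposition from \<open>X\<close>
    onto the Kraus operators.\<close>
  also have "\<dots> = (\<Sum>i<N. \<Sum>s<a * b. \<Sum>t<a * b. (\<lambda>s t. K i $$ (?x, cross_index b s t)
      * X $$ (s, t) * cnj (K i $$ (?y, cross_index b t s))) (cross_index b s t) (cross_index b t s))"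
    by (intro sum.cong refl) (auto simp: cross_index_cross)
  also have "\<dots> = (\<Sum>i<N. \<Sum>s<a * b. \<Sum>t<a * b. K i $$ (?x, cross_index b s t)
      * X $$ (s, t) * cnj (K i $$ (?y, cross_index b t s)))"
    by (rule sum.cong[OF refl]) (rule sum_cross_index)
  also have "\<dots> = (\<Sum>i<N. \<Sum>s<a * b. \<Sum>t<a * b. K' i $$ (r, s) * X $$ (s, t) * cnj (K' i $$ (r', t)))"
  proof (intro sum.cong refl)
    fix i s t assume "i \<in> {..<N}" "s \<in> {..<a * b}" "t \<in> {..<a * b}"
    then have "K i $$ (?x, cross_index b s t) * cnj (K i $$ (?y, cross_index b t s))
        = K' i $$ (r, s) * cnj (K' i $$ (r', t))"
      using K[of i] rr by (auto simp: transpose_partner_def)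
    then show "K i $$ (?x, cross_index b s t) * X $$ (s, t) * cnj (K i $$ (?y, cross_index b t s))
        = K' i $$ (r, s) * X $$ (s, t) * cnj (K' i $$ (r', t))"
      by (metis mult.assoc mult.commute)
  qed
  also have "\<dots> = kraus_map N K' (a' * b') X $$ (r, r')"
    by (rule kraus_map_index[OF Kc(2) X rr, symmetric])
  finally show "partial_transpose a' b' (kraus_map N K (a' * b') (partial_transpose a b X)) $$ (r, r')
      = kraus_map N K' (a' * b') X $$ (r, r')" .
qed (auto simp: kraus_map_def partial_transpose_def)

lemma completely_positive_cong:
  assumes "completely_positive d d' L" "\<And>X. X \<in> carrier_mat d d \<Longrightarrow> L' X = L X"
  shows "completely_positive d d' L'"
proof -
  have "linear_op_map d d' L'"
    using assms by (auto simp: completely_positive_def linear_op_map_def)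
  moreover have "ampliation k d d' L' X = ampliation k d d' L X" for k X
    unfolding ampliation_def by (simp add: assms(2))
  ultimately show ?thesis using assms(1) by (simp add: completely_positive_def)
qed

text \<open>The family \<open>K\<close> witnesses complete positivity of the map, the family
  \<open>K'\<close> that of its conjugation by the partial transposition.\<close>

lemma ppt_operation_kraus_map:
  assumes K: "\<And>i. i < N \<Longrightarrow> transpose_partner a b a' b' (K i) (K' i)"
    and one: "kraus_map N (\<lambda>i. mat_adjoint (K i)) (a * b) (1\<^sub>m (a' * b')) = 1\<^sub>m (a * b)"
  shows "ppt_operation a b a' b' (kraus_map N K (a' * b'))"
proof -
  have Kc: "K i \<in> carrier_mat (a' * b') (a * b)" "K' i \<in> carrier_mat (a' * b') (a * b)" if "i < N" for i
    using K[OF that] by (auto simp: transpose_partner_def)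
  have "cptp (a * b) (a' * b') (kraus_map N K (a' * b'))"
    unfolding cptp_def
    by (intro conjI ballI completely_positive_kraus_map kraus_map_trace[OF _ _ one] Kc)
  moreover have "completely_positive (a * b) (a' * b')
      (partial_transpose a' b' \<circ> kraus_map N K (a' * b') \<circ> partial_transpose a b)"
    by (rule completely_positive_cong[OF completely_positive_kraus_map[OF Kc(2)]])
      (simp_all add: partial_transpose_kraus_map[OF K])
  ultimately show ?thesis by (simp add: ppt_operation_def)
qed

text \<open>A real infimum over an empty set carries no information, so the rate bounds need some
  PPT operation. This one discards the input and prepares |00>: \<open>K j\<close> is |00><j|, a
  product operator with real entries, hence its own partner.\<close>

lemma ppt_operation_exists:
  assumes "0 < a' * b'"
  shows "\<exists>L. ppt_operation a b a' b' L"
proof -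
  define K :: "nat \<Rightarrow> complex mat" where
    "K j = mat (a' * b') (a * b) (\<lambda>(r, s). if r = 0 \<and> s = j then 1 else 0)" for j
  have K: "K j \<in> carrier_mat (a' * b') (a * b)" for j by (simp add: K_def)
  have c0: "cross_index x 0 0 = 0" "cross_index x j j = j" for x j
    by (simp_all add: cross_index_def)
  have K_prod: "K j $$ (r, s) * cnj (K j $$ (r', s')) = (if r = 0 \<and> r' = 0 \<and> s = j \<and> s' = j then 1 else 0)"
    if "r < a' * b'" "r' < a' * b'" "s < a * b" "s' < a * b" for j r r' s s'
    using that by (simp add: K_def)
  have "transpose_partner a b a' b' (K j) (K j)" if "j < a * b" for j
    unfolding transpose_partner_def
  proof (intro conjI K allI impI)
    fix r r' s s' assume rs: "r < a' * b'" "r' < a' * b'" "s < a * b" "s' < a * b"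
    have 1: "cross_index b' r r' = 0 \<and> cross_index b' r' r = 0 \<longleftrightarrow> r = 0 \<and> r' = 0"
      using cross_index_cross[OF rs(1,2)] cross_index_cross[OF rs(2,1)] c0 by metis
    have 2: "cross_index b s s' = j \<and> cross_index b s' s = j \<longleftrightarrow> s = j \<and> s' = j"
      using cross_index_cross[OF rs(3,4)] cross_index_cross[OF rs(4,3)] c0 by metis
    have iff: "cross_index b' r r' = 0 \<and> cross_index b' r' r = 0 \<and> cross_index b s s' = j \<and> cross_index b s' s = j
        \<longleftrightarrow> r = 0 \<and> r' = 0 \<and> s = j \<and> s' = j"
      using 1 2 by metis
    show "K j $$ (cross_index b' r r', cross_index b s s') * cnj (K j $$ (cross_index b' r' r, cross_index b s' s))
        = K j $$ (r, s) * cnj (K j $$ (r', s'))"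
      unfolding K_prod[OF cross_index_less[OF rs(1,2)] cross_index_less[OF rs(2,1)]
          cross_index_less[OF rs(3,4)] cross_index_less[OF rs(4,3)]] K_prod[OF rs] iff ..
  qed
  moreover have "kraus_map (a * b) (\<lambda>i. mat_adjoint (K i)) (a * b) (1\<^sub>m (a' * b')) = 1\<^sub>m (a * b)"
  proof (rule eq_matI)
    fix s t assume "s < dim_row (1\<^sub>m (a * b))" "t < dim_col (1\<^sub>m (a * b))"
    then have st: "s < a * b" "t < a * b" by auto
    have "kraus_map (a * b) (\<lambda>i. mat_adjoint (K i)) (a * b) (1\<^sub>m (a' * b')) $$ (s, t)
        = (\<Sum>i<a * b. \<Sum>r<a' * b'. \<Sum>q<a' * b'.
            mat_adjoint (K i) $$ (s, r) * 1\<^sub>m (a' * b') $$ (r, q) * cnj (mat_adjoint (K i) $$ (t, q)))"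
      using st by (intro kraus_map_index) (simp_all add: K)
    also have "\<dots> = (\<Sum>i<a * b. \<Sum>r<a' * b'. \<Sum>q<a' * b'.
            if q = 0 then (if r = 0 then (if i = s then (if s = t then 1 else 0) else 0) else 0) else 0)"
      using st by (intro sum.cong refl) (auto simp: K_def)
    finally show "kraus_map (a * b) (\<lambda>i. mat_adjoint (K i)) (a * b) (1\<^sub>m (a' * b')) $$ (s, t) = 1\<^sub>m (a * b) $$ (s, t)"
      using st assms by simp
  qed (auto simp: kraus_map_def)
  ultimately show ?thesis using ppt_operation_kraus_map by blast
qed

section \<open>Tensor powers of Kraus maps\<close>

lemma transpose_partner_tensor:
  assumes "transpose_partner c1 d1 a1 b1 K K'" and "transpose_partner c2 d2 a2 b2 L L'"
  shows "transpose_partner (c1 * c2) (d1 * d2) (a1 * a2) (b1 * b2)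
    (rect_tensor a1 b1 a2 b2 c1 d1 c2 d2 K L) (rect_tensor a1 b1 a2 b2 c1 d1 c2 d2 K' L')"
  unfolding transpose_partner_def
proof (intro conjI rect_tensor_carrier allI impI)
  fix r r' s s'
  assume r: "r < (a1 * a2) * (b1 * b2)" and r': "r' < (a1 * a2) * (b1 * b2)"
    and s: "s < (c1 * c2) * (d1 * d2)" and s': "s' < (c1 * c2) * (d1 * d2)"
  let ?l = "left_index b1 a2 b2" and ?m = "right_index b1 a2 b2"
  let ?l' = "left_index d1 c2 d2" and ?m' = "right_index d1 c2 d2"
  have 1: "K $$ (cross_index b1 (?l r) (?l r'), cross_index d1 (?l' s) (?l' s'))
      * cnj (K $$ (cross_index b1 (?l r') (?l r), cross_index d1 (?l' s') (?l' s)))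
      = K' $$ (?l r, ?l' s) * cnj (K' $$ (?l r', ?l' s'))"
    using assms(1) left_index_less[OF r] left_index_less[OF r'] left_index_less[OF s] left_index_less[OF s']
    by (simp add: transpose_partner_def)
  have 2: "L $$ (cross_index b2 (?m r) (?m r'), cross_index d2 (?m' s) (?m' s'))
      * cnj (L $$ (cross_index b2 (?m r') (?m r), cross_index d2 (?m' s') (?m' s)))
      = L' $$ (?m r, ?m' s) * cnj (L' $$ (?m r', ?m' s'))"
    using assms(2) right_index_less[OF r] right_index_less[OF r'] right_index_less[OF s] right_index_less[OF s']
    by (simp add: transpose_partner_def)
  have "(x * y) * cnj (z * w) = (x * cnj z) * (y * cnj w)" for x y z w :: complex by simp
  then show "rect_tensor a1 b1 a2 b2 c1 d1 c2 d2 K L $$ (cross_index (b1 * b2) r r', cross_index (d1 * d2) s s')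
      * cnj (rect_tensor a1 b1 a2 b2 c1 d1 c2 d2 K L $$ (cross_index (b1 * b2) r' r, cross_index (d1 * d2) s' s))
      = rect_tensor a1 b1 a2 b2 c1 d1 c2 d2 K' L' $$ (r, s)
      * cnj (rect_tensor a1 b1 a2 b2 c1 d1 c2 d2 K' L' $$ (r', s'))"
    by (simp only: rect_tensor_index[OF cross_index_less[OF r r'] cross_index_less[OF s s']]
        rect_tensor_index[OF cross_index_less[OF r' r] cross_index_less[OF s' s]]
        rect_tensor_index[OF r s] rect_tensor_index[OF r' s']
        cross_index_left_right[OF r r'] cross_index_left_right[OF r' r]
        cross_index_left_right[OF s s'] cross_index_left_right[OF s' s] 1 2)
qed

text \<open>A single index below \<open>M * N\<close> codes the pair of Kraus indices by its
  remainder and quotient modulo \<open>N\<close>, so the double sum factors.\<close>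

lemma kraus_map_bipartite_tensor:
  assumes K: "\<And>i. i < N \<Longrightarrow> K i \<in> carrier_mat (a1 * b1) (c1 * d1)"
    and L: "\<And>i. i < M \<Longrightarrow> L i \<in> carrier_mat (a2 * b2) (c2 * d2)"
    and X: "X \<in> carrier_mat (c1 * d1) (c1 * d1)" and Y: "Y \<in> carrier_mat (c2 * d2) (c2 * d2)"
  shows "kraus_map (M * N) (\<lambda>i. rect_tensor a1 b1 a2 b2 c1 d1 c2 d2 (K (i mod N)) (L (i div N)))
      ((a1 * a2) * (b1 * b2)) (bipartite_tensor c1 d1 c2 d2 X Y)
    = bipartite_tensor a1 b1 a2 b2 (kraus_map N K (a1 * b1) X) (kraus_map M L (a2 * b2) Y)" (is "?L = ?R")
proof (rule eq_matI)
  fix r c assume "r < dim_row ?R" "c < dim_col ?R"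
  then have rc: "r < (a1 * a2) * (b1 * b2)" "c < (a1 * a2) * (b1 * b2)"
    by (auto simp: bipartite_tensor_def)
  let ?T = "\<lambda>i j. rect_tensor a1 b1 a2 b2 c1 d1 c2 d2 (K i) (L j)"
  let ?l = "left_index b1 a2 b2" and ?m = "right_index b1 a2 b2"
  let ?f = "\<lambda>i. (K i * X * mat_adjoint (K i)) $$ (?l r, ?l c)"
  let ?g = "\<lambda>j. (L j * Y * mat_adjoint (L j)) $$ (?m r, ?m c)"
  have TT: "?T i j * bipartite_tensor c1 d1 c2 d2 X Y * mat_adjoint (?T i j)
      = bipartite_tensor a1 b1 a2 b2 (K i * X * mat_adjoint (K i)) (L j * Y * mat_adjoint (L j))"
    if "i < N" "j < M" for i j
    unfolding bipartite_tensor_rect rect_tensor_adjoint[OF K[OF that(1)] L[OF that(2)]]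
      rect_tensor_mult[OF K[OF that(1)] L[OF that(2)] X Y]
    by (rule rect_tensor_mult) (use K[OF that(1)] L[OF that(2)] X Y in auto)
  have "?L $$ (r, c) = (\<Sum>i<M * N. (?T (i mod N) (i div N) * bipartite_tensor c1 d1 c2 d2 X Y
      * mat_adjoint (?T (i mod N) (i div N))) $$ (r, c))"
    using rc by (simp add: kraus_map_def del: index_mult_mat)
  also have "\<dots> = (\<Sum>i<M * N. ?f (i mod N) * ?g (i div N))"
  proof (rule sum.cong[OF refl])
    fix i assume "i \<in> {..<M * N}"
    then have "i mod N < N" "i div N < M" by (auto intro: div_less_of_less_mult mod_less_of_less_mult)
    from TT[OF this] show "(?T (i mod N) (i div N) * bipartite_tensor c1 d1 c2 d2 X Y
      * mat_adjoint (?T (i mod N) (i div N))) $$ (r, c) = ?f (i mod N) * ?g (i div N)"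
      using bipartite_tensor_index[OF rc] by simp
  qed
  also have "\<dots> = (\<Sum>j<M. \<Sum>i<N. ?f i * ?g j)"
    by (rule sum_div_mod[where f = "\<lambda>j i. ?f i * ?g j"])
  also have "\<dots> = (\<Sum>i<N. ?f i) * (\<Sum>j<M. ?g j)"
    by (subst sum.swap) (rule sum_product[symmetric])
  also have "\<dots> = ?R $$ (r, c)"
    using bipartite_tensor_index[OF rc] left_index_less[OF rc(1)] left_index_less[OF rc(2)]
      right_index_less[OF rc(1)] right_index_less[OF rc(2)]
    by (simp add: kraus_map_def del: index_mult_mat)
  finally show "?L $$ (r, c) = ?R $$ (r, c)" .
qed (auto simp: kraus_map_def bipartite_tensor_def)

text \<open>The Kraus operators of the \<open>n\<close>-fold tensor power; the index is read as \<open>n\<close> digits in base \<open>N\<close>.\<close>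

fun kraus_power ::
    "nat \<Rightarrow> nat \<Rightarrow> nat \<Rightarrow> nat \<Rightarrow> nat \<Rightarrow> (nat \<Rightarrow> complex mat) \<Rightarrow> nat \<Rightarrow> nat \<Rightarrow> complex mat" where
  "kraus_power a b a' b' N K 0 i = 1\<^sub>m 1"
| "kraus_power a b a' b' N K (Suc n) i =
     rect_tensor a' b' (a' ^ n) (b' ^ n) a b (a ^ n) (b ^ n) (K (i mod N)) (kraus_power a b a' b' N K n (i div N))"

text \<open>Parallel use of one single-copy operation; both the partner relation and the
  normalization pass through the recursion of \<open>kraus_power\<close>.\<close>

lemma ppt_operation_kraus_power:
  assumes K: "\<And>i. i < N \<Longrightarrow> transpose_partner a b a' b' (K i) (K' i)"
    and one: "kraus_map N (\<lambda>i. mat_adjoint (K i)) (a * b) (1\<^sub>m (a' * b')) = 1\<^sub>m (a * b)"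
  shows "\<exists>L. ppt_operation (a ^ n) (b ^ n) (a' ^ n) (b' ^ n) L \<and>
           (\<forall>X \<in> carrier_mat (a * b) (a * b).
              L (tensor_power a b X n) = tensor_power a' b' (kraus_map N K (a' * b') X) n)"
proof -
  let ?P = "kraus_power a b a' b' N K" and ?P' = "kraus_power a b a' b' N K'"
  have Kc: "K i \<in> carrier_mat (a' * b') (a * b)" if "i < N" for i
    using K[OF that] by (auto simp: transpose_partner_def)
  have partner: "transpose_partner (a ^ n) (b ^ n) (a' ^ n) (b' ^ n) (?P n i) (?P' n i)" if "i < N ^ n" for n i
    using that
  proof (induction n arbitrary: i)
    case 0
    then show ?case by (simp add: transpose_partner_def cross_index_def)
  next
    case (Suc n)
    then have "i mod N < N" "i div N < N ^ n"
      by (auto intro!: div_less_of_less_mult mod_less_of_less_mult[of i "N ^ n"] simp: mult.commute)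
    then show ?case using transpose_partner_tensor[OF K Suc.IH] by simp
  qed
  have Pc: "?P n i \<in> carrier_mat (a' ^ n * b' ^ n) (a ^ n * b ^ n)" if "i < N ^ n" for n i
    using partner[OF that] by (auto simp: transpose_partner_def)
  have one_n: "kraus_map (N ^ n) (\<lambda>i. mat_adjoint (?P n i)) (a ^ n * b ^ n) (1\<^sub>m (a' ^ n * b' ^ n)) = 1\<^sub>m (a ^ n * b ^ n)" for n
  proof (induction n)
    case 0
    show ?case by (intro eq_matI) (auto simp: kraus_map_def)
  next
    case (Suc n)
    have "mat_adjoint (?P (Suc n) i) = rect_tensor a b (a ^ n) (b ^ n) a' b' (a' ^ n) (b' ^ n)
        (mat_adjoint (K (i mod N))) (mat_adjoint (?P n (i div N)))" if "i < N ^ n * N" for i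
      using rect_tensor_adjoint[OF Kc Pc] mod_less_of_less_mult[OF that] div_less_of_less_mult[OF that] by simp
    then have "kraus_map (N ^ Suc n) (\<lambda>i. mat_adjoint (?P (Suc n) i)) (a ^ Suc n * b ^ Suc n) (1\<^sub>m (a' ^ Suc n * b' ^ Suc n))
      = kraus_map (N ^ n * N) (\<lambda>i. rect_tensor a b (a ^ n) (b ^ n) a' b' (a' ^ n) (b' ^ n)
            (mat_adjoint (K (i mod N))) (mat_adjoint (?P n (i div N)))) ((a * a ^ n) * (b * b ^ n))
            (bipartite_tensor a' b' (a' ^ n) (b' ^ n) (1\<^sub>m (a' * b')) (1\<^sub>m (a' ^ n * b' ^ n)))"
      unfolding power_Suc bipartite_tensor_one mult.commute[of N] by (rule kraus_map_cong)
    also have "\<dots> = bipartite_tensor a b (a ^ n) (b ^ n) (kraus_map N (\<lambda>i. mat_adjoint (K i)) (a * b) (1\<^sub>m (a' * b')))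
        (kraus_map (N ^ n) (\<lambda>i. mat_adjoint (?P n i)) (a ^ n * b ^ n) (1\<^sub>m (a' ^ n * b' ^ n)))"
      by (rule kraus_map_bipartite_tensor) (simp_all add: Kc Pc)
    finally show ?case unfolding one Suc.IH bipartite_tensor_one by simp
  qed
  have "kraus_map (N ^ n) (?P n) (a' ^ n * b' ^ n) (tensor_power a b X n) = tensor_power a' b' (kraus_map N K (a' * b') X) n"
    if X: "X \<in> carrier_mat (a * b) (a * b)" for X n
  proof (induction n)
    case 0
    show ?case by (intro eq_matI) (auto simp: kraus_map_def)
  next
    case (Suc n)
    have "kraus_map (N ^ Suc n) (?P (Suc n)) (a' ^ Suc n * b' ^ Suc n) (tensor_power a b X (Suc n))
      = kraus_map (N ^ n * N) (\<lambda>i. rect_tensor a' b' (a' ^ n) (b' ^ n) a b (a ^ n) (b ^ n)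
            (K (i mod N)) (?P n (i div N))) ((a' * a' ^ n) * (b' * b' ^ n))
            (bipartite_tensor a b (a ^ n) (b ^ n) X (tensor_power a b X n))"
      unfolding power_Suc tensor_power.simps mult.commute[of N] by (rule kraus_map_cong) simp
    also have "\<dots> = bipartite_tensor a' b' (a' ^ n) (b' ^ n) (kraus_map N K (a' * b') X)
        (kraus_map (N ^ n) (?P n) (a' ^ n * b' ^ n) (tensor_power a b X n))"
      by (rule kraus_map_bipartite_tensor[OF Kc Pc X tensor_power_carrier])
    finally show ?case by (simp only: Suc.IH tensor_power.simps)
  qed
  then show ?thesis using ppt_operation_kraus_map[OF partner one_n] by blast
qed


section \<open>Fidelity bounds for PPT operations\<close>

lemma psd_ketbra:
  assumes "v \<in> carrier_vec d"
  shows "psd d (ketbra v)"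
proof -
  have "ketbra v = mat d 1 (\<lambda>(i, _). v $ i) * mat_adjoint (mat d 1 (\<lambda>(i, _). v $ i))"
    using assms by (intro eq_matI) (auto simp: ketbra_def scalar_prod_def)
  then show ?thesis using psd_gram[of "mat d 1 (\<lambda>(i, _). v $ i)" d 1] by simp
qed

lemma ketbra_carrier: "v \<in> carrier_vec d \<Longrightarrow> ketbra v \<in> carrier_mat d d"
  by (simp add: ketbra_def)

lemma less_four: "i < 4 \<longleftrightarrow> i \<in> {0, 1, 2, 3 :: nat}"
  by auto

lemma eq_mat_four:
  assumes "A \<in> carrier_mat 4 4" "B \<in> carrier_mat 4 4"
    and "\<And>i j. i \<in> {0, 1, 2, 3} \<Longrightarrow> j \<in> {0, 1, 2, 3} \<Longrightarrow> A $$ (i, j) = B $$ (i, j)"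
  shows "A = B"
  using assms by (intro eq_matI) (auto simp only: less_four carrier_matD)

lemma tensor_power_one: "tensor_power a b (1\<^sub>m (a * b)) n = 1\<^sub>m (a ^ n * b ^ n)"
proof -
  have "1 \<cdot>\<^sub>m 1\<^sub>m k = (1\<^sub>m k :: complex mat)" for k by (intro eq_matI) auto
  then show ?thesis using tensor_power_scaled_one[of a b 1 n] by simp
qed

lemma sqrt_two_square: "complex_of_real (1 / sqrt 2) * complex_of_real (1 / sqrt 2) = 1 / 2"
  unfolding of_real_mult[symmetric] by simp

lemma phi_plus_eq: "phi_plus = vec 4 (\<lambda>r. if r = 0 \<or> r = 3 then complex_of_real (1 / sqrt 2) else 0)"
proof (rule eq_vecI)
  fix i assume "i < dim_vec (vec 4 (\<lambda>r. if r = 0 \<or> r = 3 then complex_of_real (1 / sqrt 2) else 0))"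
  then have "i \<in> {0, 1, 2, 3}" by (simp add: less_four)
  then show "phi_plus $ i = vec 4 (\<lambda>r. if r = 0 \<or> r = 3 then complex_of_real (1 / sqrt 2) else 0) $ i"
    by (auto simp: phi_plus_def tensor_vec_def)
qed (simp add: phi_plus_def tensor_vec_def)

lemma Phi_eq: "Phi = mat 4 4 (\<lambda>(r, c). if (r = 0 \<or> r = 3) \<and> (c = 0 \<or> c = 3) then 1 / 2 else 0)"
  unfolding Phi_def ketbra_def phi_plus_eq using sqrt_two_square
  by (intro eq_matI) auto

lemma Phi_carrier: "Phi \<in> carrier_mat (2 * 2) (2 * 2)"
  by (simp add: Phi_eq)

lemma psd_Phi: "psd (2 * 2) Phi"
  unfolding Phi_def by (rule psd_ketbra) (simp add: phi_plus_eq)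

lemma sum_lessThan_4: "(\<Sum>i<(4::nat). f i) = f 0 + f 1 + f 2 + f 3"
  by (simp add: numeral_eq_Suc)

lemma trace_Phi_Phi: "mat_trace (Phi * Phi) = 1"
  using Phi_carrier by (simp add: mat_trace_mult[of _ 4 4]) (simp add: Phi_eq sum_lessThan_4)

definition diag_state :: "complex mat" where
  "diag_state = mat 4 4 (\<lambda>(r, c). if r = c \<and> (r = 0 \<or> r = 3) then 1 else 0)"

lemma diag_state_carrier: "diag_state \<in> carrier_mat (2 * 2) (2 * 2)"
  by (simp add: diag_state_def)

lemma trace_diag_state: "mat_trace diag_state = 2"
  by (simp add: mat_trace_def diag_state_def sum_lessThan_4)

lemma psd_diag_state: "psd (2 * 2) diag_state"
proof -
  have "diag_state = real_diag 4 (\<lambda>i. if i = 0 \<or> i = 3 then 1 else 0)"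
    by (intro eq_matI) (auto simp: diag_state_def real_diag_def)
  then show ?thesis using psd_real_diag[of 4 "\<lambda>i. if i = 0 \<or> i = 3 then 1 else 0"] by simp
qed

lemma partial_transpose_diag_state: "partial_transpose 2 2 diag_state = diag_state"
  by (rule eq_mat_four) (auto simp: diag_state_def partial_transpose_def)

lemma dominated_Phi_diag_state: "dominated (2 * 2) Phi diag_state"
proof -
  \<comment> \<open>The other Bell vector in the span of |00> and |11>.\<close>
  let ?v = "vec 4 (\<lambda>r. if r = 0 then complex_of_real (1 / sqrt 2) else if r = 3 then - complex_of_real (1 / sqrt 2) else 0)"
  have "diag_state - Phi = ketbra ?v"
    using sqrt_two_square by (intro eq_matI) (auto simp: diag_state_def Phi_eq ketbra_def)
  then have "psd (2 * 2) (diag_state - Phi)" using psd_ketbra[of ?v 4] by simp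
  then show ?thesis
    unfolding dominated_def using Phi_carrier diag_state_carrier psd_add[OF psd_diag_state psd_Phi] by blast
qed

lemma dominated_trans_psd:
  assumes "dominated d A B" "psd d (C - B)" "C \<in> carrier_mat d d"
  shows "dominated d A C"
proof -
  note A = dominatedD[OF assms(1)]
  have "C - A = (C - B) + (B - A)" "C + A = (C - B) + (B + A)"
    using A(1,2) assms(3) by (auto intro!: eq_matI)
  then show ?thesis
    unfolding dominated_def using A assms psd_add by metis
qed

lemma dominated_Phi_one: "dominated (2 * 2) Phi (1\<^sub>m (2 * 2))"
proof (rule dominated_trans_psd[OF dominated_Phi_diag_state])
  have "1\<^sub>m (2 * 2) - diag_state = real_diag 4 (\<lambda>i. if i = 0 \<or> i = 3 then 0 else 1)"
    by (intro eq_matI) (auto simp: diag_state_def real_diag_def)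
  then show "psd (2 * 2) (1\<^sub>m (2 * 2) - diag_state)"
    using psd_real_diag[of 4 "\<lambda>i. if i = 0 \<or> i = 3 then 0 else 1"] by simp
qed simp

text \<open>The partial transpose of \<Phi> is half the flip of two qubits. The lower and upper gaps
  are therefore the projections onto the symmetric space, spanned by \<open>?w\<close>, |00>, |11>,
  and onto the singlet \<open>?v\<close>.\<close>

lemma dominated_partial_transpose_Phi:
  "dominated (2 * 2) (partial_transpose 2 2 Phi) ((1 / 2) \<cdot>\<^sub>m 1\<^sub>m (2 * 2))"
proof -
  let ?h = "complex_of_real (1 / sqrt 2)"
  let ?v = "vec 4 (\<lambda>r. if r = 1 then ?h else if r = 2 then - ?h else 0)"
  let ?w = "vec 4 (\<lambda>r. if r = 1 then ?h else if r = 2 then ?h else 0)"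
  have pt: "partial_transpose 2 2 Phi = mat 4 4 (\<lambda>(r, c). if r = c \<and> (r = 0 \<or> r = 3) \<or> r = 1 \<and> c = 2 \<or> r = 2 \<and> c = 1 then 1 / 2 else 0)"
    by (rule eq_mat_four) (auto simp: Phi_eq partial_transpose_def)
  have 1: "(1 / 2) \<cdot>\<^sub>m 1\<^sub>m (2 * 2) - partial_transpose 2 2 Phi = ketbra ?v"
    unfolding pt using sqrt_two_square by (intro eq_mat_four) (auto simp: ketbra_def)
  have 2: "(1 / 2) \<cdot>\<^sub>m 1\<^sub>m (2 * 2) + partial_transpose 2 2 Phi = ketbra ?w + diag_state"
    unfolding pt using sqrt_two_square by (intro eq_mat_four) (auto simp: ketbra_def diag_state_def)
  show ?thesis
    unfolding dominated_def 1 2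
    using psd_ketbra[of ?v 4] psd_add[OF psd_ketbra[of ?w 4] psd_diag_state[simplified]]
      partial_transpose_carrier[of 2 2 Phi] by simp
qed

section \<open>Completely positive maps and operator inequalities\<close>

lemma completely_positive_carrier:
  "completely_positive d d' L \<Longrightarrow> X \<in> carrier_mat d d \<Longrightarrow> L X \<in> carrier_mat d' d'"
  by (auto simp: completely_positive_def linear_op_map_def)

text \<open>Positivity is the case \<open>k = 1\<close> of the ampliation.\<close>

lemma completely_positive_psd:
  assumes L: "completely_positive d d' L" and X: "psd d X"
  shows "psd d' (L X)"
proof -
  note Xc = psd_carrier[OF X]
  have "psd (1 * d') (ampliation 1 d d' L X)"
    using L X unfolding completely_positive_def by (metis mult_1)
  moreover have "ampliation 1 d d' L X = L X"
  proof -
    have "mat d d (\<lambda>(s, t). X $$ (s, t)) = X" using Xc by (intro eq_matI) auto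
    then show ?thesis
      using completely_positive_carrier[OF L Xc] by (intro eq_matI) (auto simp: ampliation_def)
  qed
  ultimately show ?thesis by simp
qed

lemma completely_positive_minus:
  assumes L: "completely_positive d d' L" and X: "X \<in> carrier_mat d d" and Y: "Y \<in> carrier_mat d d"
  shows "L (X - Y) = L X - L Y"
proof -
  have "X - Y = X + (- 1) \<cdot>\<^sub>m Y" using X Y by (intro eq_matI) auto
  also have "L \<dots> = L X + (- 1) \<cdot>\<^sub>m L Y"
    using L X Y by (simp add: completely_positive_def linear_op_map_def)
  also have "\<dots> = L X - L Y"
    using completely_positive_carrier[OF L X] completely_positive_carrier[OF L Y] by (intro eq_matI) auto
  finally show ?thesis .
qed

lemma completely_positive_dominated:
  assumes L: "completely_positive d d' L" and XY: "dominated d X Y"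
  shows "dominated d' (L X) (L Y)"
proof -
  note X = dominatedD[OF XY]
  have "L (Y + X) = L Y + L X"
    using L X by (simp add: completely_positive_def linear_op_map_def)
  then show ?thesis
    unfolding dominated_def
    using completely_positive_carrier[OF L] completely_positive_minus[OF L X(2,1)]
      completely_positive_psd[OF L X(3)] completely_positive_psd[OF L X(4)] X(1,2) by simp
qed

lemma dominated_uminus:
  assumes "dominated d A B"
  shows "dominated d (- A) B"
proof -
  note A = dominatedD[OF assms]
  have "B - (- A) = B + A" "B + (- A) = B - A"
    using A(1,2) by (auto intro!: eq_matI)
  then show ?thesis unfolding dominated_def using A by simp
qed

lemma abs_trace_mult_le_trace_norm:
  assumes W: "dominated n W (1\<^sub>m n)" and X: "X \<in> carrier_mat n n" "mat_adjoint X = X"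
  shows "\<bar>Re (mat_trace (W * X))\<bar> \<le> trace_norm X"
proof -
  have "mat_trace (- W * X) = - mat_trace (W * X)"
    using dominatedD(1)[OF W] X uminus_mult_left_mat[of W X]
    by (simp add: mat_trace_def sum_negf)
  then show ?thesis using trace_norm_ge[OF W X] trace_norm_ge[OF dominated_uminus[OF W] X] by simp
qed

lemma ppt_operationD:
  assumes "ppt_operation a b a' b' L"
  shows "completely_positive (a * b) (a' * b') L"
    and "\<And>X. X \<in> carrier_mat (a * b) (a * b) \<Longrightarrow> mat_trace (L X) = mat_trace X"
    and "completely_positive (a * b) (a' * b') (partial_transpose a' b' \<circ> L \<circ> partial_transpose a b)"
  using assms by (auto simp: ppt_operation_def cptp_def)

section \<open>Overlap bounds for n copies\<close>

lemma distillation_fidelity_bound: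
  assumes L: "ppt_operation (a ^ n) (b ^ n) (2 ^ m) (2 ^ m) L"
    and \<rho>: "psd (a * b) \<rho>"
    and Y: "dominated (a * b) (partial_transpose a b \<rho>) Y" "mat_trace Y = complex_of_real N"
  shows "1 - trace_norm (L (tensor_power a b \<rho> n) - tensor_power 2 2 Phi m) \<le> N ^ n / 2 ^ m"
proof -
  let ?d = "a ^ n * b ^ n" and ?e = "2 ^ m * 2 ^ m :: nat"
  define R where "R = tensor_power a b \<rho> n"
  define F where "F = tensor_power 2 2 Phi m"
  define LG where "LG = partial_transpose (2 ^ m) (2 ^ m) \<circ> L \<circ> partial_transpose (a ^ n) (b ^ n)"
  note L1 = ppt_operationD(1)[OF L] and L2 = ppt_operationD(2)[OF L]
  have LG: "completely_positive ?d ?e LG" using ppt_operationD(3)[OF L] unfolding LG_def .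
  have R: "psd ?d R" unfolding R_def by (rule tensor_power_psd[OF \<rho>])
  have F: "psd ?e F" unfolding F_def by (rule tensor_power_psd[OF psd_Phi])
  note Rc = psd_carrier[OF R] and Fc = psd_carrier[OF F]
  have S: "psd ?e (L R)" by (rule completely_positive_psd[OF L1 R])
  note Sc = psd_carrier[OF S]
  have "dominated ?d (partial_transpose (a ^ n) (b ^ n) R) (tensor_power a b Y n)"
    unfolding R_def partial_transpose_tensor_power[OF psd_carrier[OF \<rho>]]
    by (rule tensor_power_dominated[OF Y(1)])
  \<comment> \<open>Because transposition is an involution, \<open>LG\<close> maps the transpose of
    \<open>R\<close> to the transpose of \<open>L R\<close>, and it carries the domination
    along.\<close>
  from completely_positive_dominated[OF LG this]
  have 1: "dominated ?e (partial_transpose (2 ^ m) (2 ^ m) (L R)) (LG (tensor_power a b Y n))"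
    by (simp add: LG_def partial_transpose_involution[OF Rc])
  have "dominated ?e (partial_transpose (2 ^ m) (2 ^ m) F) ((1 / 2) ^ m \<cdot>\<^sub>m 1\<^sub>m ?e)"
    using tensor_power_dominated[OF dominated_partial_transpose_Phi, of m]
    unfolding F_def partial_transpose_tensor_power[OF Phi_carrier] tensor_power_scaled_one .
  \<comment> \<open>Both operators in the overlap are transposed, which leaves its value unchanged;
    neither transpose need be positive, so the two-sided pairing is essential.\<close>
  from dominated_trace_mult[OF this 1]
  have "mat_trace (F * L R) \<le> mat_trace ((1 / 2) ^ m \<cdot>\<^sub>m 1\<^sub>m ?e * LG (tensor_power a b Y n))"
    by (simp add: partial_transpose_trace_mult[OF Fc Sc])
  also have "\<dots> = (1 / 2) ^ m * mat_trace (LG (tensor_power a b Y n))"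
    using dominatedD(2)[OF 1] by (simp add: mat_trace_smult[of _ ?e] mult_smult_assoc_mat[of _ ?e ?e])
  \<comment> \<open>\<open>LG\<close> preserves the trace, as \<open>L\<close> and both
    transpositions do.\<close>
  also have "mat_trace (LG (tensor_power a b Y n)) = complex_of_real (N ^ n)"
  proof -
    have "L (partial_transpose (a ^ n) (b ^ n) (tensor_power a b Y n)) \<in> carrier_mat ?e ?e"
      by (rule completely_positive_carrier[OF L1]) simp
    then show ?thesis
      unfolding LG_def
      using Y(2) by (simp add: partial_transpose_trace tensor_power_carrier L2
          tensor_power_trace[OF dominatedD(2)[OF Y(1)]])
  qed
  finally have le: "mat_trace (F * L R) \<le> (1 / 2) ^ m * complex_of_real (N ^ n)" .
  have fid: "Re (mat_trace (F * L R)) \<le> N ^ n / 2 ^ m"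
  proof -
    have "(1 / 2) ^ m * complex_of_real (N ^ n) = complex_of_real (N ^ n / 2 ^ m)"
      by (simp add: power_one_over)
    then show ?thesis using le by (simp only: less_eq_complex_def Re_complex_of_real)
  qed
  \<comment> \<open>\<open>F\<close> serves as a test with 0 <= F <= 1 that the target passes with
    certainty, so the error is at least one minus the overlap.\<close>
  have "mat_trace (F * (L R - F)) = mat_trace (F * L R) - mat_trace (F * F)"
    by (rule trace_mult_minus_right[OF Fc Sc Fc])
  moreover have "mat_trace (F * F) = 1"
    unfolding F_def tensor_power_mult[OF Phi_carrier Phi_carrier]
    using Phi_carrier by (simp add: tensor_power_trace[of _ 2 2] trace_Phi_Phi)
  moreover have "dominated ?e F (1\<^sub>m ?e)"
    using tensor_power_dominated[OF dominated_Phi_one, of m] unfolding F_def tensor_power_one .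
  moreover have "mat_adjoint (L R - F) = L R - F"
    using mat_adjoint_minus[OF Sc Fc] psd_hermitian[OF S] psd_hermitian[OF F] by simp
  ultimately have "\<bar>Re (mat_trace (F * L R)) - 1\<bar> \<le> trace_norm (L R - F)"
    using abs_trace_mult_le_trace_norm[of ?e F "L R - F"] minus_carrier_mat[OF Fc] by simp
  with fid show ?thesis unfolding R_def F_def by linarith
qed

text \<open>The transpose of \<open>L F\<close> need not be positive, so \<open>L F\<close> is first
  enlarged to the PPT operator \<open>L D\<close>. \<open>P\<close> is a test that \<rho> passes
  with certainty, and \<open>Y\<close> certifies that PPT operators pass it with weight at most half
  their trace.\<close>

lemma dilution_fidelity_bound:
  assumes L: "ppt_operation (2 ^ m) (2 ^ m) (a ^ n) (b ^ n) L"
    and \<rho>: "psd (a * b) \<rho>" and P: "psd (a * b) P" "dominated (a * b) P (1\<^sub>m (a * b))"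
    and P\<rho>: "mat_trace (P * \<rho>) = 1"
    and Y: "dominated (a * b) (partial_transpose a b P) Y"
      "dominated (a * b) (partial_transpose a b Y) ((1 / 2) \<cdot>\<^sub>m 1\<^sub>m (a * b))"
  shows "1 - trace_norm (tensor_power a b \<rho> n - L (tensor_power 2 2 Phi m)) \<le> 2 ^ m / 2 ^ n"
proof -
  let ?d = "2 ^ m * 2 ^ m :: nat" and ?e = "a ^ n * b ^ n"
  define R where "R = tensor_power a b \<rho> n"
  define F where "F = tensor_power 2 2 Phi m"
  define D where "D = tensor_power 2 2 diag_state m"
  define Q where "Q = tensor_power a b P n"
  define Z where "Z = tensor_power a b Y n"
  let ?pt = "partial_transpose (a ^ n) (b ^ n)"
  define LG where "LG = ?pt \<circ> L \<circ> partial_transpose (2 ^ m) (2 ^ m)"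
  note L1 = ppt_operationD(1)[OF L] and L2 = ppt_operationD(2)[OF L]
  have LG: "completely_positive ?d ?e LG" using ppt_operationD(3)[OF L] unfolding LG_def .
  have R: "psd ?e R" unfolding R_def by (rule tensor_power_psd[OF \<rho>])
  have F: "psd ?d F" unfolding F_def by (rule tensor_power_psd[OF psd_Phi])
  have D: "psd ?d D" unfolding D_def by (rule tensor_power_psd[OF psd_diag_state])
  have Q: "psd ?e Q" unfolding Q_def by (rule tensor_power_psd[OF P(1)])
  note Rc = psd_carrier[OF R] and Fc = psd_carrier[OF F] and Dc = psd_carrier[OF D] and Qc = psd_carrier[OF Q]
  have Zc: "Z \<in> carrier_mat ?e ?e" unfolding Z_def by (rule tensor_power_carrier)
  have S: "psd ?e (L F)" by (rule completely_positive_psd[OF L1 F])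
  have T: "psd ?e (L D)" by (rule completely_positive_psd[OF L1 D])
  note Sc = psd_carrier[OF S] and Tc = psd_carrier[OF T]
  \<comment> \<open>\<open>D\<close> is fixed by transposition, so positivity of \<open>LG\<close>
    says that \<open>L D\<close> has a positive partial transpose.\<close>
  have "LG D = ?pt (L D)"
    unfolding LG_def D_def
    by (simp add: partial_transpose_tensor_power[OF diag_state_carrier] partial_transpose_diag_state)
  then have TG: "psd ?e (?pt (L D))" using completely_positive_psd[OF LG D] by simp
  have "psd ?d (D - F)"
    unfolding D_def F_def by (rule dominatedD(3)[OF tensor_power_dominated[OF dominated_Phi_diag_state]])
  then have DF: "psd ?e (L D - L F)"
    using completely_positive_psd[OF L1] completely_positive_minus[OF L1 Dc Fc] by metis
  have "mat_trace (Q * L F) \<le> mat_trace (Q * L D)"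
    using trace_mult_psd_nonneg[OF Q DF] trace_mult_minus_right[OF Qc Tc Sc] by simp
  also have "\<dots> = mat_trace (?pt Q * ?pt (L D))"
    by (rule partial_transpose_trace_mult[OF Qc Tc, symmetric])
  \<comment> \<open>The n-th power of the upper bound on the transposed test is legitimate because
    \<open>Y\<close> bounds its negative as well; the same holds for the transpose of
    \<open>Y\<close> below.\<close>
  also have "\<dots> \<le> mat_trace (Z * ?pt (L D))"
  proof (rule trace_mult_mono[OF _ TG _ Zc])
    show "psd ?e (Z - ?pt Q)"
      unfolding Z_def Q_def partial_transpose_tensor_power[OF psd_carrier[OF P(1)]]
      by (rule dominatedD(3)[OF tensor_power_dominated[OF Y(1)]])
  qed simp
  also have "\<dots> = mat_trace (?pt Z * L D)"
    using partial_transpose_trace_mult[OF Zc partial_transpose_carrier[of _ _ "L D"]]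
    by (simp add: partial_transpose_involution[OF Tc])
  also have "\<dots> \<le> mat_trace (((1 / 2) ^ n \<cdot>\<^sub>m 1\<^sub>m ?e) * L D)"
  proof (rule trace_mult_mono[OF _ T])
    show "psd ?e ((1 / 2) ^ n \<cdot>\<^sub>m 1\<^sub>m ?e - ?pt Z)"
      unfolding Z_def partial_transpose_tensor_power[OF dominatedD(2)[OF Y(1)]] tensor_power_scaled_one[symmetric]
      by (rule dominatedD(3)[OF tensor_power_dominated[OF Y(2)]])
  qed auto
  also have "\<dots> = (1 / 2) ^ n * mat_trace (L D)"
    using Tc by (simp add: mat_trace_smult[of _ ?e] mult_smult_assoc_mat[of _ ?e ?e])
  also have "mat_trace (L D) = 2 ^ m"
    unfolding L2[OF Dc] unfolding D_def tensor_power_trace[OF diag_state_carrier] trace_diag_state ..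
  finally have le: "mat_trace (Q * L F) \<le> (1 / 2) ^ n * 2 ^ m" .
  have fid: "Re (mat_trace (Q * L F)) \<le> 2 ^ m / 2 ^ n"
  proof -
    have "(1 / 2) ^ n * 2 ^ m = complex_of_real (2 ^ m / 2 ^ n)"
      by (simp add: power_one_over)
    then show ?thesis using le by (simp only: less_eq_complex_def Re_complex_of_real)
  qed
  \<comment> \<open>\<open>Q\<close> accepts \<open>R\<close> with certainty, so a small weight of
    \<open>L F\<close> under \<open>Q\<close> forces a large trace distance.\<close>
  have "mat_trace (Q * (R - L F)) = mat_trace (Q * R) - mat_trace (Q * L F)"
    by (rule trace_mult_minus_right[OF Qc Rc Sc])
  moreover have "mat_trace (Q * R) = 1"
    unfolding Q_def R_def tensor_power_mult[OF psd_carrier[OF P(1)] psd_carrier[OF \<rho>]]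
    using psd_carrier[OF P(1)] psd_carrier[OF \<rho>] by (simp add: tensor_power_trace P\<rho>)
  moreover have "dominated ?e Q (1\<^sub>m ?e)"
    using tensor_power_dominated[OF P(2), of n] unfolding Q_def tensor_power_one .
  moreover have "mat_adjoint (R - L F) = R - L F"
    using mat_adjoint_minus[OF Rc Sc] psd_hermitian[OF S] psd_hermitian[OF R] by simp
  ultimately have "\<bar>1 - Re (mat_trace (Q * L F))\<bar> \<le> trace_norm (R - L F)"
    using abs_trace_mult_le_trace_norm[of ?e Q "R - L F"] minus_carrier_mat[OF Sc] by simp
  with fid show ?thesis unfolding R_def F_def by linarith
qed


section \<open>Rates\<close>

text \<open>Converts an estimate with bounded slack for all large n into an inequality of
  rates.\<close>

lemma eventually_linear_bound:
  assumes "\<forall>\<^sub>F n in sequentially. c * real n \<le> K"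
  shows "c \<le> 0"
proof (rule ccontr)
  assume "\<not> c \<le> 0"
  then have c: "0 < c" by simp
  obtain n0 where n0: "\<And>n. n0 \<le> n \<Longrightarrow> c * real n \<le> K"
    using assms unfolding eventually_sequentially by blast
  obtain n1 where "K / c < real n1" using reals_Archimedean2 by blast
  then have "K / c < real (max n0 n1)" by (rule less_le_trans) simp
  then show False using n0[of "max n0 n1"] c by (simp add: pos_divide_less_eq mult.commute)
qed

lemma nat_floor_bounds:
  assumes "0 \<le> x"
  shows "x - 1 < real (nat \<lfloor>x\<rfloor>)" "real (nat \<lfloor>x\<rfloor>) \<le> x"
  using assms by linarith+

lemma distillable_rate_bound:
  assumes r: "0 \<le> r" "(\<lambda>n. distill_error a b \<rho> n (nat \<lfloor>r * real n\<rfloor>)) \<longlonglongrightarrow> 0"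
    and \<rho>: "psd (a * b) \<rho>"
    and Y: "dominated (a * b) (partial_transpose a b \<rho>) Y" "mat_trace Y = complex_of_real N" and N: "0 < N"
  shows "r \<le> log 2 N"
proof -
  \<comment> \<open>Any threshold below 1 would serve; an error of 1/2 costs one bit in the estimate
    of \<open>m\<close>.\<close>
  have "\<forall>\<^sub>F n in sequentially. distill_error a b \<rho> n (nat \<lfloor>r * real n\<rfloor>) < 1 / 2"
    using r(2) by (rule order_tendstoD) simp
  then have "\<forall>\<^sub>F n in sequentially. (r - log 2 N) * real n \<le> 2"
  proof (rule eventually_mono)
    fix n
    define m where "m = nat \<lfloor>r * real n\<rfloor>"
    let ?S = "{L. ppt_operation (a ^ n) (b ^ n) (2 ^ m) (2 ^ m) L}"
    assume "distill_error a b \<rho> n (nat \<lfloor>r * real n\<rfloor>) < 1 / 2"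
    then have "(INF L\<in>?S. trace_norm (L (tensor_power a b \<rho> n) - tensor_power 2 2 Phi m)) < 1 / 2"
      by (simp add: distill_error_def m_def)
    moreover have "?S \<noteq> {}" using ppt_operation_exists[of "2 ^ m" "2 ^ m"] by simp
    ultimately obtain L where L: "L \<in> ?S" "trace_norm (L (tensor_power a b \<rho> n) - tensor_power 2 2 Phi m) < 1 / 2"
      using cInf_lessD[of "(\<lambda>L. trace_norm (L (tensor_power a b \<rho> n) - tensor_power 2 2 Phi m)) ` ?S"] by blast
    have "1 / 2 \<le> N ^ n / 2 ^ m"
      using distillation_fidelity_bound[OF _ \<rho> Y, of n m L] L unfolding mem_Collect_eq by linarith
    then have "2 ^ m \<le> 2 * N ^ n" by (simp add: field_simps)
    then have "log 2 (2 ^ m) \<le> log 2 (2 * N ^ n)" using N by (subst log_le_cancel_iff) auto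
    then have "real m \<le> 1 + real n * log 2 N" using N by (simp add: log_mult log_nat_power)
    moreover have "r * real n - 1 < real m" unfolding m_def using r(1) by (intro nat_floor_bounds) simp
    \<comment> \<open>The constant 2 is one bit from the error threshold plus one from rounding
      \<open>r * n\<close> down to \<open>m\<close>.\<close>
    ultimately show "(r - log 2 N) * real n \<le> 2" by (simp add: algebra_simps)
  qed
  then show ?thesis using eventually_linear_bound by fastforce
qed

lemma distillable_entanglement_less_one:
  assumes \<rho>: "psd (a * b) \<rho>"
    and Y: "dominated (a * b) (partial_transpose a b \<rho>) Y" "mat_trace Y = complex_of_real N"
    and N: "0 < N" "N < 2"
  shows "E_D a b \<rho> < 1"
proof -
  have "E_D a b \<rho> \<le> ereal (log 2 N)"
    unfolding E_D_def by (rule Sup_least) (auto dest: distillable_rate_bound[OF _ _ \<rho> Y N(1)])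
  also have "log 2 N < 1" using N by (simp add: log_less_one_cancel_iff)
  then have "ereal (log 2 N) < 1" by simp
  finally show ?thesis .
qed

lemma dilution_rate_bound:
  assumes r: "0 \<le> r" "(\<lambda>n. dilute_error a b \<rho> n (nat \<lfloor>r * real n\<rfloor>)) \<longlonglongrightarrow> 0"
    and ab: "0 < a" "0 < b"
    and \<rho>: "psd (a * b) \<rho>" and P: "psd (a * b) P" "dominated (a * b) P (1\<^sub>m (a * b))"
    and P\<rho>: "mat_trace (P * \<rho>) = 1"
    and Y: "dominated (a * b) (partial_transpose a b P) Y"
      "dominated (a * b) (partial_transpose a b Y) ((1 / 2) \<cdot>\<^sub>m 1\<^sub>m (a * b))"
  shows "1 \<le> r"
proof -
  have "\<forall>\<^sub>F n in sequentially. dilute_error a b \<rho> n (nat \<lfloor>r * real n\<rfloor>) < 1 / 2"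
    using r(2) by (rule order_tendstoD) simp
  then have "\<forall>\<^sub>F n in sequentially. (1 - r) * real n \<le> 1"
  proof (rule eventually_mono)
    fix n
    define m where "m = nat \<lfloor>r * real n\<rfloor>"
    let ?S = "{L. ppt_operation (2 ^ m) (2 ^ m) (a ^ n) (b ^ n) L}"
    assume "dilute_error a b \<rho> n (nat \<lfloor>r * real n\<rfloor>) < 1 / 2"
    then have "(INF L\<in>?S. trace_norm (tensor_power a b \<rho> n - L (tensor_power 2 2 Phi m))) < 1 / 2"
      by (simp add: dilute_error_def m_def)
    moreover have "?S \<noteq> {}" using ppt_operation_exists[of "a ^ n" "b ^ n"] ab by simp
    ultimately obtain L where L: "L \<in> ?S" "trace_norm (tensor_power a b \<rho> n - L (tensor_power 2 2 Phi m)) < 1 / 2"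
      using cInf_lessD[of "(\<lambda>L. trace_norm (tensor_power a b \<rho> n - L (tensor_power 2 2 Phi m))) ` ?S"] by blast
    have "1 / 2 \<le> (2 ^ m / 2 ^ n :: real)"
      using dilution_fidelity_bound[OF _ \<rho> P P\<rho> Y, of m n L] L unfolding mem_Collect_eq by linarith
    then have "(2 ^ n :: real) \<le> 2 ^ Suc m" by (simp add: field_simps)
    then have "n \<le> Suc m" by (subst (asm) power_increasing_iff) auto
    \<comment> \<open>Rounding down now works in favour of the estimate, so only the bit from the
      error threshold is left as slack.\<close>
    moreover have "real m \<le> r * real n" unfolding m_def using r(1) by (intro nat_floor_bounds) simp
    ultimately show "(1 - r) * real n \<le> 1" by (simp add: algebra_simps)
  qed
  then show ?thesis using eventually_linear_bound by fastforce
qed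

text \<open>Nonnegativity of the trace norm is used twice: it bounds the set from below, so that the
  infimum lies under the value 0 attained at \<open>L\<close>, and it keeps the infimum from being
  negative.\<close>

lemma dilute_error_eq_zero:
  assumes L: "ppt_operation (2 ^ m) (2 ^ m) (a ^ n) (b ^ n) L"
    and eq: "L (tensor_power 2 2 Phi m) = tensor_power a b \<rho> n"
  shows "dilute_error a b \<rho> n m = 0"
proof -
  let ?S = "{L. ppt_operation (2 ^ m) (2 ^ m) (a ^ n) (b ^ n) L}"
  let ?f = "\<lambda>L. trace_norm (tensor_power a b \<rho> n - L (tensor_power 2 2 Phi m))"
  have nonneg: "0 \<le> ?f M" if "M \<in> ?S" for M
  proof (rule trace_norm_nonneg)
    show "tensor_power a b \<rho> n - M (tensor_power 2 2 Phi m) \<in> carrier_mat (a ^ n * b ^ n) (a ^ n * b ^ n)"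
      using that by (intro minus_carrier_mat completely_positive_carrier[OF ppt_operationD(1) tensor_power_carrier]) simp
  qed
  have "tensor_power a b \<rho> n - tensor_power a b \<rho> n = 0\<^sub>m (a ^ n * b ^ n) (a ^ n * b ^ n)"
    using tensor_power_carrier by (rule minus_r_inv_mat)
  then have "?f L = 0" unfolding eq by (simp add: trace_norm_zero)
  moreover have "bdd_below (?f ` ?S)" by (rule bdd_belowI2[of _ 0]) (rule nonneg)
  ultimately have "(INF M\<in>?S. ?f M) \<le> 0"
    using cINF_lower[of ?f ?S L] L by simp
  moreover have "0 \<le> (INF M\<in>?S. ?f M)"
    using L nonneg by (intro cINF_greatest) auto
  ultimately show ?thesis unfolding dilute_error_def by simp
qed

lemma entanglement_cost_eq_one:
  assumes ab: "0 < a" "0 < b"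
    and \<rho>: "psd (a * b) \<rho>" and P: "psd (a * b) P" "dominated (a * b) P (1\<^sub>m (a * b))"
    and P\<rho>: "mat_trace (P * \<rho>) = 1"
    and Y: "dominated (a * b) (partial_transpose a b P) Y"
      "dominated (a * b) (partial_transpose a b Y) ((1 / 2) \<cdot>\<^sub>m 1\<^sub>m (a * b))"
    and dil: "\<And>n. \<exists>L. ppt_operation (2 ^ n) (2 ^ n) (a ^ n) (b ^ n) L \<and>
        L (tensor_power 2 2 Phi n) = tensor_power a b \<rho> n"
  shows "E_C a b \<rho> = 1"
proof (rule antisym)
  \<comment> \<open>At rate 1 the number of available pairs is exactly \<open>n\<close>, and the
    conversion is exact for every \<open>n\<close>.\<close>
  have "dilute_error a b \<rho> n n = 0" for n
    using dil[of n] by (elim exE conjE) (rule dilute_error_eq_zero)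
  then have "(\<lambda>n. dilute_error a b \<rho> n (nat \<lfloor>1 * real n\<rfloor>)) \<longlonglongrightarrow> 0" by simp
  then have "ereal 1 \<in> ereal ` {r. 0 \<le> r \<and> (\<lambda>n. dilute_error a b \<rho> n (nat \<lfloor>r * real n\<rfloor>)) \<longlonglongrightarrow> 0}"
    by (intro imageI) simp
  then show "E_C a b \<rho> \<le> 1" unfolding E_C_def one_ereal_def by (rule Inf_lower)
  show "1 \<le> E_C a b \<rho>"
    unfolding E_C_def by (rule Inf_greatest) (auto dest: dilution_rate_bound[OF _ _ ab \<rho> P P\<rho> Y])
qed


section \<open>Mixtures of two antisymmetric states\<close>

lemma dim_ketbra [simp]: "dim_row (ketbra v) = dim_vec v" "dim_col (ketbra v) = dim_vec v"
  by (simp_all add: ketbra_def)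

lemma ketbra_index: "i < dim_vec v \<Longrightarrow> j < dim_vec v \<Longrightarrow> ketbra v $$ (i, j) = v $ i * cnj (v $ j)"
  by (simp add: ketbra_def)

lemma mat_adjoint_ketbra [simp]: "mat_adjoint (ketbra v) = ketbra v"
  by (intro eq_matI) (auto simp: ketbra_def)

lemma ketbra_mult:
  assumes "u \<in> carrier_vec d" "v \<in> carrier_vec d"
  shows "ketbra u * ketbra v = mat d d (\<lambda>(i, j). (v \<bullet>c u) * (u $ i * cnj (v $ j)))"
proof (rule eq_matI)
  fix i j assume "i < dim_row (mat d d (\<lambda>(i, j). (v \<bullet>c u) * (u $ i * cnj (v $ j))))"
    "j < dim_col (mat d d (\<lambda>(i, j). (v \<bullet>c u) * (u $ i * cnj (v $ j))))"
  then have ij: "i < d" "j < d" by auto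
  have "(ketbra u * ketbra v) $$ (i, j) = (\<Sum>k<d. (u $ i * cnj (u $ k)) * (v $ k * cnj (v $ j)))"
    using assms ij by (subst mat_mult_index[of _ d d _ d]) (auto simp: ketbra_def)
  also have "\<dots> = (\<Sum>k<d. v $ k * cnj (u $ k)) * (u $ i * cnj (v $ j))"
    by (simp add: sum_distrib_left sum_distrib_right ac_simps)
  finally show "(ketbra u * ketbra v) $$ (i, j) = mat d d (\<lambda>(i, j). (v \<bullet>c u) * (u $ i * cnj (v $ j))) $$ (i, j)"
    using assms ij by (simp add: scalar_prod_def atLeast0LessThan)
qed (use assms in \<open>auto simp: ketbra_def\<close>)

text \<open>The complement is again a Hermitian idempotent, hence its own Gram
  factorization.\<close>

lemma psd_one_minus_projection:
  assumes E: "E \<in> carrier_mat d d" "mat_adjoint E = E" "E * E = E"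
  shows "psd d (1\<^sub>m d - E)"
proof -
  have c: "1\<^sub>m d - E \<in> carrier_mat d d" using E(1) by (rule minus_carrier_mat)
  have "(1\<^sub>m d - E) * mat_adjoint (1\<^sub>m d - E) = (1\<^sub>m d - E) * (1\<^sub>m d - E)"
    using mat_adjoint_minus[OF one_carrier_mat E(1)] E(2) by simp
  also have "\<dots> = 1\<^sub>m d * (1\<^sub>m d - E) - E * (1\<^sub>m d - E)"
    by (rule minus_mult_distrib_mat[OF one_carrier_mat E(1) c])
  also have "\<dots> = (1\<^sub>m d - E) - (E - E)"
    using E(1,3) c mult_minus_distrib_mat[OF E(1) one_carrier_mat E(1)] by simp
  also have "\<dots> = 1\<^sub>m d - E" using E(1) by (intro eq_matI) auto
  finally show ?thesis using psd_gram[OF c] by simp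
qed

lemma mat_trace_ketbra: "v \<in> carrier_vec d \<Longrightarrow> mat_trace (ketbra v) = v \<bullet>c v"
  by (auto simp: mat_trace_def ketbra_def scalar_prod_def atLeast0LessThan)

section \<open>Product and wedge vectors in C^3 \<otimes> C^3\<close>

type_synonym vec3 = "nat \<Rightarrow> complex"

definition prod_vec :: "vec3 \<Rightarrow> vec3 \<Rightarrow> complex vec" where
  "prod_vec x y = vec 9 (\<lambda>r. x (r div 3) * y (r mod 3))"

definition wedge :: "vec3 \<Rightarrow> vec3 \<Rightarrow> complex vec" where
  "wedge x y = vec 9 (\<lambda>r. complex_of_real (1 / sqrt 2) * (x (r div 3) * y (r mod 3) - y (r div 3) * x (r mod 3)))"

definition inner3 :: "vec3 \<Rightarrow> vec3 \<Rightarrow> complex" where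
  "inner3 x y = (\<Sum>i<3. x i * cnj (y i))"

text \<open>Bob's vectors appear conjugated after partial transposition, because the transpose of
  |y><w| is |w'><y'| with the conjugate vectors w' and y'.\<close>

definition conj_vec3 :: "vec3 \<Rightarrow> vec3" where
  "conj_vec3 x i = cnj (x i)"

lemma prod_vec_carrier [simp]: "prod_vec x y \<in> carrier_vec 9" "dim_vec (prod_vec x y) = 9"
  by (auto simp: prod_vec_def)

lemma wedge_carrier [simp]: "wedge x y \<in> carrier_vec 9" "dim_vec (wedge x y) = 9"
  by (auto simp: wedge_def)

lemma prod_vec_index: "r < 9 \<Longrightarrow> prod_vec x y $ r = x (r div 3) * y (r mod 3)"
  by (simp add: prod_vec_def)

lemma wedge_index:
  "r < 9 \<Longrightarrow> wedge x y $ r = complex_of_real (1 / sqrt 2) * (x (r div 3) * y (r mod 3) - y (r div 3) * x (r mod 3))"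
  by (simp add: wedge_def)

lemma sum_prod_index:
  fixes f g :: vec3
  shows "(\<Sum>r<9. f (r div 3) * g (r mod 3)) = (\<Sum>i<3. f i) * (\<Sum>j<3. g j)"
  using sum_div_mod[of "\<lambda>i j. f i * g j" 3 3] by (simp add: sum_product)

lemma inner_prod_vec: "prod_vec x y \<bullet>c prod_vec z w = inner3 x z * inner3 y w"
proof -
  have "prod_vec x y \<bullet>c prod_vec z w = (\<Sum>r<9. (x (r div 3) * cnj (z (r div 3))) * (y (r mod 3) * cnj (w (r mod 3))))"
    by (auto simp: scalar_prod_def prod_vec_def atLeast0LessThan intro!: sum.cong)
  then show ?thesis unfolding sum_prod_index[of "\<lambda>i. x i * cnj (z i)" "\<lambda>j. y j * cnj (w j)"] inner3_def .
qed

lemma half_mult: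
  "complex_of_real (1 / sqrt 2) * a * cnj (complex_of_real (1 / sqrt 2) * b) = a * cnj b / 2"
proof -
  have "complex_of_real (1 / sqrt 2) * a * cnj (complex_of_real (1 / sqrt 2) * b)
      = (complex_of_real (1 / sqrt 2) * complex_of_real (1 / sqrt 2)) * (a * cnj b)" by simp
  then show ?thesis unfolding sqrt_two_square by simp
qed

lemma wedge_eq:
  "wedge x y = complex_of_real (1 / sqrt 2) \<cdot>\<^sub>v (prod_vec x y - prod_vec y x)"
  by (intro eq_vecI) (auto simp: wedge_def prod_vec_def)

text \<open>A Gram determinant: each of the four terms of the expanded product splits into a sum
  over Alice's digit times a sum over Bob's.\<close>

lemma inner_wedge:
  "wedge x y \<bullet>c wedge z w = inner3 x z * inner3 y w - inner3 x w * inner3 y z"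
proof -
  have "wedge x y \<bullet>c wedge z w
      = (\<Sum>r<9. complex_of_real (1 / sqrt 2) * (x (r div 3) * y (r mod 3) - y (r div 3) * x (r mod 3))
          * cnj (complex_of_real (1 / sqrt 2) * (z (r div 3) * w (r mod 3) - w (r div 3) * z (r mod 3))))"
    by (auto simp: scalar_prod_def wedge_def atLeast0LessThan intro!: sum.cong)
  also have "\<dots> = (\<Sum>r<9. ((x (r div 3) * cnj (z (r div 3))) * (y (r mod 3) * cnj (w (r mod 3)))
      + (y (r div 3) * cnj (w (r div 3))) * (x (r mod 3) * cnj (z (r mod 3)))
      - (x (r div 3) * cnj (w (r div 3))) * (y (r mod 3) * cnj (z (r mod 3)))
      - (y (r div 3) * cnj (z (r div 3))) * (x (r mod 3) * cnj (w (r mod 3)))) / 2)"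
    unfolding half_mult by (intro sum.cong refl) (simp add: algebra_simps)
  also have "\<dots> = (inner3 x z * inner3 y w + inner3 y w * inner3 x z - inner3 x w * inner3 y z - inner3 y z * inner3 x w) / 2"
    unfolding sum_divide_distrib[symmetric] sum.distrib sum_subtractf
      sum_prod_index[of "\<lambda>i. x i * cnj (z i)" "\<lambda>j. y j * cnj (w j)"]
      sum_prod_index[of "\<lambda>i. y i * cnj (w i)" "\<lambda>j. x j * cnj (z j)"]
      sum_prod_index[of "\<lambda>i. x i * cnj (w i)" "\<lambda>j. y j * cnj (z j)"]
      sum_prod_index[of "\<lambda>i. y i * cnj (z i)" "\<lambda>j. x j * cnj (w j)"] inner3_def ..
  also have "\<dots> = inner3 x z * inner3 y w - inner3 x w * inner3 y z" by (simp add: field_simps)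
  finally show ?thesis .
qed

lemma ketbra_wedge_index:
  assumes "r < 9" "c < 9"
  shows "ketbra (wedge x y) $$ (r, c)
    = (x (r div 3) * y (r mod 3) - y (r div 3) * x (r mod 3))
      * cnj (x (c div 3) * y (c mod 3) - y (c div 3) * x (c mod 3)) / 2"
  using assms by (simp only: ketbra_index wedge_index wedge_carrier half_mult)

lemma cross_index_three:
  assumes "r < 9" "c < 9"
  shows "cross_index 3 r c < 9" "cross_index 3 r c div 3 = r div 3" "cross_index 3 r c mod 3 = c mod 3"
  using cross_index_less[of r 3 3 c 3] cross_index_div_mod[of c 3 3] assms by auto

lemma partial_transpose_ketbra_wedge_index:
  assumes "r < 9" "c < 9"
  shows "partial_transpose 3 3 (ketbra (wedge x y)) $$ (r, c)
    = (x (r div 3) * y (c mod 3) - y (r div 3) * x (c mod 3))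
      * cnj (x (c div 3) * y (r mod 3) - y (c div 3) * x (r mod 3)) / 2"
  using assms partial_transpose_index[of r 3 3 c]
  by (simp add: ketbra_wedge_index cross_index_three)

text \<open>\<open>q A \<otimes> B\<close>, where \<open>A s\<close> and \<open>B s\<close> are the images of the basis vector \<open>s\<close>.\<close>

definition local_op :: "real \<Rightarrow> (nat \<Rightarrow> vec3) \<Rightarrow> (nat \<Rightarrow> vec3) \<Rightarrow> complex mat" where
  "local_op q A B = mat (3 * 3) (2 * 2)
     (\<lambda>(r, s). complex_of_real q * (A (s div 2) (r div 3) * B (s mod 2) (r mod 3)))"

lemma transpose_partner_local_op:
  "transpose_partner 2 2 3 3 (local_op q A B) (local_op q A (\<lambda>s. conj_vec3 (B s)))"
  unfolding transpose_partner_def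
proof (intro conjI allI impI)
  fix r r' s s' :: nat assume b: "r < 3 * 3" "r' < 3 * 3" "s < 2 * 2" "s' < 2 * 2"
  note lt = cross_index_less[OF b(1,2)] cross_index_less[OF b(2,1)]
    cross_index_less[OF b(3,4)] cross_index_less[OF b(4,3)]
  note dm = cross_index_div_mod[OF b(1)] cross_index_div_mod[OF b(2)]
    cross_index_div_mod[OF b(3)] cross_index_div_mod[OF b(4)]
  show "local_op q A B $$ (cross_index 3 r r', cross_index 2 s s')
      * cnj (local_op q A B $$ (cross_index 3 r' r, cross_index 2 s' s))
    = local_op q A (\<lambda>s. conj_vec3 (B s)) $$ (r, s) * cnj (local_op q A (\<lambda>s. conj_vec3 (B s)) $$ (r', s'))"
    using b lt unfolding local_op_def by (simp add: dm conj_vec3_def)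
qed (auto simp: local_op_def)

section \<open>Negativity of the mixture in an orthonormal basis f, g, e\<close>

context
  fixes f g e :: vec3
  assumes complete: "\<And>i j. i < 3 \<Longrightarrow> j < 3 \<Longrightarrow>
      f i * cnj (f j) + g i * cnj (g j) + e i * cnj (e j) = (if i = j then 1 else 0)"
    and orthonormal: "inner3 f f = 1" "inner3 g g = 1" "inner3 e e = 1" "inner3 f g = 0" "inner3 g f = 0"
      "inner3 f e = 0" "inner3 e f = 0" "inner3 g e = 0" "inner3 e g = 0"
begin

definition mixture :: "real \<Rightarrow> complex mat" where
  "mixture p = complex_of_real p \<cdot>\<^sub>m ketbra (wedge f g) + complex_of_real (1 - p) \<cdot>\<^sub>m ketbra (wedge f e)"

lemma mixture_carrier: "mixture p \<in> carrier_mat 9 9"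
  by (simp add: mixture_def ketbra_def)

lemma inner3_conj: "inner3 (conj_vec3 x) (conj_vec3 y) = cnj (inner3 x y)"
  by (simp add: inner3_def conj_vec3_def)

lemma psd_prod: "psd 9 (ketbra (prod_vec x y))"
  by (rule psd_ketbra) simp

text \<open>\<open>\<rho>\<^sup>T\<close> has a diagonal part and the off-diagonal part \<open>-(|ff\<rangle>\<langle>s| + |s\<rangle>\<langle>ff|) / 2\<close> with
  \<open>s = p |gg\<rangle> + (1 - p) |ee\<rangle>\<close> (the second factors conjugated). AM-GM with the weight \<open>t = \<parallel>s\<parallel>\<close> dominates
  the latter by \<open>(t |ff\<rangle>\<langle>ff| + |s\<rangle>\<langle>s| / t) / 2\<close>, the norm-optimal choice.\<close>

lemma mixture_transpose_dominated:
  assumes p: "0 < p" "p < 1"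
  shows "\<exists>Y. dominated (3 * 3) (partial_transpose 3 3 (mixture p)) Y
           \<and> mat_trace Y = complex_of_real (1 + sqrt (p\<^sup>2 + (1 - p)\<^sup>2))"
proof -
  define t where "t = sqrt (p\<^sup>2 + (1 - p)\<^sup>2)"
  have t: "0 < t" using p by (simp add: t_def add_pos_pos)
  define q where "q = sqrt t"
  have q: "0 < q" "q * q = t" using t by (simp_all add: q_def)
  let ?q = "complex_of_real q" and ?i = "complex_of_real (1 / q)" and ?p = "complex_of_real p"
    and ?p' = "complex_of_real (1 - p)"
  have qi: "?q * ?i = 1" using q by simp
  let ?ff = "prod_vec f (conj_vec3 f)" and ?gg = "prod_vec g (conj_vec3 g)" and ?ee = "prod_vec e (conj_vec3 e)"
  \<comment> \<open>\<open>x\<close> and \<open>y\<close> are q |ff> + s/q and q |ff> - s/q. The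
    factors q and 1/q cancel in the cross terms, so |x><x|/2 exceeds |y><y|/2 by |ff><s| + |s><ff|,
    exactly what removes the off-diagonal part of 2 R. Hence Y - R and Y + R are both manifestly
    positive, and Y exceeds R in trace by half the squared norm of \<open>x\<close>, which is
    t.\<close>
  define x where "x = vec 9 (\<lambda>r. ?q * ?ff $ r + ?i * (?p * ?gg $ r + ?p' * ?ee $ r))"
  define y where "y = vec 9 (\<lambda>r. ?q * ?ff $ r - ?i * (?p * ?gg $ r + ?p' * ?ee $ r))"
  define R where "R = partial_transpose 3 3 (mixture p)"
  have R: "R \<in> carrier_mat 9 9" unfolding R_def using partial_transpose_carrier[of 3 3] by simp
  have x: "x \<in> carrier_vec 9" "y \<in> carrier_vec 9" by (simp_all add: x_def y_def)
  define Y where "Y = R + complex_of_real (1 / 2) \<cdot>\<^sub>m ketbra x"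
  have Y: "Y \<in> carrier_mat 9 9" using R ketbra_carrier[OF x(1)] by (simp add: Y_def)
  have YmR: "Y - R = complex_of_real (1 / 2) \<cdot>\<^sub>m ketbra x"
    using R ketbra_carrier[OF x(1)] unfolding Y_def by (intro eq_matI) auto
  have YpR: "Y + R = (?p \<cdot>\<^sub>m (ketbra (prod_vec f (conj_vec3 g)) + ketbra (prod_vec g (conj_vec3 f)))
      + ?p' \<cdot>\<^sub>m (ketbra (prod_vec f (conj_vec3 e)) + ketbra (prod_vec e (conj_vec3 f))))
      + complex_of_real (1 / 2) \<cdot>\<^sub>m ketbra y" (is "_ = ?Z")
  proof (rule eq_matI)
    fix r c assume "r < dim_row ?Z" "c < dim_col ?Z"
    then have rc: "r < 9" "c < 9" using x by (auto simp: ketbra_def)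
    have R_index: "R $$ (r, c) = ?p * partial_transpose 3 3 (ketbra (wedge f g)) $$ (r, c)
        + ?p' * partial_transpose 3 3 (ketbra (wedge f e)) $$ (r, c)"
      unfolding R_def mixture_def using rc cross_index_three[OF rc] cross_index_three[OF rc(2,1)]
      by (simp add: partial_transpose_index ketbra_def)
    have xy: "x $ r * cnj (x $ c) = y $ r * cnj (y $ c)
        + 2 * (?ff $ r * cnj (?p * ?gg $ c + ?p' * ?ee $ c) + (?p * ?gg $ r + ?p' * ?ee $ r) * cnj (?ff $ c))"
    proof -
      have gen: "(Q * F + I * S) * cnj (Q * F' + I * S')
          = (Q * F - I * S) * cnj (Q * F' - I * S') + 2 * (Q * I) * (F * cnj S' + S * cnj F')"
        if "cnj Q = Q" "cnj I = I" for Q I F S F' S' :: complex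
        using that by (simp add: algebra_simps)
      show ?thesis
        using gen[of ?q ?i "?ff $ r" "?p * ?gg $ r + ?p' * ?ee $ r" "?ff $ c" "?p * ?gg $ c + ?p' * ?ee $ c"] rc
        unfolding qi by (simp add: x_def y_def)
    qed
    have "(Y + R) $$ (r, c) = 2 * R $$ (r, c) + x $ r * cnj (x $ c) / 2"
      using R rc x by (simp add: Y_def ketbra_def)
    also have "\<dots> = ?Z $$ (r, c)"
      unfolding R_index xy using rc carrier_vecD[OF x(2)]
      by (simp add: partial_transpose_ketbra_wedge_index prod_vec_index ketbra_index conj_vec3_def)
        (simp add: algebra_simps add_divide_distrib diff_divide_distrib)
    finally show "(Y + R) $$ (r, c) = ?Z $$ (r, c)" .
  qed (use R x in \<open>auto simp: ketbra_def\<close>)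
  have "psd 9 (Y - R)" unfolding YmR by (intro psd_smult psd_ketbra x) simp
  moreover have "psd 9 (Y + R)"
    unfolding YpR using p by (intro psd_add psd_smult psd_ketbra psd_prod x) auto
  ultimately have dom: "dominated (3 * 3) R Y" using R Y by (simp add: dominated_def)
  have "x \<bullet>c x = complex_of_real (q * q + (1 / q * p) * (1 / q * p) + (1 / q * (1 - p)) * (1 / q * (1 - p)))"
  proof -
    have "x = ?q \<cdot>\<^sub>v ?ff + ((?i * ?p) \<cdot>\<^sub>v ?gg + (?i * ?p') \<cdot>\<^sub>v ?ee)"
      by (intro eq_vecI) (auto simp: x_def algebra_simps diff_divide_distrib)
    then show ?thesis
      by (simp add: conjugate_add_vec[of _ 9] conjugate_smult_vec add_scalar_prod_distrib[of _ 9]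
          scalar_prod_add_distrib[of _ 9] inner_prod_vec inner3_conj orthonormal)
  qed
  also have "q * q + (1 / q * p) * (1 / q * p) + (1 / q * (1 - p)) * (1 / q * (1 - p)) = 2 * t"
  proof -
    have "(1 / q * p) * (1 / q * p) + (1 / q * (1 - p)) * (1 / q * (1 - p)) = (p\<^sup>2 + (1 - p)\<^sup>2) / (q * q)"
      by (simp add: power2_eq_square add_divide_distrib)
    also have "p\<^sup>2 + (1 - p)\<^sup>2 = t * t" by (simp add: t_def)
    finally show ?thesis using t by (simp add: q(2))
  qed
  finally have nx: "x \<bullet>c x = complex_of_real (2 * t)" .
  have "mat_trace R = 1"
  proof -
    have "mat_trace (mixture p) = ?p * mat_trace (ketbra (wedge f g)) + ?p' * mat_trace (ketbra (wedge f e))"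
      unfolding mixture_def using ketbra_carrier[OF wedge_carrier(1)]
      by (simp add: mat_trace_add[of _ 9] mat_trace_smult[of _ 9])
    also have "\<dots> = 1" by (simp add: mat_trace_ketbra[of _ 9] inner_wedge orthonormal)
    finally show ?thesis unfolding R_def using mixture_carrier[of p] by (simp add: partial_transpose_trace)
  qed
  then have "mat_trace Y = complex_of_real (1 + t)"
    unfolding Y_def using R ketbra_carrier[OF x(1)] nx
    by (simp add: mat_trace_add[of _ 9] mat_trace_smult[of _ 9] mat_trace_ketbra[OF x(1)])
  with dom show ?thesis unfolding R_def t_def by blast
qed

section \<open>The support projection and the cost witness\<close>

definition support_proj :: "complex mat" where
  "support_proj = ketbra (wedge f g) + ketbra (wedge f e)"

definition cost_witness :: "complex mat" where
  "cost_witness = complex_of_real (1 / 2) \<cdot>\<^sub>m 1\<^sub>m 9 - partial_transpose 3 3 (ketbra (wedge g e))"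

lemma support_proj_carrier: "support_proj \<in> carrier_mat 9 9"
  by (simp add: support_proj_def ketbra_def)

lemma cost_witness_carrier: "cost_witness \<in> carrier_mat 9 9"
  unfolding cost_witness_def using partial_transpose_carrier[of 3 3] by (intro minus_carrier_mat) simp

lemma psd_support_proj: "psd 9 support_proj"
  unfolding support_proj_def by (intro psd_add psd_ketbra) auto

lemma support_proj_idem: "support_proj * support_proj = support_proj"
  and support_proj_mixture: "support_proj * mixture p = mixture p"
proof -
  note c = ketbra_carrier[OF wedge_carrier(1)]
  have m: "ketbra (wedge f g) * ketbra (wedge f g) = ketbra (wedge f g)"
    "ketbra (wedge f e) * ketbra (wedge f e) = ketbra (wedge f e)"
    "ketbra (wedge f g) * ketbra (wedge f e) = 0\<^sub>m 9 9"
    "ketbra (wedge f e) * ketbra (wedge f g) = 0\<^sub>m 9 9"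
    by (intro eq_matI; simp add: ketbra_mult[of _ 9] inner_wedge orthonormal ketbra_index; simp add: ketbra_def)+
  have dist: "support_proj * (a \<cdot>\<^sub>m ketbra (wedge f g) + b \<cdot>\<^sub>m ketbra (wedge f e))
      = a \<cdot>\<^sub>m ketbra (wedge f g) + b \<cdot>\<^sub>m ketbra (wedge f e)" for a b
  proof -
    have "support_proj * (a \<cdot>\<^sub>m ketbra (wedge f g) + b \<cdot>\<^sub>m ketbra (wedge f e))
        = a \<cdot>\<^sub>m (support_proj * ketbra (wedge f g)) + b \<cdot>\<^sub>m (support_proj * ketbra (wedge f e))"
      using c support_proj_carrier
      by (simp add: mult_add_distrib_mat[of _ 9 9 _ 9] mult_smult_distrib[of _ 9 9 _ 9])
    also have "support_proj * ketbra (wedge f g) = ketbra (wedge f g)"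
      unfolding support_proj_def add_mult_distrib_mat[OF c c c] m using c by simp
    also have "support_proj * ketbra (wedge f e) = ketbra (wedge f e)"
      unfolding support_proj_def add_mult_distrib_mat[OF c c c] m using c by simp
    finally show ?thesis .
  qed
  show "support_proj * mixture p = mixture p" unfolding mixture_def by (rule dist)
  have "1 \<cdot>\<^sub>m ketbra v = ketbra v" for v by (intro eq_matI) auto
  then show "support_proj * support_proj = support_proj"
    using dist[of 1 1] by (simp add: support_proj_def)
qed

lemma dominated_support_proj: "dominated (3 * 3) support_proj (1\<^sub>m (3 * 3))"
proof -
  have "mat_adjoint support_proj = support_proj" by (rule psd_hermitian[OF psd_support_proj])
  then have "psd 9 (1\<^sub>m 9 - support_proj)"
    by (intro psd_one_minus_projection support_proj_carrier support_proj_idem)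
  moreover have "psd 9 (1\<^sub>m 9 + support_proj)" by (intro psd_add psd_one psd_support_proj)
  ultimately show ?thesis using support_proj_carrier by (simp add: dominated_def)
qed

text \<open>On the antisymmetric subspace the three vectors \<open>f \<and> g, f \<and> e, g \<and> e\<close> form an orthonormal basis,
  so their projections add up to \<open>(1 - F) / 2\<close> with the flip \<open>F\<close>, and \<open>F\<close> is the partial transpose of
  \<open>|\<delta>\<rangle>\<langle>\<delta>|\<close> with \<open>\<delta> = \<Sum>i |ii\<rangle>\<close>.\<close>

lemma partial_transpose_antisymmetric:
  assumes rc: "r < 9" "c < 9"
  shows "partial_transpose 3 3 (ketbra (wedge f g)) $$ (r, c) + partial_transpose 3 3 (ketbra (wedge f e)) $$ (r, c)
      + partial_transpose 3 3 (ketbra (wedge g e)) $$ (r, c)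
    = ((if r = c then 1 else 0)
       - (if r div 3 = r mod 3 then 1 else 0) * (if c div 3 = c mod 3 then 1 else 0)) / 2"
proof -
  define C where "C i j = f i * cnj (f j) + g i * cnj (g j) + e i * cnj (e j)" for i j
  let ?i = "r div 3" and ?j = "r mod 3" and ?k = "c div 3" and ?l = "c mod 3"
  have b: "?i < 3" "?j < 3" "?k < 3" "?l < 3" using rc by auto
  have "partial_transpose 3 3 (ketbra (wedge f g)) $$ (r, c) + partial_transpose 3 3 (ketbra (wedge f e)) $$ (r, c)
      + partial_transpose 3 3 (ketbra (wedge g e)) $$ (r, c) = (C ?i ?k * C ?l ?j - C ?i ?j * C ?l ?k) / 2"
    unfolding partial_transpose_ketbra_wedge_index[OF rc] C_def
    by (simp add: field_simps)
  also have "C ?i ?k = (if ?i = ?k then 1 else 0)" unfolding C_def using b by (intro complete)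
  also have "C ?l ?j = (if ?l = ?j then 1 else 0)" unfolding C_def using b by (intro complete)
  also have "C ?i ?j = (if ?i = ?j then 1 else 0)" unfolding C_def using b by (intro complete)
  also have "C ?l ?k = (if ?l = ?k then 1 else 0)" unfolding C_def using b by (intro complete)
  also have "(if ?i = ?k then 1 else 0) * (if ?l = ?j then 1 else 0) = (if r = c then 1 else 0 :: complex)"
  proof -
    have "?i = ?k \<and> ?l = ?j \<longleftrightarrow> r = c" by (metis div_mult_mod_eq)
    then show ?thesis by auto
  qed
  finally show ?thesis by (auto simp: eq_commute)
qed

text \<open>The resolution of the antisymmetric projection turns the witness into P^T +
  |\<delta>><\<delta>|/2, so the upper gap is |\<delta>><\<delta>|/2. For the lower gap, 2 P^T
  contributes the cross terms -|ff><s| - |s><ff| with s = |gg> + |ee> (second factors conjugated);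
  |\<delta>><\<delta>|/2 flips and halves them, and completing the square leaves |z><z|/2 with z =
  |ff> - s.\<close>

lemma dominated_transpose_support_proj:
  "dominated (3 * 3) (partial_transpose 3 3 support_proj) cost_witness"
proof -
  let ?P = "partial_transpose 3 3 support_proj"
  let ?W = "partial_transpose 3 3 (ketbra (wedge g e))"
  define \<delta> :: "complex vec" where "\<delta> = vec 9 (\<lambda>r. if r div 3 = r mod 3 then 1 else 0)"
  have \<delta>: "\<delta> \<in> carrier_vec 9" by (simp add: \<delta>_def)
  define z where "z = vec 9 (\<lambda>r. 2 * prod_vec f (conj_vec3 f) $ r - \<delta> $ r)"
  have z: "z \<in> carrier_vec 9" by (simp add: z_def)
  have P: "?P \<in> carrier_mat 9 9" using partial_transpose_carrier[of 3 3] by simp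
  have P_index: "?P $$ (r, c) = partial_transpose 3 3 (ketbra (wedge f g)) $$ (r, c)
      + partial_transpose 3 3 (ketbra (wedge f e)) $$ (r, c)" if "r < 9" "c < 9" for r c
    unfolding support_proj_def using that cross_index_three[OF that] cross_index_three[OF that(2,1)]
    by (simp add: partial_transpose_index ketbra_def)
  have W_index: "?W $$ (r, c) = ((if r = c then 1 else 0) - \<delta> $ r * cnj (\<delta> $ c)) / 2 - ?P $$ (r, c)"
    if "r < 9" "c < 9" for r c
  proof -
    have "\<delta> $ r * cnj (\<delta> $ c) = (if r div 3 = r mod 3 then 1 else 0) * (if c div 3 = c mod 3 then 1 else 0)"
      using that by (simp add: \<delta>_def)
    then have "?P $$ (r, c) + ?W $$ (r, c) = ((if r = c then 1 else 0) - \<delta> $ r * cnj (\<delta> $ c)) / 2"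
      unfolding P_index[OF that] partial_transpose_antisymmetric[OF that] by (simp only:)
    then show ?thesis by (simp only: eq_diff_eq add.commute)
  qed
  have Y_index: "cost_witness $$ (r, c) = \<delta> $ r * cnj (\<delta> $ c) / 2 + ?P $$ (r, c)" if "r < 9" "c < 9" for r c
    using W_index[OF that] that partial_transpose_carrier[of 3 3 "ketbra (wedge g e)"]
    by (auto simp: cost_witness_def diff_divide_distrib)
  have "cost_witness - ?P = complex_of_real (1 / 2) \<cdot>\<^sub>m ketbra \<delta>"
    using P \<delta> by (intro eq_matI) (auto simp: Y_index ketbra_def)
  then have "psd 9 (cost_witness - ?P)" using psd_smult[OF psd_ketbra[OF \<delta>], of "1 / 2"] by simp
  moreover have "cost_witness + ?P = (ketbra (prod_vec f (conj_vec3 g)) + ketbra (prod_vec g (conj_vec3 f)))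
      + (ketbra (prod_vec f (conj_vec3 e)) + ketbra (prod_vec e (conj_vec3 f))) + complex_of_real (1 / 2) \<cdot>\<^sub>m ketbra z"
    (is "_ = ?Z")
  proof (rule eq_matI)
    fix r c assume "r < dim_row ?Z" "c < dim_col ?Z"
    then have rc: "r < 9" "c < 9" using z by (auto simp: ketbra_def)
    \<comment> \<open>By completeness, \<delta> is the sum of |ff>, |gg> and |ee> with Bob's factors
      conjugated; this also gives z = 2 |ff> - \<delta>.\<close>
    have d: "\<delta> $ s = f (s div 3) * cnj (f (s mod 3)) + g (s div 3) * cnj (g (s mod 3)) + e (s div 3) * cnj (e (s mod 3))"
      if "s < 9" for s
      using complete[of "s div 3" "s mod 3"] that by (simp add: \<delta>_def)
    have "(cost_witness + ?P) $$ (r, c) = \<delta> $ r * cnj (\<delta> $ c) / 2 + 2 * ?P $$ (r, c)"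
      using rc P by (simp add: Y_index)
    also have "\<dots> = ?Z $$ (r, c)"
      using rc carrier_vecD[OF z]
      by (simp add: P_index partial_transpose_ketbra_wedge_index prod_vec_index ketbra_index conj_vec3_def z_def d)
        (simp add: field_simps)
    finally show "(cost_witness + ?P) $$ (r, c) = ?Z $$ (r, c)" .
  qed (use P z in \<open>auto simp: ketbra_def\<close>)
  then have "psd 9 (cost_witness + ?P)"
    using psd_add[OF psd_add[OF psd_add[OF psd_prod psd_prod] psd_add[OF psd_prod psd_prod]]
        psd_smult[OF psd_ketbra[OF z], of "1 / 2"]] by simp
  ultimately show ?thesis using P cost_witness_carrier by (simp add: dominated_def)
qed

text \<open>Transposing back leaves 1/2 - E with a rank-one projection E, whose eigenvalues are 1/2
  and -1/2; the gaps are E and 1 - E.\<close>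

lemma dominated_transpose_cost_witness:
  "dominated (3 * 3) (partial_transpose 3 3 cost_witness) ((1 / 2) \<cdot>\<^sub>m 1\<^sub>m (3 * 3))"
proof -
  let ?E = "ketbra (wedge g e)"
  have E: "?E \<in> carrier_mat 9 9" by (rule ketbra_carrier) simp
  have one: "partial_transpose 3 3 (1\<^sub>m 9) = 1\<^sub>m 9"
  proof (rule eq_matI)
    fix r c assume "r < dim_row (1\<^sub>m 9 :: complex mat)" "c < dim_col (1\<^sub>m 9 :: complex mat)"
    then have rc: "r < 9" "c < 9" by auto
    have "cross_index 3 r c = cross_index 3 c r \<longleftrightarrow> r = c"
      using cross_index_three[OF rc] cross_index_three[OF rc(2,1)] by (metis div_mult_mod_eq)
    then show "partial_transpose 3 3 (1\<^sub>m 9) $$ (r, c) = 1\<^sub>m 9 $$ (r, c)"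
      using rc cross_index_three[OF rc] cross_index_three[OF rc(2,1)]
      by (simp add: partial_transpose_index)
  qed (auto simp: partial_transpose_def)
  have pt: "partial_transpose 3 3 cost_witness = complex_of_real (1 / 2) \<cdot>\<^sub>m 1\<^sub>m 9 - ?E"
    unfolding cost_witness_def
    using E partial_transpose_carrier[of 3 3 ?E] partial_transpose_involution[of ?E 3 3]
    by (simp add: partial_transpose_minus partial_transpose_smult one)
  have idem: "?E * ?E = ?E"
    by (intro eq_matI; simp add: ketbra_mult[of _ 9] inner_wedge orthonormal ketbra_index; simp add: ketbra_def)
  have "(1 / 2) \<cdot>\<^sub>m 1\<^sub>m 9 - partial_transpose 3 3 cost_witness = ?E"
    unfolding pt using E by (intro eq_matI) auto
  moreover have "(1 / 2) \<cdot>\<^sub>m 1\<^sub>m 9 + partial_transpose 3 3 cost_witness = 1\<^sub>m 9 - ?E"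
    unfolding pt using E by (intro eq_matI) auto
  moreover have "psd 9 ?E" by (rule psd_ketbra) simp
  moreover have "psd 9 (1\<^sub>m 9 - ?E)"
    by (rule psd_one_minus_projection[OF E mat_adjoint_ketbra idem])
  ultimately show ?thesis
    using partial_transpose_carrier[of 3 3 cost_witness] by (simp add: dominated_def)
qed

section \<open>Exact dilution by random local isometries\<close>

lemma local_op_Phi:
  assumes q: "0 \<le> q"
  shows "local_op (sqrt q) (case_nat x (\<lambda>_. y)) (case_nat y (\<lambda>_ i. - x i)) * Phi
      * mat_adjoint (local_op (sqrt q) (case_nat x (\<lambda>_. y)) (case_nat y (\<lambda>_ i. - x i)))
    = complex_of_real q \<cdot>\<^sub>m ketbra (wedge x y)" (is "?K * Phi * _ = ?R")
proof (rule eq_matI)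
  have K: "?K \<in> carrier_mat 9 4" by (simp add: local_op_def)
  fix r c assume "r < dim_row ?R" "c < dim_col ?R"
  then have rc: "r < 9" "c < 9" by (auto simp: ketbra_def)
  \<comment> \<open>Alice sends |0>, |1> to x, y and Bob sends them to y, -x, so |00> + |11> becomes
    xy - yx. Only the columns 0 and 3, those of |00> and |11>, meet the support of \<Phi>.\<close>
  have Krow: "?K $$ (s, 0) + ?K $$ (s, 3) = complex_of_real (sqrt q) * (x (s div 3) * y (s mod 3) - y (s div 3) * x (s mod 3))"
    if "s < 9" for s
    using that by (simp add: local_op_def algebra_simps)
  have qq: "complex_of_real (sqrt q) * complex_of_real (sqrt q) = complex_of_real q"
    unfolding of_real_mult[symmetric] using q by simp
  have "(?K * Phi * mat_adjoint ?K) $$ (r, c) = (\<Sum>s<4. \<Sum>t<4. ?K $$ (r, s) * Phi $$ (s, t) * cnj (?K $$ (c, t)))"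
    using Phi_carrier rc by (intro congruence_index[OF K]) auto
  also have "\<dots> = (?K $$ (r, 0) + ?K $$ (r, 3)) * cnj (?K $$ (c, 0) + ?K $$ (c, 3)) / 2"
    by (simp add: sum_lessThan_4 Phi_eq field_simps)
  also have "\<dots> = (complex_of_real (sqrt q) * complex_of_real (sqrt q))
      * ((x (r div 3) * y (r mod 3) - y (r div 3) * x (r mod 3)) * cnj (x (c div 3) * y (c mod 3) - y (c div 3) * x (c mod 3)) / 2)"
    unfolding Krow[OF rc(1)] Krow[OF rc(2)] by simp
  also have "\<dots> = ?R $$ (r, c)"
  proof -
    have "?R $$ (r, c) = complex_of_real q * ketbra (wedge x y) $$ (r, c)"
      using rc carrier_matD[OF ketbra_carrier[OF wedge_carrier(1)]] by simp
    then show ?thesis unfolding qq ketbra_wedge_index[OF rc] ..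
  qed
  finally show "(?K * Phi * mat_adjoint ?K) $$ (r, c) = ?R $$ (r, c)" .
qed (auto simp: local_op_def ketbra_def)

text \<open>Both local factors are isometries, so the Gram matrix is q times the identity; the
  weights p and 1 - p will then add up to a trace-preserving map.\<close>

lemma local_op_gram:
  assumes q: "0 \<le> q" and xy: "inner3 x x = 1" "inner3 y y = 1" "inner3 x y = 0" "inner3 y x = 0"
    and st: "s < 4" "t < 4"
  shows "(mat_adjoint (local_op (sqrt q) (case_nat x (\<lambda>_. y)) (case_nat y (\<lambda>_ i. - x i)))
      * local_op (sqrt q) (case_nat x (\<lambda>_. y)) (case_nat y (\<lambda>_ i. - x i))) $$ (s, t)
    = (if s = t then complex_of_real q else 0)" (is "(mat_adjoint ?K * ?K) $$ _ = _")
proof -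
  let ?A = "case_nat x (\<lambda>_. y)" and ?B = "case_nat y (\<lambda>_ i. - x i)"
  have K: "?K \<in> carrier_mat 9 4" by (simp add: local_op_def)
  have qq: "complex_of_real (sqrt q) * complex_of_real (sqrt q) = complex_of_real q"
    unfolding of_real_mult[symmetric] using q by simp
  have "(mat_adjoint ?K * ?K) $$ (s, t) = (\<Sum>r<9. cnj (?K $$ (r, s)) * ?K $$ (r, t))"
    using K st by (subst mat_mult_index[OF mat_adjoint_carrier[OF K] K]) auto
  also have "\<dots> = (\<Sum>r<9. (complex_of_real (sqrt q) * complex_of_real (sqrt q)) *
      ((?A (t div 2) (r div 3) * cnj (?A (s div 2) (r div 3))) * (?B (t mod 2) (r mod 3) * cnj (?B (s mod 2) (r mod 3)))))"
    using st by (intro sum.cong refl) (simp add: local_op_def)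
  also have "\<dots> = complex_of_real q * (inner3 (?A (t div 2)) (?A (s div 2)) * inner3 (?B (t mod 2)) (?B (s mod 2)))"
    unfolding qq sum_distrib_left[symmetric] inner3_def
      sum_prod_index[of "\<lambda>i. ?A (t div 2) i * cnj (?A (s div 2) i)" "\<lambda>i. ?B (t mod 2) i * cnj (?B (s mod 2) i)"] ..
  also have "\<dots> = (if s = t then complex_of_real q else 0)"
  proof -
    have neg: "inner3 (\<lambda>i. - u i) v = - inner3 u v" "inner3 u (\<lambda>i. - v i) = - inner3 u v" for u v
      by (simp_all add: inner3_def sum_negf)
    have "s \<in> {0, 1, 2, 3}" "t \<in> {0, 1, 2, 3}" using st by (auto simp: less_four)
    then show ?thesis by (auto simp: xy neg)
  qed
  finally show ?thesis .
qed

lemma mixture_dilution: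
  assumes p: "0 < p" "p < 1"
  shows "\<exists>L. ppt_operation (2 ^ n) (2 ^ n) (3 ^ n) (3 ^ n) L
           \<and> L (tensor_power 2 2 Phi n) = tensor_power 3 3 (mixture p) n"
proof -
  define K where "K i = (case i of 0 \<Rightarrow> local_op (sqrt p) (case_nat f (\<lambda>_. g)) (case_nat g (\<lambda>_ i. - f i))
     | Suc _ \<Rightarrow> local_op (sqrt (1 - p)) (case_nat f (\<lambda>_. e)) (case_nat e (\<lambda>_ i. - f i)))" for i
  define K' where "K' i = (case i of 0 \<Rightarrow> local_op (sqrt p) (case_nat f (\<lambda>_. g)) (\<lambda>s. conj_vec3 (case_nat g (\<lambda>_ i. - f i) s))
     | Suc _ \<Rightarrow> local_op (sqrt (1 - p)) (case_nat f (\<lambda>_. e)) (\<lambda>s. conj_vec3 (case_nat e (\<lambda>_ i. - f i) s)))" for i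
  have Kc: "K i \<in> carrier_mat 9 4" for i by (simp add: K_def local_op_def split: nat.split)
  have partner: "transpose_partner 2 2 3 3 (K i) (K' i)" for i
    unfolding K_def K'_def by (cases i) (simp_all add: transpose_partner_local_op)
  have "kraus_map 2 (\<lambda>i. mat_adjoint (K i)) 4 (1\<^sub>m 9) = 1\<^sub>m 4"
  proof (rule eq_matI)
    fix s t assume "s < dim_row (1\<^sub>m 4 :: complex mat)" "t < dim_col (1\<^sub>m 4 :: complex mat)"
    then have st: "s < 4" "t < 4" by auto
    have K1: "mat_adjoint (K i) * 1\<^sub>m 9 * mat_adjoint (mat_adjoint (K i)) = mat_adjoint (K i) * K i" for i
      using Kc[of i] by simp
    have "kraus_map 2 (\<lambda>i. mat_adjoint (K i)) 4 (1\<^sub>m 9) $$ (s, t)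
        = (mat_adjoint (K 0) * K 0) $$ (s, t) + (mat_adjoint (K 1) * K 1) $$ (s, t)"
      unfolding kraus_map_def K1 using st by (simp add: numeral_2_eq_2 del: index_mult_mat)
    also have "\<dots> = (if s = t then complex_of_real p else 0) + (if s = t then complex_of_real (1 - p) else 0)"
    proof -
      have "(mat_adjoint (K 0) * K 0) $$ (s, t) = (if s = t then complex_of_real p else 0)"
        unfolding K_def nat.case(1) using p by (intro local_op_gram orthonormal st) simp
      moreover have "(mat_adjoint (K 1) * K 1) $$ (s, t) = (if s = t then complex_of_real (1 - p) else 0)"
        unfolding K_def One_nat_def nat.case(2) using p by (intro local_op_gram orthonormal st) simp
      ultimately show ?thesis by simp
    qed
    also have "\<dots> = 1\<^sub>m 4 $$ (s, t)" using st by simp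
    finally show "kraus_map 2 (\<lambda>i. mat_adjoint (K i)) 4 (1\<^sub>m 9) $$ (s, t) = 1\<^sub>m 4 $$ (s, t)" .
  qed (auto simp: kraus_map_def)
  then have one: "kraus_map 2 (\<lambda>i. mat_adjoint (K i)) (2 * 2) (1\<^sub>m (3 * 3)) = 1\<^sub>m (2 * 2)" by simp
  have "kraus_map 2 K 9 Phi = mixture p"
  proof (rule eq_matI)
    fix r c assume "r < dim_row (mixture p)" "c < dim_col (mixture p)"
    then have rc: "r < 9" "c < 9" using mixture_carrier[of p] by auto
    have K0: "K 0 * Phi * mat_adjoint (K 0) = complex_of_real p \<cdot>\<^sub>m ketbra (wedge f g)"
      unfolding K_def nat.case(1) using p by (intro local_op_Phi) simp
    have K1: "K 1 * Phi * mat_adjoint (K 1) = complex_of_real (1 - p) \<cdot>\<^sub>m ketbra (wedge f e)"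
      unfolding K_def One_nat_def nat.case(2) using p by (intro local_op_Phi) simp
    have "kraus_map 2 K 9 Phi $$ (r, c) = (K 0 * Phi * mat_adjoint (K 0)) $$ (r, c) + (K 1 * Phi * mat_adjoint (K 1)) $$ (r, c)"
      unfolding kraus_map_def using rc by (simp add: numeral_2_eq_2 del: index_mult_mat)
    also have "\<dots> = mixture p $$ (r, c)"
      unfolding K0 K1 mixture_def using rc carrier_matD[OF ketbra_carrier[OF wedge_carrier(1)]] by simp
    finally show "kraus_map 2 K 9 Phi $$ (r, c) = mixture p $$ (r, c)" .
  qed (use mixture_carrier in \<open>auto simp: kraus_map_def\<close>)
  then show ?thesis
    using ppt_operation_kraus_power[OF partner one, of n] Phi_carrier by auto
qed

lemma mixture_irreversible:
  assumes p: "0 < p" "p < 1"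
  shows "E_D 3 3 (mixture p) < 1" "E_C 3 3 (mixture p) = 1"
proof -
  have rho: "psd (3 * 3) (mixture p)"
    unfolding mixture_def using p by (intro psd_add psd_smult psd_ketbra) auto
  \<comment> \<open>The strict gap below 2 is due to genuine mixing, p (1 - p) > 0.\<close>
  have "p\<^sup>2 + (1 - p)\<^sup>2 < 1"
  proof -
    have "p\<^sup>2 + (1 - p)\<^sup>2 = 1 - 2 * (p * (1 - p))" by (simp add: power2_eq_square algebra_simps)
    then show ?thesis using mult_pos_pos[of p "1 - p"] p by simp
  qed
  then have N: "0 < 1 + sqrt (p\<^sup>2 + (1 - p)\<^sup>2)" "1 + sqrt (p\<^sup>2 + (1 - p)\<^sup>2) < 2"
    by (auto intro: add_pos_nonneg)
  show "E_D 3 3 (mixture p) < 1"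
    using mixture_transpose_dominated[OF p] distillable_entanglement_less_one[OF rho _ _ N] by blast
  have "mat_trace (support_proj * mixture p) = 1"
  proof -
    have "mat_trace (mixture p) = complex_of_real p * mat_trace (ketbra (wedge f g)) + complex_of_real (1 - p) * mat_trace (ketbra (wedge f e))"
      unfolding mixture_def using ketbra_carrier[OF wedge_carrier(1)]
      by (simp add: mat_trace_add[of _ 9] mat_trace_smult[of _ 9])
    then show ?thesis
      unfolding support_proj_mixture by (simp add: mat_trace_ketbra[of _ 9] inner_wedge orthonormal)
  qed
  then show "E_C 3 3 (mixture p) = 1"
    using psd_support_proj
    by (intro entanglement_cost_eq_one[OF _ _ rho _ dominated_support_proj _ dominated_transpose_support_proj
          dominated_transpose_cost_witness mixture_dilution[OF p]]) auto
qed

end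

section \<open>Choice of the basis for the given vectors\<close>

theorem proposition5:
  fixes \<rho> :: "complex mat" and u1 u2 a b :: "complex vec" and p :: real
  assumes "is_state (3 * 3) \<rho>"
    and "0 < p" and "p < 1"
    and "a \<in> carrier_vec 3" and "b \<in> carrier_vec 3"
    and "u1 = complex_of_real (1 / sqrt 2) \<cdot>\<^sub>v
      (tensor_vec (unit_vec 3 0) (unit_vec 3 1) - tensor_vec (unit_vec 3 1) (unit_vec 3 0))"
    and "u2 = complex_of_real (1 / sqrt 2) \<cdot>\<^sub>v (tensor_vec a b - tensor_vec b a)"
    and "u2 \<bullet>c u2 = 1"
    and "u2 \<bullet>c u1 = 0"
    and "\<rho> = complex_of_real p \<cdot>\<^sub>m ketbra u1 + complex_of_real (1 - p) \<cdot>\<^sub>m ketbra u2"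
  shows "E_D 3 3 \<rho> < 1 \<and> 1 = E_C 3 3 \<rho>"
proof -
  let ?\<alpha> = "a $ 0 * b $ 2 - a $ 2 * b $ 0" and ?\<beta> = "a $ 1 * b $ 2 - a $ 2 * b $ 1"
  define \<alpha> where "\<alpha> = ?\<alpha>"
  define \<beta> where "\<beta> = ?\<beta>"
  \<comment> \<open>Orthogonality to u1, the wedge of the first two basis vectors, kills the
    01-minor of (a, b). What remains of the wedge of a and b is \<alpha> e0 \<and> e2 + \<beta> e1
    \<and> e2 = (\<alpha> e0 + \<beta> e1) \<and> e2, which dictates f and e. The vector g completes
    f to an orthonormal basis of the plane of u1, with the phase for which the wedge of f and g is
    u1 itself.\<close>
  define f :: vec3 where "f i = (if i = 0 then \<alpha> else if i = 1 then \<beta> else 0)" for i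
  define g :: vec3 where "g i = (if i = 0 then - cnj \<beta> else if i = 1 then cnj \<alpha> else 0)" for i
  define e :: vec3 where "e i = (if i = 2 then 1 else 0)" for i
  let ?e = "\<lambda>k i. if i = k then 1 else 0 :: complex"
  have tv: "tensor_vec v w = prod_vec (($) v) (($) w)" if "v \<in> carrier_vec 3" "w \<in> carrier_vec 3" for v w
    using that by (intro eq_vecI) (auto simp: tensor_vec_def prod_vec_def)
  have u1: "u1 = wedge (?e 0) (?e 1)"
    unfolding assms(6) wedge_eq
    by (simp add: tv) (auto simp: prod_vec_def intro!: eq_vecI)
  have u2: "u2 = wedge (($) a) (($) b)"
    unfolding assms(7) wedge_eq by (simp add: tv assms(4,5))
  have inner3_expand: "inner3 x y = x 0 * cnj (y 0) + x 1 * cnj (y 1) + x 2 * cnj (y 2)" for x y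
    by (simp add: inner3_def numeral_eq_Suc)
  have c01: "a $ 0 * b $ 1 - a $ 1 * b $ 0 = 0"
    using assms(9) unfolding u1 u2 inner_wedge inner3_expand by simp
  \<comment> \<open>Lagrange's identity: the squared norm of u2 is the sum of the squared moduli of
    the three 2 x 2 minors of (a, b).\<close>
  have norm: "\<alpha> * cnj \<alpha> + \<beta> * cnj \<beta> = 1"
  proof -
    have "u2 \<bullet>c u2 = (a $ 0 * b $ 1 - a $ 1 * b $ 0) * cnj (a $ 0 * b $ 1 - a $ 1 * b $ 0)
        + ?\<alpha> * cnj ?\<alpha> + ?\<beta> * cnj ?\<beta>"
      unfolding u2 inner_wedge inner3_expand by (simp add: algebra_simps)
    then show ?thesis using assms(8) c01 by (simp add: \<alpha>_def \<beta>_def)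
  qed
  have norm': "cnj \<beta> * \<beta> + cnj \<alpha> * \<alpha> = 1" "\<alpha> * cnj \<alpha> + cnj \<beta> * \<beta> = 1"
    using norm by (simp_all add: ac_simps)
  have nine: "r < 9 \<longleftrightarrow> r \<in> {0, 1, 2, 3, 4, 5, 6, 7, 8 :: nat}" for r by auto
  have U1: "u1 = wedge f g"
  proof (rule eq_vecI)
    fix r assume "r < dim_vec (wedge f g)"
    then have "r \<in> {0, 1, 2, 3, 4, 5, 6, 7, 8}" by (simp add: nine)
    then show "u1 $ r = wedge f g $ r"
      unfolding u1 by (auto simp: wedge_def f_def g_def algebra_simps)
        (simp_all add: norm flip: add_divide_distrib)
  qed (simp add: u1)
  have U2: "u2 = wedge f e"
  proof (rule eq_vecI)
    fix r assume "r < dim_vec (wedge f e)"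
    then have "r \<in> {0, 1, 2, 3, 4, 5, 6, 7, 8}" by (simp add: nine)
    then show "u2 $ r = wedge f e $ r"
      unfolding u2 using c01 by (auto simp: wedge_def f_def e_def \<alpha>_def \<beta>_def algebra_simps diff_divide_distrib
        simp flip: numeral_2_eq_2)
  qed (simp add: u2)
  have complete: "f i * cnj (f j) + g i * cnj (g j) + e i * cnj (e j) = (if i = j then 1 else 0)"
    if "i < 3" "j < 3" for i j
  proof -
    have "i \<in> {0, 1, 2}" "j \<in> {0, 1, 2}" using that by auto
    then show ?thesis using norm norm' by (auto simp: f_def g_def e_def ac_simps)
  qed
  have orthonormal: "inner3 f f = 1" "inner3 g g = 1" "inner3 e e = 1" "inner3 f g = 0" "inner3 g f = 0"
      "inner3 f e = 0" "inner3 e f = 0" "inner3 g e = 0" "inner3 e g = 0"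
    unfolding inner3_expand using norm norm' by (auto simp: f_def g_def e_def ac_simps)
  have "\<rho> = mixture f g e p"
    unfolding assms(10) U1 U2 by (simp add: mixture_def[OF complete orthonormal])
  then show ?thesis using mixture_irreversible[OF complete orthonormal assms(2,3)] by simp
qed

end
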